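(* Let $p$ be a prime and let $\mathcal{F}$ be a saturated fusion system over a discrete $p$-toral group $S$. Then there exists a faithful unitary representation of $S$ which is fusion-preserving (that is, $\mathcal{F}$-invariant).
   Context: Discrete $p$-toral groups. Let $\mathbb{Z}/p^\infty=\bigcup_n\mathbb{Z}/p^n$. A discrete $p$-toral group is a group $P$ with a normal subgroup $P_0\cong(\mathbb{Z}/p^\infty)^k$ (its identity component, the subgroup of infinitely $p$-divisible elements) such that $P/P_0$ is a finite $p$-group. Put $|P|=(k,|P/P_0|)\in\mathbb{N}^2$, ordered lexicographically. Fusion systems. For subgroups $P,Q\le S$, $\mathrm{Inj}(P,Q)$ is the set of injective homomorphisms, $\mathrm{Hom}_S(P,Q)$ the set of homomorphisms induced by conjugation by elements of $S$, $\mathrm{Aut}_S(P)=\mathrm{Hom}_S(P,P)$ and $\mathrm{Inn}(P)$ the group of inner automorphisms. A fusion system $\mathcal{F}$ over a discrete $p$-toral group $S$ is a category whose objects are the subgroups of $S$, whose morphism sets satisfy $\mathrm{Hom}_S(P,Q)\subseteq\mathrm{Hom}_{\mathcal{F}}(P,Q)\subseteq\mathrm{Inj}(P,Q)$, and in which every morphism factors as an isomorphism in $\mathcal{F}$ followed by an inclusion. Subgroups isomorphic in $\mathcal{F}$ are called $\mathcal{F}$-conjugate. Put $\mathrm{Out}_{\mathcal{F}}(P)=\mathrm{Aut}_{\mathcal{F}}(P)/\mathrm{Inn}(P)$ and $\mathrm{Out}_S(P)=\mathrm{Aut}_S(P)/\mathrm{Inn}(P)$. $P$ is fully centralized (resp.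 fully normalized) if $|C_S(P)|\ge|C_S(P')|$ (resp. $|N_S(P)|\ge|N_S(P')|$) for all $P'$ $\mathcal{F}$-conjugate to $P$. $\mathcal{F}$ is saturated if: (I) every fully normalized $P$ is fully centralized, $\mathrm{Out}_{\mathcal{F}}(P)$ is finite and $\mathrm{Out}_S(P)$ is a Sylow $p$-subgroup of $\mathrm{Out}_{\mathcal{F}}(P)$; (II) if $\phi\in\mathrm{Hom}_{\mathcal{F}}(P,S)$ has $\phi(P)$ fully centralized, and $N_\phi=\{g\in N_S(P)\mid\phi c_g\phi^{-1}\in\mathrm{Aut}_S(\phi(P))\}$, where $c_g(x)=gxg^{-1}$, then $\phi$ extends to some $\bar\phi\in\mathrm{Hom}_{\mathcal{F}}(N_\phi,S)$; (III) if $P_1\le P_2\le\cdots$ are subgroups of $S$, $P_\infty=\bigcup_nP_n$, and $\phi\in\mathrm{Hom}(P_\infty,S)$ satisfies $\phi|_{P_n}\in\mathrm{Hom}_{\mathcal{F}}(P_n,S)$ for all $n$, then $\phi\in\mathrm{Hom}_{\mathcal{F}}(P_\infty,S)$. Invariance. Representations are finite-dimensional complex. A representation $\rho\colon S\to GL(V)$ is fusion-preserving, or $\mathcal{F}$-invariant, if for every $P\le S$ and every $f\in\mathrm{Hom}_{\mathcal{F}}(P,S)$ the representations $\rho|_P$ and $\rho|_{f(P)}\circ f$ of $P$ are isomorphic. *)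

theory Defs
  imports
    "HOL-Algebra.Algebra"
    "Jordan_Normal_Form.Schur_Decomposition"
begin

section \<open>Discrete $p$-toral groups\<close>

text \<open>The group $\mathbb{Z}/p^\infty$ is realised multiplicatively: the cyclic group of order
  $p^n$ is the group of complex roots of unity of order dividing $p^n$, and the union is taken
  over all $n$.\<close>

definition prufer_group :: "nat \<Rightarrow> complex monoid" where
  "prufer_group p = \<lparr>carrier = (\<Union>n. {z. z ^ (p ^ n) = 1}), monoid.mult = (*), one = 1\<rparr>"

definition toral_group :: "nat \<Rightarrow> nat \<Rightarrow> (nat \<Rightarrow> complex) monoid" where
  "toral_group p k = product_group {..<k} (\<lambda>_. prufer_group p)"

definition finite_p_group :: "nat \<Rightarrow> ('a, 'b) monoid_scheme \<Rightarrow> bool" where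
  "finite_p_group p G \<longleftrightarrow> group G \<and> finite (carrier G) \<and> (\<exists>m. Coset.order G = p ^ m)"

definition discrete_p_toral :: "nat \<Rightarrow> ('a, 'b) monoid_scheme \<Rightarrow> bool" where
  "discrete_p_toral p G \<longleftrightarrow> group G \<and>
     (\<exists>P\<^sub>0 k. P\<^sub>0 \<lhd> G \<and> G\<lparr>carrier := P\<^sub>0\<rparr> \<cong> toral_group p k \<and> finite_p_group p (G Mod P\<^sub>0))"

text \<open>If \<open>G\<close> is discrete $p$-toral, the normal subgroup in the preceding definition is necessarily
  the set of infinitely $p$-divisible elements: it is divisible, and an element with a
  $p^n$-th root for \<open>p ^ n = |G / P\<^sub>0|\<close> lies in it. Its rank \<open>k\<close> is also unique, since it has
  exactly $p^k$ elements of order dividing $p$.\<close>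

definition identity_component :: "nat \<Rightarrow> ('a, 'b) monoid_scheme \<Rightarrow> 'a set" where
  "identity_component p G =
     {x \<in> carrier G. \<forall>n. \<exists>y \<in> carrier G. y [^]\<^bsub>G\<^esub> (p ^ n :: nat) = x}"

definition toral_rank :: "nat \<Rightarrow> ('a, 'b) monoid_scheme \<Rightarrow> nat" where
  "toral_rank p G = (THE k. G\<lparr>carrier := identity_component p G\<rparr> \<cong> toral_group p k)"

definition toral_size :: "nat \<Rightarrow> ('a, 'b) monoid_scheme \<Rightarrow> nat \<times> nat" where
  "toral_size p G = (toral_rank p G, Coset.order (G Mod identity_component p G))"

text \<open>The lexicographic order, written out so as not to fix an order instance on pairs.\<close>

definition size_le :: "nat \<times> nat \<Rightarrow> nat \<times> nat \<Rightarrow> bool" where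
  "size_le a b \<longleftrightarrow> fst a < fst b \<or> fst a = fst b \<and> snd a \<le> snd b"


section \<open>Fusion systems\<close>

definition conj_map :: "('a, 'b) monoid_scheme \<Rightarrow> 'a set \<Rightarrow> 'a \<Rightarrow> 'a \<Rightarrow> 'a" where
  "conj_map S P g = (\<lambda>x\<in>P. g \<otimes>\<^bsub>S\<^esub> x \<otimes>\<^bsub>S\<^esub> inv\<^bsub>S\<^esub> g)"

definition Hom_conj :: "('a, 'b) monoid_scheme \<Rightarrow> 'a set \<Rightarrow> 'a set \<Rightarrow> ('a \<Rightarrow> 'a) set" where
  "Hom_conj S P Q = {conj_map S P g | g. g \<in> carrier S \<and> conj_map S P g ` P \<subseteq> Q}"

text \<open>Homomorphisms defined on a subgroup \<open>P\<close> are represented by functions that are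
  extensional on \<open>P\<close>, so that equality of morphisms is equality of functions.\<close>

definition Inj_hom :: "('a, 'b) monoid_scheme \<Rightarrow> 'a set \<Rightarrow> 'a set \<Rightarrow> ('a \<Rightarrow> 'a) set" where
  "Inj_hom S P Q = mon (S\<lparr>carrier := P\<rparr>) (S\<lparr>carrier := Q\<rparr>) \<inter> extensional P"

text \<open>A family \<open>F\<close> of morphism sets is indexed by source and target; only its values at
  subgroups of \<open>S\<close> matter.\<close>

type_synonym 'a mor_sets = "'a set \<Rightarrow> 'a set \<Rightarrow> ('a \<Rightarrow> 'a) set"

definition F_iso :: "'a mor_sets \<Rightarrow> 'a set \<Rightarrow> 'a set \<Rightarrow> ('a \<Rightarrow> 'a) set" where
  "F_iso F P Q = {\<phi> \<in> F P Q. \<exists>\<psi> \<in> F Q P.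
     compose P \<psi> \<phi> = (\<lambda>x\<in>P. x) \<and> compose Q \<phi> \<psi> = (\<lambda>x\<in>Q. x)}"

text \<open>Identities need not be required separately: they are conjugations by the unit.\<close>

definition fusion_system :: "nat \<Rightarrow> ('a, 'b) monoid_scheme \<Rightarrow> 'a mor_sets \<Rightarrow> bool" where
  "fusion_system p S F \<longleftrightarrow> discrete_p_toral p S \<and>
     (\<forall>P Q. subgroup P S \<longrightarrow> subgroup Q S \<longrightarrow>
        Hom_conj S P Q \<subseteq> F P Q \<and> F P Q \<subseteq> Inj_hom S P Q) \<and>
     (\<forall>P Q R. subgroup P S \<longrightarrow> subgroup Q S \<longrightarrow> subgroup R S \<longrightarrow>
        (\<forall>\<phi> \<in> F P Q. \<forall>\<psi> \<in> F Q R. compose P \<psi> \<phi> \<in> F P R)) \<and>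
     (\<forall>P Q. subgroup P S \<longrightarrow> subgroup Q S \<longrightarrow> (\<forall>\<phi> \<in> F P Q.
        \<exists>R \<psi>. subgroup R S \<and> R \<subseteq> Q \<and> \<psi> \<in> F_iso F P R \<and> \<phi> = compose P (\<lambda>x\<in>R. x) \<psi>))"

definition F_conjugate ::
  "('a, 'b) monoid_scheme \<Rightarrow> 'a mor_sets \<Rightarrow> 'a set \<Rightarrow> 'a set \<Rightarrow> bool" where
  "F_conjugate S F P Q \<longleftrightarrow> subgroup P S \<and> subgroup Q S \<and> F_iso F P Q \<noteq> {}"

definition centralizer :: "('a, 'b) monoid_scheme \<Rightarrow> 'a set \<Rightarrow> 'a set" where
  "centralizer S P = {g \<in> carrier S. \<forall>x\<in>P. g \<otimes>\<^bsub>S\<^esub> x = x \<otimes>\<^bsub>S\<^esub> g}"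

definition fully_centralized ::
  "nat \<Rightarrow> ('a, 'b) monoid_scheme \<Rightarrow> 'a mor_sets \<Rightarrow> 'a set \<Rightarrow> bool" where
  "fully_centralized p S F P \<longleftrightarrow> (\<forall>P'. F_conjugate S F P P' \<longrightarrow>
     size_le (toral_size p (S\<lparr>carrier := centralizer S P'\<rparr>))
             (toral_size p (S\<lparr>carrier := centralizer S P\<rparr>)))"

definition fully_normalized ::
  "nat \<Rightarrow> ('a, 'b) monoid_scheme \<Rightarrow> 'a mor_sets \<Rightarrow> 'a set \<Rightarrow> bool" where
  "fully_normalized p S F P \<longleftrightarrow> (\<forall>P'. F_conjugate S F P P' \<longrightarrow>
     size_le (toral_size p (S\<lparr>carrier := normalizer S P'\<rparr>))
             (toral_size p (S\<lparr>carrier := normalizer S P\<rparr>)))"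

definition Inn_group :: "('a, 'b) monoid_scheme \<Rightarrow> 'a set \<Rightarrow> ('a \<Rightarrow> 'a) set" where
  "Inn_group S P = {conj_map S P g | g. g \<in> P}"

text \<open>\<open>Out_quot S P A\<close> is \<open>A / Inn P\<close> for a group \<open>A\<close> of automorphisms of \<open>P\<close>
  containing \<open>Inn P\<close>.\<close>

definition Out_quot ::
  "('a, 'b) monoid_scheme \<Rightarrow> 'a set \<Rightarrow> ('a \<Rightarrow> 'a) set \<Rightarrow> ('a \<Rightarrow> 'a) set monoid" where
  "Out_quot S P A = ((AutoGroup (S\<lparr>carrier := P\<rparr>))\<lparr>carrier := A\<rparr>) Mod Inn_group S P"

definition Out_F ::
  "('a, 'b) monoid_scheme \<Rightarrow> 'a mor_sets \<Rightarrow> 'a set \<Rightarrow> ('a \<Rightarrow> 'a) set monoid" where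
  "Out_F S F P = Out_quot S P (F_iso F P P)"

definition Out_S :: "('a, 'b) monoid_scheme \<Rightarrow> 'a set \<Rightarrow> ('a \<Rightarrow> 'a) set monoid" where
  "Out_S S P = Out_quot S P (Hom_conj S P P)"

definition sylow_subgroup :: "nat \<Rightarrow> 'a set \<Rightarrow> ('a, 'b) monoid_scheme \<Rightarrow> bool" where
  "sylow_subgroup p H G \<longleftrightarrow> subgroup H G \<and> card H = p ^ multiplicity p (Coset.order G)"

text \<open>\<open>N_ext S P \<phi>\<close> is the group $N_\phi$.\<close>

definition N_ext :: "('a, 'b) monoid_scheme \<Rightarrow> 'a set \<Rightarrow> ('a \<Rightarrow> 'a) \<Rightarrow> 'a set" where
  "N_ext S P \<phi> = {g \<in> normalizer S P.
     (\<lambda>y \<in> \<phi> ` P. \<phi> (conj_map S P g (inv_into P \<phi> y))) \<in> Hom_conj S (\<phi> ` P) (\<phi> ` P)}"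

definition saturated :: "nat \<Rightarrow> ('a, 'b) monoid_scheme \<Rightarrow> 'a mor_sets \<Rightarrow> bool" where
  "saturated p S F \<longleftrightarrow>
     (\<forall>P. subgroup P S \<longrightarrow> fully_normalized p S F P \<longrightarrow>
        fully_centralized p S F P \<and> finite (carrier (Out_F S F P)) \<and>
        sylow_subgroup p (carrier (Out_S S P)) (Out_F S F P)) \<and>
     (\<forall>P \<phi>. subgroup P S \<longrightarrow> \<phi> \<in> F P (carrier S) \<longrightarrow> fully_centralized p S F (\<phi> ` P) \<longrightarrow>
        (\<exists>\<phi>' \<in> F (N_ext S P \<phi>) (carrier S). \<forall>x\<in>P. \<phi>' x = \<phi> x)) \<and>
     (\<forall>(P :: nat \<Rightarrow> 'a set) \<phi>. (\<forall>n. subgroup (P n) S) \<longrightarrow> (\<forall>n. P n \<subseteq> P (Suc n)) \<longrightarrow>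
        \<phi> \<in> hom (S\<lparr>carrier := \<Union>n. P n\<rparr>) S \<inter> extensional (\<Union>n. P n) \<longrightarrow>
        (\<forall>n. restrict \<phi> (P n) \<in> F (P n) (carrier S)) \<longrightarrow>
        \<phi> \<in> F (\<Union>n. P n) (carrier S))"


section \<open>Unitary representations\<close>

text \<open>Finite-dimensional complex representations are taken on $\mathbb{C}^n$, with its
  standard Hermitian inner product.\<close>

definition GL :: "nat \<Rightarrow> complex mat monoid" where
  "GL n = units_of (ring_mat TYPE(complex) n ())"

definition representation :: "('a, 'b) monoid_scheme \<Rightarrow> nat \<Rightarrow> ('a \<Rightarrow> complex mat) \<Rightarrow> bool" where
  "representation G n \<rho> \<longleftrightarrow> \<rho> \<in> hom G (GL n)"

definition unitary_rep :: "('a, 'b) monoid_scheme \<Rightarrow> nat \<Rightarrow> ('a \<Rightarrow> complex mat) \<Rightarrow> bool" where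
  "unitary_rep G n \<rho> \<longleftrightarrow> representation G n \<rho> \<and>
     (\<forall>g \<in> carrier G. mat_adjoint (\<rho> g) * \<rho> g = 1\<^sub>m n \<and> \<rho> g * mat_adjoint (\<rho> g) = 1\<^sub>m n)"

definition faithful_rep :: "('a, 'b) monoid_scheme \<Rightarrow> ('a \<Rightarrow> complex mat) \<Rightarrow> bool" where
  "faithful_rep G \<rho> \<longleftrightarrow> inj_on \<rho> (carrier G)"

definition rep_isomorphic ::
  "('a, 'b) monoid_scheme \<Rightarrow> nat \<Rightarrow> ('a \<Rightarrow> complex mat) \<Rightarrow> ('a \<Rightarrow> complex mat) \<Rightarrow> bool" where
  "rep_isomorphic G n \<rho> \<sigma> \<longleftrightarrow> (\<exists>A \<in> carrier (GL n). \<forall>g \<in> carrier G. A * \<rho> g = \<sigma> g * A)"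

definition fusion_preserving ::
  "('a, 'b) monoid_scheme \<Rightarrow> 'a mor_sets \<Rightarrow> nat \<Rightarrow> ('a \<Rightarrow> complex mat) \<Rightarrow> bool" where
  "fusion_preserving S F n \<rho> \<longleftrightarrow> (\<forall>P. subgroup P S \<longrightarrow> (\<forall>f \<in> F P (carrier S).
     rep_isomorphic (S\<lparr>carrier := P\<rparr>) n \<rho> (\<rho> \<circ> f)))"

end

theory Submission
  imports Defs
begin

text \<open>Let \<open>T\<close> be the identity component of \<open>S\<close>, \<open>N = |S / T|\<close> and \<open>W = Aut\<^sub>F(T)\<close>. If \<open>h\<close> is the character of
  a representation of \<open>T\<close> which is \<open>W\<close>-invariant and vanishes at every element of \<open>T\<close> that is
  \<open>F\<close>-conjugate to an element outside \<open>T\<close>, then the character of the representation of \<open>S\<close> induced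
  from \<open>h\<close> is \<open>N h\<close> on \<open>T\<close> and \<open>0\<close> elsewhere, hence constant on \<open>F\<close>-conjugacy classes: elements of \<open>T\<close>
  that are \<open>F\<close>-conjugate are \<open>W\<close>-conjugate, because a conjugation onto a fully centralized target
  extends over \<open>T\<close>.

  To find \<open>h\<close>, let \<open>x\<close> lie outside \<open>T\<close> and let \<open>D\<^sub>x \<le> T\<close> be the image of the norm map
  \<open>t \<mapsto> \<Prod>i<N. x\<^sup>i t x\<^sup>-\<^sup>i\<close>. It is a divisible group commuting with \<open>x\<close>, it depends only on the coset \<open>x T\<close>
  and it contains \<open>x\<close> to the power \<open>N\<^sup>2\<close>. Suppose \<open>x\<close> is conjugate to an element \<open>t\<close> of \<open>T\<close> by a morphism defined
  on the centralizer of \<open>x\<close>. On \<open>D\<^sub>x\<close> this morphism agrees with some \<open>w \<in> W\<close>, so \<open>t\<close> lies outside \<open>w D\<^sub>x\<close>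
  while its power with exponent \<open>N\<^sup>2\<close> lies inside. As there are finitely many \<open>D\<^sub>x\<close> and \<open>w\<close>, a finite product of geometric sums
  \<open>1 + \<theta> + \<dots> + \<theta>\<^sup>q\<^sup>-\<^sup>1\<close> of linear characters \<open>\<theta>\<close> of \<open>T\<close> vanishes at all such \<open>t\<close>. Including the trivial group
  among the \<open>D\<^sub>x\<close> makes \<open>h\<close> vanish at the elements of order \<open>p\<close>, which gives faithfulness.\<close>

section \<open>Traces and normal forms of complex matrices\<close>

text \<open>Inducing from \<open>T\<close> gives a character that is zero off \<open>T\<close>,
  while fusion may carry an element outside \<open>T\<close> into \<open>T\<close>; so
  \<open>h\<close> has to vanish at all these images. They can form an infinite set, which no finite
  product can kill point by point. However, for each of the finitely many groups \<open>D\<close>,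
  the bad points fill only finitely many cosets of \<open>D\<close>, and a linear character trivial
  on \<open>D\<close> is constant on each of them.

  Subtracting that constant would give only a virtual character. The geometric sum is an actual
  character, it vanishes wherever the linear character takes a nontrivial \<open>q\<close>-th root
  of unity as value, and it equals \<open>q\<close> at the identity, so the product stays nonzero
  there.

  Isomorphism is deduced from equality of traces. As finite subsets of \<open>S\<close> lie in
  finite subgroups and the matrices have finite size, this reduces to finite groups, where a common
  constituent is split off repeatedly.

  Axiom (II) extends only morphisms with fully centralized image. Hence every subgroup needs a fully
  centralized conjugate, and this requires that the sizes of centralizers attain a maximum.\<close>

definition tr :: "complex mat \<Rightarrow> complex" where
  "tr A = (\<Sum>i<dim_row A. A $$ (i,i))"

lemma mult_mat_index:
  assumes "A \<in> carrier_mat n k" "B \<in> carrier_mat k m" "i < n" "j < m"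
  shows "(A * B) $$ (i,j) = (\<Sum>l<k. A $$ (i,l) * B $$ (l,j))"
  using assms by (auto simp: scalar_prod_def atLeast0LessThan)

lemma tr_comm:
  assumes "A \<in> carrier_mat n m" "B \<in> carrier_mat m n"
  shows "tr (A * B) = tr (B * A)"
proof -
  have "tr (A * B) = (\<Sum>i<n. \<Sum>l<m. A $$ (i,l) * B $$ (l,i))"
    unfolding tr_def using assms mult_mat_index[OF assms] by (intro sum.cong) auto
  also have "\<dots> = (\<Sum>l<m. \<Sum>i<n. B $$ (l,i) * A $$ (i,l))"
    by (subst sum.swap) (simp add: mult.commute)
  also have "\<dots> = tr (B * A)"
    unfolding tr_def using assms mult_mat_index[OF assms(2,1)] by (intro sum.cong[symmetric]) auto
  finally show ?thesis .
qed

lemma tr_conjugate: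
  assumes "A \<in> carrier_mat n n" "P \<in> carrier_mat n n" "Q \<in> carrier_mat n n" "Q * P = 1\<^sub>m n"
  shows "tr (P * A * Q) = tr A"
proof -
  have "tr (P * A * Q) = tr (Q * (P * A))"
    using assms by (intro tr_comm) auto
  also have "Q * (P * A) = (Q * P) * A" using assms by (intro assoc_mult_mat[symmetric]) auto
  also have "\<dots> = A" using assms by simp
  finally show ?thesis .
qed

lemma tr_four_block:
  assumes "A \<in> carrier_mat n n" "D \<in> carrier_mat m m"
  shows "tr (four_block_mat A B C D) = tr A + tr D"
proof -
  let ?F = "four_block_mat A B C D"
  have "tr ?F = (\<Sum>i<n + m. ?F $$ (i,i))" using assms by (simp add: tr_def)
  also have "\<dots> = (\<Sum>i<n. ?F $$ (i,i)) + (\<Sum>i<m. ?F $$ (n + i,n + i))"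
    by (induction m) (simp_all add: add.assoc)
  also have "\<dots> = tr A + tr D" using assms by (simp add: tr_def)
  finally show ?thesis .
qed

lemma four_block_mat_inject:
  assumes "A \<in> carrier_mat n1 m1" "B \<in> carrier_mat n1 m2" "C \<in> carrier_mat n2 m1" "D \<in> carrier_mat n2 m2"
    and "A' \<in> carrier_mat n1 m1" "B' \<in> carrier_mat n1 m2" "C' \<in> carrier_mat n2 m1" "D' \<in> carrier_mat n2 m2"
    and eq: "four_block_mat A B C D = four_block_mat A' B' C' D'"
  shows "A = A' \<and> B = B' \<and> C = C' \<and> D = D'"
proof -
  have e: "four_block_mat A B C D $$ (i,j) = four_block_mat A' B' C' D' $$ (i,j)" for i j
    using eq by simp
  have "A $$ (i,j) = A' $$ (i,j)" if "i < n1" "j < m1" for i j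
    using e[of i j] that assms(1-8) by simp
  moreover have "B $$ (i,j) = B' $$ (i,j)" if "i < n1" "j < m2" for i j
    using e[of i "j + m1"] that assms(1-8) by simp
  moreover have "C $$ (i,j) = C' $$ (i,j)" if "i < n2" "j < m1" for i j
    using e[of "i + n1" j] that assms(1-8) by simp
  moreover have "D $$ (i,j) = D' $$ (i,j)" if "i < n2" "j < m2" for i j
    using e[of "i + n1" "j + m1"] that assms(1-8) by simp
  ultimately show ?thesis using assms by (auto intro!: eq_matI)
qed

lemma upper_triangular_mult:
  fixes A B :: "complex mat"
  assumes A: "A \<in> carrier_mat n n" "upper_triangular A" and B: "B \<in> carrier_mat n n" "upper_triangular B"
  shows "upper_triangular (A * B)" and "i < n \<Longrightarrow> (A * B) $$ (i,i) = A $$ (i,i) * B $$ (i,i)"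
proof -
  have z: "A $$ (i,l) * B $$ (l,j) = 0" if "i < n" "l < n" "l < i \<or> j < l" for i j l
    using that A B by (auto simp: upper_triangular_def)
  show "upper_triangular (A * B)"
  proof
    fix i j assume "i < dim_row (A * B)" "j < i"
    then show "(A * B) $$ (i, j) = 0"
      using A B z[of i _ j] by (subst mult_mat_index[of _ n n _ n]) (auto intro!: sum.neutral, meson leI le_less_trans)
  qed
  assume i: "i < n"
  have "(A * B) $$ (i,i) = (\<Sum>l<n. A $$ (i,l) * B $$ (l,i))"
    using A B i by (subst mult_mat_index[of _ n n _ n]) auto
  also have "\<dots> = (\<Sum>l\<in>{i}. A $$ (i,l) * B $$ (l,i))"
    using i z by (intro sum.mono_neutral_right) (auto, metis nat_neq_iff)
  finally show "(A * B) $$ (i,i) = A $$ (i,i) * B $$ (i,i)" by simp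
qed

lemma upper_triangular_pow:
  fixes B :: "complex mat"
  assumes B: "B \<in> carrier_mat n n" "upper_triangular B"
  shows "upper_triangular (B ^\<^sub>m k) \<and> (\<forall>i<n. (B ^\<^sub>m k) $$ (i,i) = (B $$ (i,i)) ^ k)"
proof (induction k)
  case 0 then show ?case using B by auto
next
  case (Suc k)
  have "B ^\<^sub>m k \<in> carrier_mat n n" using B by auto
  then show ?case using Suc upper_triangular_mult[OF _ _ B, of "B ^\<^sub>m k"] by (auto simp: mult.commute)
qed

text \<open>The eigenvalues of a matrix of finite order are roots of unity, and inversion conjugates them.\<close>

lemma tr_finite_order:
  assumes A: "A \<in> carrier_mat n n" and k: "A ^\<^sub>m Suc k = 1\<^sub>m n"
  shows "tr (A ^\<^sub>m k) = cnj (tr A)"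
proof -
  \<comment> \<open>A triangular form is enough: the diagonal of a power consists of the powers of
    the diagonal entries, and the trace sees nothing else.\<close>
  obtain es where "char_poly A = (\<Prod>a\<leftarrow>es. [:- a, 1:])" using char_poly_factorized[OF A] by blast
  from schur_decomposition_exists[OF A this] obtain B where
    B: "B \<in> carrier_mat n n" "upper_triangular B" "similar_mat A B" by blast
  then obtain P Q where w: "similar_mat_wit A B P Q" unfolding similar_mat_def by blast
  then have PQ: "P \<in> carrier_mat n n" "Q \<in> carrier_mat n n" "P * Q = 1\<^sub>m n" "Q * P = 1\<^sub>m n"
    using A unfolding similar_mat_wit_def Let_def by auto
  have pow: "A ^\<^sub>m j = P * B ^\<^sub>m j * Q" for j
    using similar_mat_wit_pow[OF w, of j] unfolding similar_mat_wit_def Let_def by auto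
  have Bj: "B ^\<^sub>m j \<in> carrier_mat n n" for j using B by simp
  have trj: "tr (A ^\<^sub>m j) = (\<Sum>i<n. (B $$ (i,i)) ^ j)" for j
  proof -
    have "tr (A ^\<^sub>m j) = tr (B ^\<^sub>m j)" unfolding pow using PQ B by (intro tr_conjugate) auto
    also have "\<dots> = (\<Sum>i<n. (B $$ (i,i)) ^ j)"
      unfolding tr_def using upper_triangular_pow[OF B(1,2), of j] Bj[of j] by (intro sum.cong) auto
    finally show ?thesis .
  qed
  \<comment> \<open>Undoing the conjugation transfers the finite order of \<open>A\<close> to
    \<open>B\<close>, so each diagonal entry \<open>b\<close> satisfies
    \<open>b ^ Suc k = 1\<close>.\<close>
  have "B ^\<^sub>m Suc k = Q * (P * B ^\<^sub>m Suc k * Q) * P"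
  proof -
    have "Q * (P * B ^\<^sub>m Suc k * Q) * P = (Q * P) * B ^\<^sub>m Suc k * (Q * P)"
      using PQ(1,2) Bj[of "Suc k"] by (simp add: assoc_mult_mat[of _ n n _ n _ n] mult_carrier_mat[of _ n n _ n] del: pow_mat.simps)
    then show ?thesis
      using PQ(4) left_mult_one_mat[OF Bj[of "Suc k"]] right_mult_one_mat[OF Bj[of "Suc k"]] by metis
  qed
  also have "\<dots> = 1\<^sub>m n" using k PQ unfolding pow[symmetric] by simp
  finally have one: "B ^\<^sub>m Suc k = 1\<^sub>m n" .
  have "(B $$ (i,i)) ^ k = cnj (B $$ (i,i))" if i: "i < n" for i
  proof -
    let ?b = "B $$ (i,i)"
    have b: "?b ^ Suc k = 1" using upper_triangular_pow[OF B(1,2), of "Suc k"] i one by auto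
    then have "norm ?b ^ Suc k = 1" by (metis norm_one norm_power)
    then have "norm ?b = 1" using power_eq_imp_eq_base[of "norm ?b" "Suc k" 1] by simp
    then have c: "?b * cnj ?b = 1" using complex_norm_square[of ?b] by simp
    have "?b ^ k = ?b ^ k * (?b * cnj ?b)" unfolding c by simp
    also have "\<dots> = ?b ^ Suc k * cnj ?b" by (simp add: mult_ac)
    finally show ?thesis unfolding b by simp
  qed
  then show ?thesis using trj[of k] trj[of 1] A by (simp add: cnj_sum)
qed

section \<open>Invertibility and the rank normal form\<close>

lemma det_nonzero_inverse:
  fixes A :: "complex mat"
  assumes "A \<in> carrier_mat n n" "det A \<noteq> 0"
  obtains B where "B \<in> carrier_mat n n" "A * B = 1\<^sub>m n" "B * A = 1\<^sub>m n" "det B \<noteq> 0"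
proof -
  from det_non_zero_imp_unit[OF assms, of "()"] obtain B where
    B: "B \<in> carrier_mat n n" "A * B = 1\<^sub>m n" "B * A = 1\<^sub>m n"
    unfolding Units_def ring_mat_def by auto
  have "det A * det B = 1" using B assms det_mult[of A n B] by simp
  then have "det B \<noteq> 0" by auto
  with B show ?thesis using that by blast
qed

text \<open>A row swap and a column swap move some nonzero entry into the corner, where the
  elimination in \<open>rank_normal_form\<close> starts.\<close>

lemma nonzero_pivot:
  fixes A :: "complex mat"
  assumes A: "A \<in> carrier_mat (Suc n) (Suc n)" "A \<noteq> 0\<^sub>m (Suc n) (Suc n)"
  obtains P Q where "P \<in> carrier_mat (Suc n) (Suc n)" "det P \<noteq> 0"
    "Q \<in> carrier_mat (Suc n) (Suc n)" "det Q \<noteq> 0" "(P * A * Q) $$ (0,0) \<noteq> 0"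
proof -
  obtain i j where ij: "i < Suc n" "j < Suc n" "A $$ (i,j) \<noteq> 0"
    using A by (metis (no_types, lifting) carrier_matD eq_matI index_zero_mat)
  define P :: "complex mat" where "P = swaprows_mat (Suc n) 0 i"
  define Q :: "complex mat" where "Q = swaprows_mat (Suc n) 0 j"
  have dP: "det (swaprows_mat (Suc n) 0 l) \<noteq> (0 :: complex)" if "l < Suc n" for l
  proof (cases "l = 0")
    \<comment> \<open>Swapping a row with itself is the identity, of determinant 1; the value -1
      belongs to genuine transpositions only.\<close>
    case True
    have "swaprows_mat (Suc n) 0 0 = (1\<^sub>m (Suc n) :: complex mat)" by (rule eq_matI) auto
    then show ?thesis using True by simp
  next
    case False then have "det (swaprows_mat (Suc n) 0 l) = (- 1 :: complex)" using det_swaprows_mat[of 0 "Suc n" l] that by simp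
    then show ?thesis by simp
  qed
  have "P * A * Q = swapcols 0 j (swaprows 0 i A)"
    unfolding P_def Q_def using A ij swaprows_mat[of A "Suc n" "Suc n" 0 i]
    by (metis swapcols_mat[of "swaprows 0 i A" "Suc n" "Suc n" 0 j] mult_carrier_mat swaprows_mat_carrier zero_less_Suc)
  also have "\<dots> $$ (0,0) = A $$ (i,j)" using A ij by auto
  finally show ?thesis using that[of P Q] ij dP by (simp add: P_def Q_def)
qed

text \<open>Two-sided Gaussian elimination. For an intertwiner it provides bases in which the map is
  a coordinate projection, so that invariance of its kernel and image turns into the vanishing of
  blocks.\<close>

lemma rank_normal_form:
  fixes A :: "complex mat"
  assumes "A \<in> carrier_mat n n"
  shows "\<exists>P\<in>carrier_mat n n. \<exists>Q\<in>carrier_mat n n. \<exists>r\<le>n. det P \<noteq> 0 \<and> det Q \<noteq> 0 \<and>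
    P * A * Q = four_block_mat (1\<^sub>m r) (0\<^sub>m r (n - r)) (0\<^sub>m (n - r) r) (0\<^sub>m (n - r) (n - r))"
  using assms
proof (induction n arbitrary: A)
  case 0
  show ?case
    by (rule bexI[of _ "1\<^sub>m 0"], rule bexI[of _ "1\<^sub>m 0"], rule exI[of _ 0]) (use 0 in auto)
next
  case (Suc n)
  show ?case
  proof (cases "A = 0\<^sub>m (Suc n) (Suc n)")
    case True
    show ?thesis
      by (rule bexI[of _ "1\<^sub>m (Suc n)"], rule bexI[of _ "1\<^sub>m (Suc n)"], rule exI[of _ 0])
        (use True in auto)
  next
    case False
    obtain P0 Q0 where P0: "P0 \<in> carrier_mat (Suc n) (Suc n)" "det P0 \<noteq> 0"
      and Q0: "Q0 \<in> carrier_mat (Suc n) (Suc n)" "det Q0 \<noteq> 0" and a0: "(P0 * A * Q0) $$ (0,0) \<noteq> 0"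
      using nonzero_pivot[OF Suc.prems False] by blast
    define B where "B = P0 * A * Q0"
    have B: "B \<in> carrier_mat (Suc n) (Suc n)" using P0 Q0 Suc.prems unfolding B_def by auto
    obtain a b c d where sp: "split_block B 1 1 = (a,b,c,d)" by (metis prod_cases4)
    have abcd: "a \<in> carrier_mat 1 1" "b \<in> carrier_mat 1 n" "c \<in> carrier_mat n 1" "d \<in> carrier_mat n n"
      "B = four_block_mat a b c d" using split_block[OF sp, of n n] B by auto
    define t where "t = a $$ (0,0)"
    have t: "t \<noteq> 0" using a0 abcd unfolding t_def B_def[symmetric] by simp
    define u :: "complex mat" where "u = mat 1 1 (\<lambda>_. 1 / t)"
    have u: "u \<in> carrier_mat 1 1" "u * a = 1\<^sub>m 1" "a * u = 1\<^sub>m 1"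
      using t abcd(1) unfolding u_def t_def by (auto intro!: eq_matI simp: scalar_prod_def)
    have detu: "det u \<noteq> 0"
      using u(1,2) abcd(1) by (metis det_mult det_one mult_zero_left zero_neq_one)
    \<comment> \<open>With \<open>u\<close> the inverse of the pivot block, \<open>L\<close> clears
      the first column and \<open>R\<close> the first row. What remains is the Schur complement
      \<open>e\<close>, to which the induction hypothesis applies.\<close>
    define L where "L = four_block_mat u (0\<^sub>m 1 n) (- (c * u)) (1\<^sub>m n)"
    define R where "R = four_block_mat (1\<^sub>m 1) (- (u * b)) (0\<^sub>m n 1) (1\<^sub>m n)"
    have L: "L \<in> carrier_mat (1 + n) (1 + n)" using u abcd unfolding L_def by (intro four_block_carrier_mat) auto
    have R: "R \<in> carrier_mat (1 + n) (1 + n)" using u abcd unfolding R_def by (intro four_block_carrier_mat) auto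
    have dL: "det L \<noteq> 0" unfolding L_def
      using u abcd detu by (subst det_four_block_mat_upper_right_zero[of _ 1 _ n]) auto
    have dR: "det R \<noteq> 0" unfolding R_def
      using u abcd by (subst det_four_block_mat_lower_left_zero[of _ 1 _ n]) auto
    define e where "e = - (c * u) * b + d"
    have e: "e \<in> carrier_mat n n" unfolding e_def using abcd u by auto
    have cua: "- (c * u) * a + c = 0\<^sub>m n 1"
    proof -
      have "- (c * u) * a = - (c * (u * a))" using abcd u by (simp add: assoc_mult_mat[of _ n 1 _ 1 _ 1])
      also have "\<dots> = - c" using u abcd by simp
      finally show ?thesis using abcd by simp
    qed
    have LB: "L * B = four_block_mat (1\<^sub>m 1) (u * b) (0\<^sub>m n 1) e"
      unfolding L_def abcd(5)
      by (subst mult_four_block_mat[of _ 1 1 _ n _ n _ _ 1 _ n])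
        (use u abcd cua in \<open>auto simp: e_def\<close>)
    have LBR: "L * B * R = four_block_mat (1\<^sub>m 1) (0\<^sub>m 1 n) (0\<^sub>m n 1) e"
      unfolding LB R_def
      by (subst mult_four_block_mat[of _ 1 1 _ n _ n _ _ 1 _ n])
        (use u abcd e in \<open>auto intro!: cong_four_block_mat\<close>)
    from Suc.IH[OF e] obtain P1 Q1 r where P1: "P1 \<in> carrier_mat n n" "det P1 \<noteq> 0"
      and Q1: "Q1 \<in> carrier_mat n n" "det Q1 \<noteq> 0" and r: "r \<le> n" and
      eq: "P1 * e * Q1 = four_block_mat (1\<^sub>m r) (0\<^sub>m r (n - r)) (0\<^sub>m (n - r) r) (0\<^sub>m (n - r) (n - r))"
      by blast
    define P2 where "P2 = four_block_mat (1\<^sub>m 1) (0\<^sub>m 1 n) (0\<^sub>m n 1) P1"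
    define Q2 where "Q2 = four_block_mat (1\<^sub>m 1) (0\<^sub>m 1 n) (0\<^sub>m n 1) Q1"
    have P2: "P2 \<in> carrier_mat (1 + n) (1 + n)" using P1 unfolding P2_def by (intro four_block_carrier_mat) auto
    have Q2: "Q2 \<in> carrier_mat (1 + n) (1 + n)" using Q1 unfolding Q2_def by (intro four_block_carrier_mat) auto
    have dP2: "det P2 \<noteq> 0" unfolding P2_def
      using P1 by (subst det_four_block_mat_upper_right_zero[of _ 1 _ n]) auto
    have dQ2: "det Q2 \<noteq> 0" unfolding Q2_def
      using Q1 by (subst det_four_block_mat_upper_right_zero[of _ 1 _ n]) auto
    have "P2 * (L * B * R) = four_block_mat (1\<^sub>m 1) (0\<^sub>m 1 n) (0\<^sub>m n 1) (P1 * e)"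
      unfolding LBR P2_def
      by (subst mult_four_block_mat[of _ 1 1 _ n _ n _ _ 1 _ n])
        (use P1 e in \<open>auto intro!: cong_four_block_mat\<close>)
    then have "P2 * (L * B * R) * Q2 = four_block_mat (1\<^sub>m 1) (0\<^sub>m 1 n) (0\<^sub>m n 1) (P1 * e * Q1)"
      unfolding Q2_def
      by (simp only:) (subst mult_four_block_mat[of _ 1 1 _ n _ n _ _ 1 _ n],
        use P1 Q1 e in \<open>auto intro!: cong_four_block_mat\<close>)
    also have "\<dots> = four_block_mat (1\<^sub>m (Suc r)) (0\<^sub>m (Suc r) (Suc n - Suc r)) (0\<^sub>m (Suc n - Suc r) (Suc r))
        (0\<^sub>m (Suc n - Suc r) (Suc n - Suc r))"
      unfolding eq using r by (intro eq_matI) auto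
    finally have fin: "P2 * (L * B * R) * Q2 = \<dots>" .
    define P where "P = P2 * (L * P0)"
    define Q where "Q = (Q0 * R) * Q2"
    have "P2 * (L * B * R) * Q2 = P * A * Q"
      unfolding P_def Q_def B_def
      using P2 Q2 L R P0 Q0 Suc.prems
      by (simp add: assoc_mult_mat[of _ "Suc n" "Suc n" _ "Suc n" _ "Suc n"] mult_carrier_mat[of _ "Suc n" "Suc n" _ "Suc n"])
    moreover have "P \<in> carrier_mat (Suc n) (Suc n) \<and> det P \<noteq> 0"
      unfolding P_def using P2 dP2 L dL P0 by (auto simp: det_mult[of _ "Suc n"])
    moreover have "Q \<in> carrier_mat (Suc n) (Suc n) \<and> det Q \<noteq> 0"
      unfolding Q_def using Q2 dQ2 R dR Q0 by (auto simp: det_mult[of _ "Suc n"])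
    ultimately show ?thesis using fin r by (metis Suc_le_mono)
  qed
qed

text \<open>The dimensions are arguments because even an empty sum must have a definite
  size.\<close>

definition matsum :: "'i set \<Rightarrow> nat \<Rightarrow> nat \<Rightarrow> ('i \<Rightarrow> complex mat) \<Rightarrow> complex mat" where
  "matsum H n m Z = mat n m (\<lambda>ij. \<Sum>h\<in>H. Z h $$ ij)"

lemma matsum_carrier [simp]: "matsum H n m Z \<in> carrier_mat n m"
  by (simp add: matsum_def)

lemma matsum_cong: "(\<And>h. h \<in> H \<Longrightarrow> Z h = Y h) \<Longrightarrow> matsum H n m Z = matsum H n m Y"
  by (simp add: matsum_def)

lemma mult_matsum:
  assumes "B \<in> carrier_mat k n" "\<And>h. h \<in> H \<Longrightarrow> Z h \<in> carrier_mat n m"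
  shows "B * matsum H n m Z = matsum H k m (\<lambda>h. B * Z h)"
proof (rule eq_matI)
  fix i j assume "i < dim_row (matsum H k m (\<lambda>h. B * Z h))" "j < dim_col (matsum H k m (\<lambda>h. B * Z h))"
  then have ij: "i < k" "j < m" by (auto simp: matsum_def)
  have "(B * matsum H n m Z) $$ (i,j) = (\<Sum>l<n. B $$ (i,l) * (\<Sum>h\<in>H. Z h $$ (l,j)))"
    using ij assms by (subst mult_mat_index[of _ k n _ m]) (auto simp: matsum_def)
  also have "\<dots> = (\<Sum>h\<in>H. \<Sum>l<n. B $$ (i,l) * Z h $$ (l,j))"
    unfolding sum_distrib_left by (rule sum.swap)
  also have "\<dots> = (\<Sum>h\<in>H. (B * Z h) $$ (i,j))"
    using ij assms by (intro sum.cong refl mult_mat_index[symmetric]) auto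
  finally show "(B * matsum H n m Z) $$ (i,j) = matsum H k m (\<lambda>h. B * Z h) $$ (i,j)"
    using ij by (simp add: matsum_def)
qed (use assms in \<open>auto simp: matsum_def\<close>)

lemma matsum_mult:
  assumes "B \<in> carrier_mat m k" "\<And>h. h \<in> H \<Longrightarrow> Z h \<in> carrier_mat n m"
  shows "matsum H n m Z * B = matsum H n k (\<lambda>h. Z h * B)"
proof (rule eq_matI)
  fix i j assume "i < dim_row (matsum H n k (\<lambda>h. Z h * B))" "j < dim_col (matsum H n k (\<lambda>h. Z h * B))"
  then have ij: "i < n" "j < k" by (auto simp: matsum_def)
  have "(matsum H n m Z * B) $$ (i,j) = (\<Sum>l<m. (\<Sum>h\<in>H. Z h $$ (i,l)) * B $$ (l,j))"
    using ij assms by (subst mult_mat_index[of _ n m _ k]) (auto simp: matsum_def)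
  also have "\<dots> = (\<Sum>h\<in>H. \<Sum>l<m. Z h $$ (i,l) * B $$ (l,j))"
    unfolding sum_distrib_right by (rule sum.swap)
  also have "\<dots> = (\<Sum>h\<in>H. (Z h * B) $$ (i,j))"
    using ij assms by (intro sum.cong refl mult_mat_index[symmetric]) auto
  finally show "(matsum H n m Z * B) $$ (i,j) = matsum H n k (\<lambda>h. Z h * B) $$ (i,j)"
    using ij by (simp add: matsum_def)
qed (use assms in \<open>auto simp: matsum_def\<close>)

lemma matsum_reindex:
  assumes "bij_betw f H H"
  shows "matsum H n m (\<lambda>h. Z (f h)) = matsum H n m Z"
proof -
  have "(\<lambda>ij. \<Sum>h\<in>H. Z (f h) $$ ij) = (\<lambda>ij. \<Sum>h\<in>H. Z h $$ ij)"
    by (rule ext) (rule sum.reindex_bij_betw[OF assms, of "\<lambda>h. Z h $$ _"])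
  then show ?thesis by (simp add: matsum_def)
qed

section \<open>Characters and intertwiners of finite groups\<close>

definition mat_rep :: "('g, 'x) monoid_scheme \<Rightarrow> nat \<Rightarrow> ('g \<Rightarrow> complex mat) \<Rightarrow> bool" where
  "mat_rep G n \<rho> \<longleftrightarrow> (\<forall>g\<in>carrier G. \<rho> g \<in> carrier_mat n n) \<and> \<rho> \<one>\<^bsub>G\<^esub> = 1\<^sub>m n \<and>
     (\<forall>g\<in>carrier G. \<forall>h\<in>carrier G. \<rho> (g \<otimes>\<^bsub>G\<^esub> h) = \<rho> g * \<rho> h)"

text \<open>With \<open>Suc k\<close> the order of the group, \<open>inv g\<close> is the power of
  \<open>g\<close> with exponent \<open>k\<close>, so \<open>tr_finite_order\<close> applies to
  \<open>\<rho> g\<close>.\<close>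

lemma (in group) mat_rep_inv_tr:
  assumes fin: "finite (carrier G)" and rep: "mat_rep G n \<rho>" and g: "g \<in> carrier G"
  shows "tr (\<rho> (inv g)) = cnj (tr (\<rho> g))"
proof -
  have pow: "\<rho> (g [^] k) = \<rho> g ^\<^sub>m k" for k :: nat
  proof (induction k)
    case 0 then show ?case using rep g by (auto simp: mat_rep_def)
  next
    case (Suc k) then show ?case using rep g by (auto simp: mat_rep_def)
  qed
  obtain k where k: "Coset.order G = Suc k" using fin order_gt_0_iff_finite gr0_implies_Suc by blast
  have one: "g [^] Suc k = \<one>" using pow_order_eq_1[OF g] k by simp
  then have "inv g = g [^] k" using g by (metis inv_equality nat_pow_Suc2 nat_pow_closed nat_pow_Suc)
  moreover have "tr (\<rho> g ^\<^sub>m k) = cnj (tr (\<rho> g))"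
  proof (rule tr_finite_order)
    show "\<rho> g \<in> carrier_mat n n" using rep g by (simp add: mat_rep_def)
    show "\<rho> g ^\<^sub>m Suc k = 1\<^sub>m n" using one pow[of "Suc k"] rep by (simp add: mat_rep_def)
  qed
  ultimately show ?thesis by (simp add: pow)
qed

text \<open>If every averaged elementary matrix vanished, then so would the sum of the values
  \<open>|tr (\<rho> g)|\<^sup>2\<close>.\<close>

lemma (in group) nonzero_intertwiner:
  assumes fin: "finite (carrier G)" and n: "n > 0"
    and \<rho>: "mat_rep G n \<rho>" and \<sigma>: "mat_rep G n \<sigma>" and eq: "\<And>g. g \<in> carrier G \<Longrightarrow> tr (\<rho> g) = tr (\<sigma> g)"
  obtains A where "A \<in> carrier_mat n n" "A \<noteq> 0\<^sub>m n n" "\<And>g. g \<in> carrier G \<Longrightarrow> A * \<rho> g = \<sigma> g * A"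
proof -
  have c: "\<rho> g \<in> carrier_mat n n" "\<sigma> g \<in> carrier_mat n n" if "g \<in> carrier G" for g
    using \<rho> \<sigma> that by (auto simp: mat_rep_def)
  have m: "\<rho> (g \<otimes> h) = \<rho> g * \<rho> h" "\<sigma> (g \<otimes> h) = \<sigma> g * \<sigma> h" if "g \<in> carrier G" "h \<in> carrier G" for g h
    using \<rho> \<sigma> that by (auto simp: mat_rep_def)
  define Z :: "nat \<Rightarrow> nat \<Rightarrow> complex mat" where "Z k l = mat n n (\<lambda>ij. if ij = (k,l) then 1 else 0)" for k l
  have Z: "Z k l \<in> carrier_mat n n" for k l by (simp add: Z_def)
  define E where "E k l = matsum (carrier G) n n (\<lambda>g. \<sigma> g * Z k l * \<rho> (inv g))" for k l
  have inter: "E k l * \<rho> h = \<sigma> h * E k l" if h: "h \<in> carrier G" for k l h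
  proof -
    let ?Y = "\<lambda>g. \<sigma> g * Z k l * \<rho> (inv g \<otimes> h)"
    have bij: "bij_betw (\<lambda>g. h \<otimes> g) (carrier G) (carrier G)"
      by (rule bij_betwI[where g = "\<lambda>g. inv h \<otimes> g"]) (use h in \<open>auto simp: m_assoc[symmetric]\<close>)
    have "\<sigma> h * E k l = matsum (carrier G) n n (\<lambda>g. \<sigma> h * (\<sigma> g * Z k l * \<rho> (inv g)))"
      unfolding E_def by (rule mult_matsum[where k=n]) (use c Z h in \<open>auto simp: mult_carrier_mat[of _ n n _ n]\<close>)
    also have "\<dots> = matsum (carrier G) n n (\<lambda>g. ?Y (h \<otimes> g))"
    proof (rule matsum_cong)
      fix g assume g: "g \<in> carrier G"
      have "inv (h \<otimes> g) \<otimes> h = inv g" using g h by (simp add: inv_mult_group m_assoc)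
      then show "\<sigma> h * (\<sigma> g * Z k l * \<rho> (inv g)) = ?Y (h \<otimes> g)"
        using m[OF h g] c[OF h] c[OF g] c[of "inv g"] g Z[of k l]
        by (simp add: assoc_mult_mat[of _ n n _ n _ n] mult_carrier_mat[of _ n n _ n])
    qed
    also have "\<dots> = matsum (carrier G) n n ?Y" by (rule matsum_reindex[OF bij])
    also have "\<dots> = matsum (carrier G) n n (\<lambda>g. \<sigma> g * Z k l * \<rho> (inv g) * \<rho> h)"
      by (rule matsum_cong) (use h c Z m in \<open>simp add: assoc_mult_mat[of _ n n _ n _ n] mult_carrier_mat[of _ n n _ n]\<close>)
    also have "\<dots> = E k l * \<rho> h"
      unfolding E_def by (rule matsum_mult[symmetric]) (use c Z h in \<open>auto simp: mult_carrier_mat[of _ n n _ n]\<close>)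
    finally show ?thesis by simp
  qed
  have "\<exists>k l. E k l \<noteq> 0\<^sub>m n n"
  proof (rule ccontr)
    assume "\<not> ?thesis"
    then have z: "E k l = 0\<^sub>m n n" for k l by blast
    \<comment> \<open>The entry of \<open>E k l\<close> at \<open>(k,l)\<close> is a sum of products
      of diagonal entries, one from each representation; summed over all \<open>k\<close> and
      \<open>l\<close> these give products of traces.\<close>
    have entry: "(\<Sum>g\<in>carrier G. \<sigma> g $$ (k,k) * \<rho> (inv g) $$ (l,l)) = 0" if kl: "k < n" "l < n" for k l
    proof -
      have "\<sigma> g $$ (k,k) * \<rho> (inv g) $$ (l,l) = (\<sigma> g * Z k l * \<rho> (inv g)) $$ (k,l)" if g: "g \<in> carrier G" for g
      proof -
        have "(\<sigma> g * Z k l * \<rho> (inv g)) $$ (k,l) = (\<Sum>b<n. (\<Sum>a<n. \<sigma> g $$ (k,a) * Z k l $$ (a,b)) * \<rho> (inv g) $$ (b,l))"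
          using kl g c Z mult_mat_index[of "\<sigma> g * Z k l" n n "\<rho> (inv g)" n k l] mult_mat_index[of "\<sigma> g" n n "Z k l" n k]
          by (simp add: mult_carrier_mat[of _ n n _ n])
        also have "\<dots> = (\<Sum>b<n. if b = l then \<sigma> g $$ (k,k) * \<rho> (inv g) $$ (l,l) else 0)"
        proof (intro sum.cong refl)
          fix b assume b: "b \<in> {..<n}"
          have "(\<Sum>a<n. \<sigma> g $$ (k,a) * Z k l $$ (a,b)) = (\<Sum>a<n. if a = k then (if b = l then \<sigma> g $$ (k,k) else 0) else 0)"
            using kl b by (intro sum.cong) (auto simp: Z_def)
          then show "(\<Sum>a<n. \<sigma> g $$ (k,a) * Z k l $$ (a,b)) * \<rho> (inv g) $$ (b,l) =
              (if b = l then \<sigma> g $$ (k,k) * \<rho> (inv g) $$ (l,l) else 0)"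
            using kl by (simp add: sum.delta)
        qed
        finally show ?thesis using kl by simp
      qed
      then show ?thesis using arg_cong[OF z[of k l], of "\<lambda>M. M $$ (k,l)"] kl by (simp add: E_def matsum_def)
    qed
    have "(\<Sum>g\<in>carrier G. tr (\<sigma> g) * tr (\<rho> (inv g))) = (\<Sum>g\<in>carrier G. \<Sum>k<n. \<Sum>l<n. \<sigma> g $$ (k,k) * \<rho> (inv g) $$ (l,l))"
      using c by (intro sum.cong refl) (simp add: tr_def sum_product carrier_matD(1)[OF c(1)] carrier_matD(1)[OF c(2)])
    also have "\<dots> = (\<Sum>k<n. \<Sum>l<n. \<Sum>g\<in>carrier G. \<sigma> g $$ (k,k) * \<rho> (inv g) $$ (l,l))"
      by (subst sum.swap, intro sum.cong refl, rule sum.swap)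
    also have "\<dots> = 0" using entry by simp
    finally have "(\<Sum>g\<in>carrier G. tr (\<rho> g) * cnj (tr (\<rho> g))) = 0"
      using eq mat_rep_inv_tr[OF fin \<rho>] by simp
    then have "of_real (\<Sum>g\<in>carrier G. (norm (tr (\<rho> g)))\<^sup>2) = (0 :: complex)"
      by (simp only: of_real_sum complex_norm_square)
    then have "(\<Sum>g\<in>carrier G. (norm (tr (\<rho> g)))\<^sup>2) = 0" using of_real_eq_0_iff by blast
    \<comment> \<open>The summand at the identity is the square of the degree \<open>n\<close>,
      which is positive.\<close>
    then have "(norm (tr (\<rho> \<one>)))\<^sup>2 = 0" using fin by (subst (asm) sum_nonneg_eq_0_iff) auto
    then show False using n \<rho> by (simp add: mat_rep_def tr_def)
  qed
  then show ?thesis using that inter by (metis E_def matsum_carrier)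
qed

section \<open>Representations with equal characters are isomorphic\<close>

lemma smult_mult_both:
  fixes A B :: "complex mat"
  assumes "A \<in> carrier_mat n k" "B \<in> carrier_mat k m"
  shows "A * (c \<cdot>\<^sub>m B) = c \<cdot>\<^sub>m (A * B)" "(c \<cdot>\<^sub>m A) * B = c \<cdot>\<^sub>m (A * B)"
  using assms by (auto simp: mult_smult_distrib mult_smult_assoc_mat)

text \<open>Maschke's theorem in cocycle form: averaging \<open>c h * a (inv h)\<close> trivialises the cocycle.\<close>

lemma (in group) cocycle_coboundary:
  assumes fin: "finite (carrier G)" and a: "mat_rep G r a" and d: "mat_rep G m d"
    and c: "\<And>g. g \<in> carrier G \<Longrightarrow> c g \<in> carrier_mat m r"
    and coc: "\<And>g h. g \<in> carrier G \<Longrightarrow> h \<in> carrier G \<Longrightarrow> c (g \<otimes> h) = c g * a h + d g * c h"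
  obtains Y where "Y \<in> carrier_mat m r" "\<And>g. g \<in> carrier G \<Longrightarrow> d g * Y + c g = Y * a g"
proof -
  have ca: "a g \<in> carrier_mat r r" "d g \<in> carrier_mat m m" if "g \<in> carrier G" for g
    using a d that by (auto simp: mat_rep_def)
  let ?N = "of_nat (card (carrier G)) :: complex"
  have N: "?N \<noteq> 0" using fin by auto
  define Z where "Z = matsum (carrier G) m r (\<lambda>h. c h * a (inv h))"
  have Z: "Z \<in> carrier_mat m r" by (simp add: Z_def)
  have ch: "c h * a (inv h) \<in> carrier_mat m r" if "h \<in> carrier G" for h
    using c[OF that] ca(1)[of "inv h"] that by auto
  \<comment> \<open>Multiplication by \<open>d g\<close> shifts the summation index by
    \<open>g\<close>. By the cocycle relation each summand leaves one copy of \<open>c g\<close>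
    behind, which explains the factor \<open>?N\<close>, removed later by scaling \<open>Z\<close>
    to \<open>Y\<close>.\<close>
  have key: "d g * Z + ?N \<cdot>\<^sub>m c g = Z * a g" if g: "g \<in> carrier G" for g
  proof -
    have bij: "bij_betw (\<lambda>h. g \<otimes> h) (carrier G) (carrier G)"
      by (rule bij_betwI[where g = "\<lambda>h. inv g \<otimes> h"]) (use g in \<open>auto simp: m_assoc[symmetric]\<close>)
    have tm: "d g * (c h * a (inv h)) + c g = c (g \<otimes> h) * a (inv (g \<otimes> h)) * a g" if h: "h \<in> carrier G" for h
    proof -
      have "a (inv (g \<otimes> h)) * a g = a (inv h)"
      proof -
        have "inv (g \<otimes> h) \<otimes> g = inv h" using g h by (simp add: inv_mult_group m_assoc)
        then show ?thesis using a g h unfolding mat_rep_def by (metis inv_closed m_closed)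
      qed
      moreover have "a h * a (inv h) = 1\<^sub>m r" using a h unfolding mat_rep_def by (metis inv_closed r_inv)
      moreover have "c (g \<otimes> h) * a (inv (g \<otimes> h)) * a g = c (g \<otimes> h) * (a (inv (g \<otimes> h)) * a g)"
        using c[of "g \<otimes> h"] ca(1)[OF g] ca(1)[of "inv (g \<otimes> h)"] g h by (intro assoc_mult_mat[of _ m r _ r _ r]) auto
      moreover have "(c g * a h + d g * c h) * a (inv h) = c g * (a h * a (inv h)) + d g * (c h * a (inv h))"
      proof -
        have i: "a (inv h) \<in> carrier_mat r r" using ca(1) h by simp
        have p: "c g * a h \<in> carrier_mat m r" "d g * c h \<in> carrier_mat m r"
          using c[OF g] c[OF h] ca[OF g] ca[OF h] by auto
        show ?thesis
          unfolding add_mult_distrib_mat[OF p i] assoc_mult_mat[OF c[OF g] ca(1)[OF h] i]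
            assoc_mult_mat[OF ca(2)[OF g] c[OF h] i] ..
      qed
      ultimately have "c (g \<otimes> h) * a (inv (g \<otimes> h)) * a g = c g + d g * (c h * a (inv h))"
        using coc[OF g h] right_mult_one_mat[OF c[OF g]] by metis
      also have "\<dots> = d g * (c h * a (inv h)) + c g"
        using c[OF g] c[OF h] ca[OF g] ca[of "inv h"] h by (intro comm_add_mat[of _ m r]) auto
      finally show ?thesis by simp
    qed
    have "d g * Z = matsum (carrier G) m r (\<lambda>h. d g * (c h * a (inv h)))"
      unfolding Z_def by (rule mult_matsum[where k=m]) (use ch ca g in auto)
    moreover have "?N \<cdot>\<^sub>m c g = matsum (carrier G) m r (\<lambda>h. c g)"
      using c[OF g] by (intro eq_matI) (auto simp: matsum_def)
    ultimately have "d g * Z + ?N \<cdot>\<^sub>m c g = matsum (carrier G) m r (\<lambda>h. d g * (c h * a (inv h)) + c g)"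
      using c[OF g] by (intro eq_matI) (auto simp: matsum_def sum.distrib)
    also have "\<dots> = matsum (carrier G) m r (\<lambda>h. c (g \<otimes> h) * a (inv (g \<otimes> h)) * a g)"
      by (rule matsum_cong) (rule tm)
    also have "\<dots> = matsum (carrier G) m r (\<lambda>h. c h * a (inv h) * a g)"
      using matsum_reindex[OF bij, of m r "\<lambda>h. c h * a (inv h) * a g"] by simp
    also have "\<dots> = Z * a g"
      unfolding Z_def by (rule matsum_mult[symmetric]) (use ch ca g in auto)
    finally show ?thesis .
  qed
  define Y where "Y = (1 / ?N) \<cdot>\<^sub>m Z"
  show ?thesis
  proof
    show "Y \<in> carrier_mat m r" using Z by (simp add: Y_def)
    fix g assume g: "g \<in> carrier G"
    have "d g * Y + c g = (1 / ?N) \<cdot>\<^sub>m (d g * Z + ?N \<cdot>\<^sub>m c g)"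
      unfolding Y_def using Z ca[OF g] c[OF g] N
      by (simp add: smult_mult_both[of _ m m _ r] add_smult_distrib_left_mat[of _ m r]) (intro eq_matI; auto)
    also have "\<dots> = Y * a g" unfolding key[OF g] Y_def using Z ca[OF g] by (simp add: smult_mult_both[of _ m r _ r])
    finally show "d g * Y + c g = Y * a g" .
  qed
qed

lemma mat_rep_conjugate:
  fixes G (structure)
  assumes \<rho>: "mat_rep G n \<rho>" and P: "P \<in> carrier_mat n n" "Q \<in> carrier_mat n n" "Q * P = 1\<^sub>m n" "P * Q = 1\<^sub>m n"
  shows "mat_rep G n (\<lambda>g. P * \<rho> g * Q)"
proof -
  have "P * \<rho> (g \<otimes> h) * Q = (P * \<rho> g * Q) * (P * \<rho> h * Q)" if gh: "g \<in> carrier G" "h \<in> carrier G" for g h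
  proof -
    have c: "\<rho> g \<in> carrier_mat n n" "\<rho> h \<in> carrier_mat n n" using \<rho> gh by (auto simp: mat_rep_def)
    have "(P * \<rho> g * Q) * (P * \<rho> h * Q) = P * \<rho> g * ((Q * P) * (\<rho> h * Q))"
      using P(1,2) c by (simp add: assoc_mult_mat[of _ n n _ n _ n] mult_carrier_mat[of _ n n _ n])
    also have "\<dots> = P * (\<rho> g * \<rho> h) * Q"
      using P(1,2) c unfolding P(3) by (simp add: assoc_mult_mat[of _ n n _ n _ n] mult_carrier_mat[of _ n n _ n])
    finally show ?thesis using \<rho> gh by (simp add: mat_rep_def)
  qed
  then show ?thesis using \<rho> P by (auto simp: mat_rep_def mult_carrier_mat[of _ n n _ n])
qed

text \<open>Strong induction on the degree, without decomposing into irreducibles. In the normal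
  form of a nonzero intertwiner the block \<open>a\<close> is a quotient of \<open>\<rho>\<close>
  and a subrepresentation of \<open>\<sigma>\<close>. The complementary blocks \<open>d\<close> and
  \<open>d'\<close> again have equal traces, and all extensions split.\<close>

theorem (in group) equal_tr_imp_intertwiner:
  assumes fin: "finite (carrier G)"
  shows "mat_rep G n \<rho> \<Longrightarrow> mat_rep G n \<sigma> \<Longrightarrow> (\<And>g. g \<in> carrier G \<Longrightarrow> tr (\<rho> g) = tr (\<sigma> g)) \<Longrightarrow>
    \<exists>A\<in>carrier_mat n n. det A \<noteq> 0 \<and> (\<forall>g\<in>carrier G. A * \<rho> g = \<sigma> g * A)"
proof (induction n arbitrary: \<rho> \<sigma> rule: less_induct)
  case (less n)
  note \<rho> = less.prems(1) and \<sigma> = less.prems(2)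
  show ?case
  proof (cases "n = 0")
    case True
    then show ?thesis using \<rho> \<sigma> by (intro bexI[of _ "1\<^sub>m 0"]) (auto simp: mat_rep_def intro!: eq_matI)
  next
    case False
    then obtain A where A: "A \<in> carrier_mat n n" "A \<noteq> 0\<^sub>m n n" "\<And>g. g \<in> carrier G \<Longrightarrow> A * \<rho> g = \<sigma> g * A"
      using nonzero_intertwiner[OF fin _ \<rho> \<sigma>] less.prems(3) by blast
    from rank_normal_form[OF A(1)] obtain P Q r where P: "P \<in> carrier_mat n n" "det P \<noteq> 0"
      and Q: "Q \<in> carrier_mat n n" "det Q \<noteq> 0" and r: "r \<le> n" and
      nf: "P * A * Q = four_block_mat (1\<^sub>m r) (0\<^sub>m r (n - r)) (0\<^sub>m (n - r) r) (0\<^sub>m (n - r) (n - r))" by blast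
    define m where "m = n - r"
    have n: "n = r + m" using r by (simp add: m_def)
    define E :: "complex mat" where "E = four_block_mat (1\<^sub>m r) (0\<^sub>m r m) (0\<^sub>m m r) (0\<^sub>m m m)"
    have E: "P * A * Q = E" using nf by (simp add: E_def m_def)
    obtain P' where P': "P' \<in> carrier_mat n n" "P * P' = 1\<^sub>m n" "P' * P = 1\<^sub>m n" "det P' \<noteq> 0"
      using det_nonzero_inverse[OF P] by blast
    obtain Q' where Q': "Q' \<in> carrier_mat n n" "Q * Q' = 1\<^sub>m n" "Q' * Q = 1\<^sub>m n" "det Q' \<noteq> 0"
      using det_nonzero_inverse[OF Q] by blast
    note asc = assoc_mult_mat[of _ n n _ n _ n] mult_carrier_mat[of _ n n _ n]
    \<comment> \<open>A nonzero \<open>A\<close> has positive rank, so the complementary degree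
      \<open>m\<close> drops below \<open>n\<close>.\<close>
    have "r \<noteq> 0"
    proof
      assume "r = 0"
      then have "E = 0\<^sub>m n n" using n by (intro eq_matI) (auto simp: E_def)
      then have "P' * (P * A * Q) * Q' = 0\<^sub>m n n" using E P' Q' by simp
      moreover have "P' * (P * A * Q) * Q' = (P' * P) * A * (Q * Q')"
        using P Q P'(1) Q'(1) A(1) by (simp add: asc)
      ultimately show False using A P' Q' by simp
    qed
    then have mn: "m < n" using n by simp
    define \<rho>1 where "\<rho>1 g = Q' * \<rho> g * Q" for g
    define \<sigma>1 where "\<sigma>1 g = P * \<sigma> g * P'" for g
    have rep1: "mat_rep G n \<rho>1" "mat_rep G n \<sigma>1"
      unfolding \<rho>1_def \<sigma>1_def using \<rho> \<sigma> P P' Q Q' by (auto intro!: mat_rep_conjugate)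
    have c1: "\<rho>1 g \<in> carrier_mat n n" "\<sigma>1 g \<in> carrier_mat n n" if "g \<in> carrier G" for g
      using rep1 that by (auto simp: mat_rep_def)
    have c0: "\<rho> g \<in> carrier_mat n n" "\<sigma> g \<in> carrier_mat n n" if "g \<in> carrier G" for g
      using \<rho> \<sigma> that by (auto simp: mat_rep_def)
    have tr1: "tr (\<rho>1 g) = tr (\<sigma>1 g)" if g: "g \<in> carrier G" for g
      unfolding \<rho>1_def \<sigma>1_def using tr_conjugate[of "\<rho> g" n Q' Q] tr_conjugate[of "\<sigma> g" n P P'] c0[OF g] P P' Q Q' less.prems(3)[OF g] by simp
    have int1: "E * \<rho>1 g = \<sigma>1 g * E" if g: "g \<in> carrier G" for g
    proof -
      have "E * \<rho>1 g = P * A * (Q * Q') * \<rho> g * Q"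
        unfolding E[symmetric] \<rho>1_def using P(1) Q(1) Q'(1) A(1) c0[OF g] by (simp add: asc)
      also have "\<dots> = P * (A * \<rho> g) * Q" using P(1) Q(1) A(1) c0[OF g] Q'(2) by (simp add: asc)
      also have "\<dots> = P * (\<sigma> g * (1\<^sub>m n * A)) * Q" using A g by simp
      also have "\<dots> = \<sigma>1 g * E" unfolding E[symmetric] \<sigma>1_def P'(3)[symmetric] using P(1) Q(1) P'(1) A(1) c0[OF g] by (simp add: asc)
      finally show ?thesis .
    qed
    define blk where "blk M = split_block M r r" for M :: "complex mat"
    define a where "a g = fst (blk (\<rho>1 g))" for g
    define b where "b g = fst (snd (blk (\<rho>1 g)))" for g
    define c where "c g = fst (snd (snd (blk (\<rho>1 g))))" for g
    define d where "d g = snd (snd (snd (blk (\<rho>1 g))))" for g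
    define a' where "a' g = fst (blk (\<sigma>1 g))" for g
    define b' where "b' g = fst (snd (blk (\<sigma>1 g)))" for g
    define c' where "c' g = fst (snd (snd (blk (\<sigma>1 g))))" for g
    define d' where "d' g = snd (snd (snd (blk (\<sigma>1 g))))" for g
    have B: "a g \<in> carrier_mat r r \<and> b g \<in> carrier_mat r m \<and> c g \<in> carrier_mat m r \<and> d g \<in> carrier_mat m m \<and>
        \<rho>1 g = four_block_mat (a g) (b g) (c g) (d g)"
      and B': "a' g \<in> carrier_mat r r \<and> b' g \<in> carrier_mat r m \<and> c' g \<in> carrier_mat m r \<and> d' g \<in> carrier_mat m m \<and>
        \<sigma>1 g = four_block_mat (a' g) (b' g) (c' g) (d' g)" if g: "g \<in> carrier G" for g
      using split_block[of "\<rho>1 g" r r "a g" "b g" "c g" "d g" m m] split_block[of "\<sigma>1 g" r r "a' g" "b' g" "c' g" "d' g" m m] c1[OF g] n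
      by (auto simp: a_def b_def c_def d_def a'_def b'_def c'_def d'_def blk_def)
    have vanish: "a g = a' g \<and> b g = 0\<^sub>m r m \<and> c' g = 0\<^sub>m m r" if g: "g \<in> carrier G" for g
    proof -
      have "E * \<rho>1 g = four_block_mat (a g) (b g) (0\<^sub>m m r) (0\<^sub>m m m)"
        using B[OF g] unfolding E_def
        by (elim conjE, simp only:, subst mult_four_block_mat[of _ r r _ m _ m _ _ r _ m]) auto
      moreover have "\<sigma>1 g * E = four_block_mat (a' g) (0\<^sub>m r m) (c' g) (0\<^sub>m m m)"
        using B'[OF g] unfolding E_def
        by (elim conjE, simp only:, subst mult_four_block_mat[of _ r r _ m _ m _ _ r _ m]) auto
      ultimately have "four_block_mat (a g) (b g) (0\<^sub>m m r) (0\<^sub>m m m) = four_block_mat (a' g) (0\<^sub>m r m) (c' g) (0\<^sub>m m m)"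
        using int1[OF g] by simp
      from four_block_mat_inject[OF _ _ _ _ _ _ _ _ this, of r r m m] show ?thesis using B[OF g] B'[OF g] by auto
    qed
    have \<rho>1: "\<rho>1 g = four_block_mat (a g) (0\<^sub>m r m) (c g) (d g)" if "g \<in> carrier G" for g
      using B[OF that] vanish[OF that] by simp
    have \<sigma>1: "\<sigma>1 g = four_block_mat (a g) (b' g) (0\<^sub>m m r) (d' g)" if "g \<in> carrier G" for g
      using B'[OF that] vanish[OF that] by simp
    have cc: "a g \<in> carrier_mat r r" "b' g \<in> carrier_mat r m" "c g \<in> carrier_mat m r" "d g \<in> carrier_mat m m" "d' g \<in> carrier_mat m m"
      if "g \<in> carrier G" for g using B[OF that] B'[OF that] by auto
    have mult: "a (g \<otimes> h) = a g * a h \<and> c (g \<otimes> h) = c g * a h + d g * c h \<and> d (g \<otimes> h) = d g * d h"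
      if g: "g \<in> carrier G" and h: "h \<in> carrier G" for g h
    proof -
      have "\<rho>1 g * \<rho>1 h = four_block_mat (a g * a h) (0\<^sub>m r m) (c g * a h + d g * c h) (d g * d h)"
        unfolding \<rho>1[OF g] \<rho>1[OF h] using cc[OF g] cc[OF h]
        by (subst mult_four_block_mat[of _ r r _ m _ m _ _ r _ m]) auto
      then have "four_block_mat (a (g \<otimes> h)) (0\<^sub>m r m) (c (g \<otimes> h)) (d (g \<otimes> h)) = \<dots>"
        using \<rho>1[of "g \<otimes> h"] rep1(1) g h by (simp add: mat_rep_def)
      from four_block_mat_inject[OF _ _ _ _ _ _ _ _ this, of r r m m] show ?thesis
        using cc[OF g] cc[OF h] cc[of "g \<otimes> h"] g h by auto
    qed
    have mult': "b' (g \<otimes> h) = b' g * d' h + a g * b' h \<and> d' (g \<otimes> h) = d' g * d' h"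
      if g: "g \<in> carrier G" and h: "h \<in> carrier G" for g h
    proof -
      have "\<sigma>1 g * \<sigma>1 h = four_block_mat (a g * a h) (b' g * d' h + a g * b' h) (0\<^sub>m m r) (d' g * d' h)"
        unfolding \<sigma>1[OF g] \<sigma>1[OF h] using cc[OF g] cc[OF h]
        by (subst mult_four_block_mat[of _ r r _ m _ m _ _ r _ m]) (auto intro!: cong_four_block_mat comm_add_mat[of _ r m])
      then have "four_block_mat (a (g \<otimes> h)) (b' (g \<otimes> h)) (0\<^sub>m m r) (d' (g \<otimes> h)) = \<dots>"
        using \<sigma>1[of "g \<otimes> h"] rep1(2) g h by (simp add: mat_rep_def)
      from four_block_mat_inject[OF _ _ _ _ _ _ _ _ this, of r r m m] show ?thesis
        using cc[OF g] cc[OF h] cc[of "g \<otimes> h"] g h by auto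
    qed
    have one: "a \<one> = 1\<^sub>m r \<and> d \<one> = 1\<^sub>m m" 
    proof -
      have "four_block_mat (a \<one>) (0\<^sub>m r m) (c \<one>) (d \<one>) = four_block_mat (1\<^sub>m r) (0\<^sub>m r m) (0\<^sub>m m r) (1\<^sub>m m)"
        using \<rho>1[of \<one>] rep1(1) n by (simp add: mat_rep_def)
      from four_block_mat_inject[OF _ _ _ _ _ _ _ _ this, of r r m m] show ?thesis using cc[of \<one>] by auto
    qed
    have one': "d' \<one> = 1\<^sub>m m" 
    proof -
      have "four_block_mat (a \<one>) (b' \<one>) (0\<^sub>m m r) (d' \<one>) = four_block_mat (1\<^sub>m r) (0\<^sub>m r m) (0\<^sub>m m r) (1\<^sub>m m)"
        using \<sigma>1[of \<one>] rep1(2) n by (simp add: mat_rep_def)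
      from four_block_mat_inject[OF _ _ _ _ _ _ _ _ this, of r r m m] show ?thesis using cc[of \<one>] by auto
    qed
    have ra: "mat_rep G r a" and rd: "mat_rep G m d" and rd': "mat_rep G m d'"
      using cc mult mult' one one' by (auto simp: mat_rep_def)
    have "tr (d g) = tr (d' g)" if g: "g \<in> carrier G" for g
      using tr1[OF g] cc[OF g] unfolding \<rho>1[OF g] \<sigma>1[OF g] by (simp add: tr_four_block[of _ r _ m])
    then obtain D where D: "D \<in> carrier_mat m m" "det D \<noteq> 0" "\<And>g. g \<in> carrier G \<Longrightarrow> D * d g = d' g * D"
      using less.IH[OF mn rd rd'] by blast
    \<comment> \<open>By \<open>mult\<close> and \<open>mult'\<close> the off-diagonal blocks
      \<open>c\<close> and \<open>b'\<close> are cocycles, trivialised by \<open>Y\<close> and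
      \<open>Z\<close>. So \<open>L\<close> splits \<open>\<rho>1\<close>, \<open>R\<close> splits
      \<open>\<sigma>1\<close>, and \<open>K\<close> matches the two block diagonal forms through
      \<open>D\<close>.\<close>
    obtain Y where Y: "Y \<in> carrier_mat m r" "\<And>g. g \<in> carrier G \<Longrightarrow> d g * Y + c g = Y * a g"
      using cocycle_coboundary[OF fin ra rd cc(3) conjunct1[OF conjunct2[OF mult]]] by blast
    obtain Z where Z: "Z \<in> carrier_mat r m" "\<And>g. g \<in> carrier G \<Longrightarrow> a g * Z + b' g = Z * d' g"
      using cocycle_coboundary[OF fin rd' ra cc(2) conjunct1[OF mult']] by blast
    define L where "L = four_block_mat (1\<^sub>m r) (0\<^sub>m r m) (- Y) (1\<^sub>m m)"
    define K where "K = four_block_mat (1\<^sub>m r) (0\<^sub>m r m) (0\<^sub>m m r) D"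
    define R where "R = four_block_mat (1\<^sub>m r) Z (0\<^sub>m m r) (1\<^sub>m m)"
    have LKR: "L \<in> carrier_mat n n" "K \<in> carrier_mat n n" "R \<in> carrier_mat n n"
      using Y D Z unfolding L_def K_def R_def n by (auto intro!: four_block_carrier_mat)
    have dL: "det L \<noteq> 0" unfolding L_def
      using Y by (subst det_four_block_mat_upper_right_zero[of _ r _ m]) auto
    have dK: "det K \<noteq> 0" unfolding K_def
      using D by (subst det_four_block_mat_upper_right_zero[of _ r _ m]) auto
    have dR: "det R \<noteq> 0" unfolding R_def
      using Z by (subst det_four_block_mat_lower_left_zero[of _ r _ m]) auto
    define \<delta> where "\<delta> g = four_block_mat (a g) (0\<^sub>m r m) (0\<^sub>m m r) (d g)" for g
    define \<delta>' where "\<delta>' g = four_block_mat (a g) (0\<^sub>m r m) (0\<^sub>m m r) (d' g)" for g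
    have step1: "L * \<rho>1 g = \<delta> g * L" if g: "g \<in> carrier G" for g
    proof -
      have "- (Y * a g) + c g = - (d g * Y)"
        unfolding Y(2)[OF g, symmetric] using cc[OF g] Y(1)
        by (intro eq_matI) auto
      then have "- Y * a g + c g = d g * (- Y)" using cc[OF g] Y(1) by simp
      then show ?thesis unfolding \<rho>1[OF g] \<delta>_def L_def using cc[OF g] Y(1)
        by (subst mult_four_block_mat[of _ r r _ m _ m _ _ r _ m], auto)
          (subst mult_four_block_mat[of _ r r _ m _ m _ _ r _ m], auto)
    qed
    have step2: "K * \<delta> g = \<delta>' g * K" if g: "g \<in> carrier G" for g
      unfolding \<delta>_def \<delta>'_def K_def using cc[OF g] D(1) D(3)[OF g]
        by (subst mult_four_block_mat[of _ r r _ m _ m _ _ r _ m], auto)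
          (subst mult_four_block_mat[of _ r r _ m _ m _ _ r _ m], auto)
    have step3: "R * \<delta>' g = \<sigma>1 g * R" if g: "g \<in> carrier G" for g
      unfolding \<sigma>1[OF g] \<delta>'_def R_def using cc[OF g] Z(1) Z(2)[OF g]
        by (subst mult_four_block_mat[of _ r r _ m _ m _ _ r _ m], auto)
          (subst mult_four_block_mat[of _ r r _ m _ m _ _ r _ m], auto)
    have cd: "\<delta> g \<in> carrier_mat n n" "\<delta>' g \<in> carrier_mat n n" if "g \<in> carrier G" for g
      using cc[OF that] unfolding \<delta>_def \<delta>'_def n by (auto intro!: four_block_carrier_mat)
    define T where "T = P' * (R * (K * (L * Q')))"
    have "T \<in> carrier_mat n n" "det T \<noteq> 0"
      unfolding T_def using LKR dL dK dR P' Q' by (auto simp: det_mult[of _ n] mult_carrier_mat[of _ n n _ n])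
    moreover have "T * \<rho> g = \<sigma> g * T" if g: "g \<in> carrier G" for g
    proof -
      note cs = LKR P(1) Q(1) P'(1) Q'(1) c0[OF g] c1[OF g] cd[OF g]
      have e1: "Q' * \<rho> g = \<rho>1 g * Q'"
        using cs Q'(2) unfolding \<rho>1_def by (simp add: asc)
      have e2: "P' * \<sigma>1 g = \<sigma> g * P'"
      proof -
        have "P' * \<sigma>1 g = (P' * P) * (\<sigma> g * P')" unfolding \<sigma>1_def using cs by (simp add: asc)
        then show ?thesis using P'(3) cs by simp
      qed
      have "T * \<rho> g = P' * (R * (K * (L * (Q' * \<rho> g))))" unfolding T_def using cs by (simp add: asc)
      also have "\<dots> = P' * (R * (K * ((L * \<rho>1 g) * Q')))" unfolding e1 using cs by (simp add: asc)
      also have "\<dots> = P' * (R * ((K * \<delta> g) * (L * Q')))" unfolding step1[OF g] using cs by (simp add: asc)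
      also have "\<dots> = P' * ((R * \<delta>' g) * (K * (L * Q')))" unfolding step2[OF g] using cs by (simp add: asc)
      also have "\<dots> = (P' * \<sigma>1 g) * (R * (K * (L * Q')))" unfolding step3[OF g] using cs by (simp add: asc)
      also have "\<dots> = \<sigma> g * T" unfolding e2 T_def using cs by (simp add: asc)
      finally show ?thesis .
    qed
    ultimately show ?thesis by blast
  qed
qed

text \<open>A finite part of \<open>Y\<close> already has the annihilator of \<open>Y\<close>.
  Stating this through linear functionals \<open>c\<close> is exactly what is needed to test an
  intertwining relation on finitely many elements.\<close>

lemma finite_spanning_subset:
  fixes Y :: "('i \<Rightarrow> complex) set"
  assumes "finite I"
  shows "\<exists>U\<subseteq>Y. finite U \<and> (\<forall>c. (\<forall>u\<in>U. (\<Sum>i\<in>I. c i * u i) = 0) \<longrightarrow> (\<forall>y\<in>Y. (\<Sum>i\<in>I. c i * y i) = 0))"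
  using assms
proof (induction I arbitrary: Y rule: finite_induct)
  case empty
  show ?case by (rule exI[of _ "{}"]) auto
next
  case (insert i I)
  show ?case
  proof (cases "\<forall>y\<in>Y. y i = 0")
    case True
    obtain U where "U \<subseteq> Y" "finite U"
      "\<forall>c. (\<forall>u\<in>U. (\<Sum>i\<in>I. c i * u i) = 0) \<longrightarrow> (\<forall>y\<in>Y. (\<Sum>i\<in>I. c i * y i) = 0)"
      using insert.IH[of Y] by blast
    moreover have "(\<Sum>j\<in>insert i I. c j * y j) = (\<Sum>j\<in>I. c j * y j)" if "y \<in> Y" for c y
      using True that insert.hyps by simp
    ultimately show ?thesis by (intro exI[of _ U]) (simp add: subset_iff)
  next
    case False
    then obtain v where v: "v \<in> Y" "v i \<noteq> 0" by blast
    define R where "R y = (\<lambda>j. y j - (y i / v i) * v j)" for y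
    obtain U' where U': "U' \<subseteq> R ` Y" "finite U'"
      "\<And>c. \<forall>u\<in>U'. (\<Sum>i\<in>I. c i * u i) = 0 \<Longrightarrow> \<forall>y\<in>R ` Y. (\<Sum>i\<in>I. c i * y i) = 0"
      using insert.IH[of "R ` Y"] by blast
    obtain U where U: "U \<subseteq> Y" "finite U" "U' = R ` U"
      using finite_subset_image[OF U'(2,1)] by blast
    have R: "(\<Sum>j\<in>I. c j * R y j) = (\<Sum>j\<in>insert i I. c j * y j) - (y i / v i) * (\<Sum>j\<in>insert i I. c j * v j)" for c y
    proof -
      have "(\<Sum>j\<in>I. c j * R y j) = (\<Sum>j\<in>I. c j * y j) - (y i / v i) * (\<Sum>j\<in>I. c j * v j)"
        by (simp add: R_def right_diff_distrib sum_subtractf sum_distrib_left mult_ac)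
      then show ?thesis using insert.hyps v by (simp add: field_simps)
    qed
    show ?thesis
    proof (intro exI[of _ "insert v U"] conjI allI impI ballI)
      fix c y assume c: "\<forall>u\<in>insert v U. (\<Sum>i\<in>insert i I. c i * u i) = 0" and y: "y \<in> Y"
      then have "\<forall>u\<in>U'. (\<Sum>j\<in>I. c j * u j) = 0" using R U by simp
      from U'(3)[OF this] show "(\<Sum>i\<in>insert i I. c i * y i) = 0" using R[of c y] c y by simp
    qed (use U v in auto)
  qed
qed

text \<open>Being an intertwiner is a linear condition on the pairs \<open>(\<rho> g, \<sigma> g)\<close>, so it suffices to check
  it on finitely many of them.\<close>

lemma (in group) locally_finite_equal_tr_imp_intertwiner:
  assumes lf: "\<And>U. finite U \<Longrightarrow> U \<subseteq> carrier G \<Longrightarrow> \<exists>H. subgroup H G \<and> finite H \<and> U \<subseteq> H"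
    and \<rho>: "mat_rep G n \<rho>" and \<sigma>: "mat_rep G n \<sigma>" and eq: "\<And>g. g \<in> carrier G \<Longrightarrow> tr (\<rho> g) = tr (\<sigma> g)"
  shows "\<exists>A\<in>carrier_mat n n. det A \<noteq> 0 \<and> (\<forall>g\<in>carrier G. A * \<rho> g = \<sigma> g * A)"
proof -
  \<comment> \<open>The boolean separates the entries of \<open>\<rho> g\<close> from those of
    \<open>\<sigma> g\<close>; \<open>e g\<close> is the pair of matrices read as a single
    vector.\<close>
  define I where "I = (UNIV :: bool set) \<times> {..<n} \<times> {..<n}"
  define e where "e g = (\<lambda>(b,ij). if b then \<rho> g $$ ij else \<sigma> g $$ ij)" for g
  have "finite I" by (simp add: I_def)
  from finite_spanning_subset[OF this, of "e ` carrier G"] obtain V where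
    V: "V \<subseteq> e ` carrier G" "finite V"
      "\<And>c. \<forall>u\<in>V. (\<Sum>i\<in>I. c i * u i) = 0 \<Longrightarrow> \<forall>y\<in>e ` carrier G. (\<Sum>i\<in>I. c i * y i) = 0" by blast
  obtain U where U: "U \<subseteq> carrier G" "finite U" "V = e ` U" using finite_subset_image[OF V(2,1)] by blast
  obtain H where H: "subgroup H G" "finite H" "U \<subseteq> H" using lf[OF U(2,1)] by blast
  have sub: "H \<subseteq> carrier G" using H subgroup.subset by blast
  interpret H: group "G\<lparr>carrier := H\<rparr>" using subgroup.subgroup_is_group[OF H(1)] is_group by blast
  have "mat_rep (G\<lparr>carrier := H\<rparr>) n \<rho>" "mat_rep (G\<lparr>carrier := H\<rparr>) n \<sigma>"
    using \<rho> \<sigma> sub by (auto simp: mat_rep_def subset_iff)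
  from H.equal_tr_imp_intertwiner[OF _ this] H(2) eq sub
  have "\<exists>A\<in>carrier_mat n n. det A \<noteq> 0 \<and> (\<forall>g\<in>H. A * \<rho> g = \<sigma> g * A)" by (simp add: subset_iff)
  then obtain A where A: "A \<in> carrier_mat n n" "det A \<noteq> 0" "\<And>g. g \<in> H \<Longrightarrow> A * \<rho> g = \<sigma> g * A"
    by blast
  have c: "\<rho> g \<in> carrier_mat n n" "\<sigma> g \<in> carrier_mat n n" if "g \<in> carrier G" for g
    using \<rho> \<sigma> that by (auto simp: mat_rep_def)
  have "A * \<rho> g = \<sigma> g * A" if g: "g \<in> carrier G" for g
  proof (rule eq_matI)
    fix i j assume "i < dim_row (\<sigma> g * A)" "j < dim_col (\<sigma> g * A)"
    then have ij: "i < n" "j < n" using c[OF g] A by auto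
    \<comment> \<open>These are the coefficients of the functional whose value at \<open>e h\<close>
      is entry \<open>(i,j)\<close> of \<open>A * \<rho> h - \<sigma> h * A\<close>.\<close>
    define w where "w = (\<lambda>(b,k,l). if b then (if l = j then A $$ (i,k) else 0) else (if k = i then - A $$ (l,j) else 0))"
    have w: "(\<Sum>x\<in>I. w x * e h x) = (A * \<rho> h) $$ (i,j) - (\<sigma> h * A) $$ (i,j)" if h: "h \<in> carrier G" for h
    proof -
      have "(\<Sum>x\<in>I. w x * e h x) = (\<Sum>k<n. \<Sum>l<n. w (True,k,l) * e h (True,k,l)) + (\<Sum>k<n. \<Sum>l<n. w (False,k,l) * e h (False,k,l))"
      proof -
        have "(\<Sum>x\<in>I. w x * e h x) = (\<Sum>b\<in>UNIV. \<Sum>k<n. \<Sum>l<n. w (b,k,l) * e h (b,k,l))"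
          unfolding I_def by (simp add: sum.cartesian_product case_prod_unfold)
        then show ?thesis by (simp add: UNIV_bool)
      qed
      also have "(\<Sum>k<n. \<Sum>l<n. w (True,k,l) * e h (True,k,l)) = (\<Sum>k<n. A $$ (i,k) * \<rho> h $$ (k,j))"
      proof (rule sum.cong[OF refl])
        fix k
        have "(\<Sum>l<n. w (True,k,l) * e h (True,k,l)) = (\<Sum>l<n. if l = j then A $$ (i,k) * \<rho> h $$ (k,j) else 0)"
          by (intro sum.cong) (auto simp: w_def e_def)
        then show "(\<Sum>l<n. w (True,k,l) * e h (True,k,l)) = A $$ (i,k) * \<rho> h $$ (k,j)" using ij by simp
      qed
      also have "\<dots> = (A * \<rho> h) $$ (i,j)" using mult_mat_index[OF A(1) c(1)[OF h] ij] by simp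
      also have "(\<Sum>k<n. \<Sum>l<n. w (False,k,l) * e h (False,k,l)) = (\<Sum>k<n. if k = i then - (\<Sum>l<n. \<sigma> h $$ (i,l) * A $$ (l,j)) else 0)"
        by (intro sum.cong refl) (auto simp: w_def e_def sum_negf[symmetric] mult.commute intro!: sum.cong)
      also have "\<dots> = - (\<sigma> h * A) $$ (i,j)" using mult_mat_index[OF c(2)[OF h] A(1) ij] ij by simp
      finally show ?thesis by simp
    qed
    have "(\<Sum>x\<in>I. w x * e h x) = 0" if "h \<in> U" for h
    proof -
      have h: "h \<in> H" "h \<in> carrier G" using that H(3) U(1) by auto
      show ?thesis unfolding w[OF h(2)] A(3)[OF h(1)] by (rule diff_self)
    qed
    then have "\<forall>u\<in>V. (\<Sum>x\<in>I. w x * u x) = 0" using U(3) by blast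
    then have "(\<Sum>x\<in>I. w x * e g x) = 0" using V(3) g by blast
    then show "(A * \<rho> g) $$ (i,j) = (\<sigma> g * A) $$ (i,j)" using w[OF g] by (simp only: right_minus_eq)
  qed (use c[OF g] A in auto)
  then show ?thesis using A by blast
qed

section \<open>From matrix representations to \<open>GL n\<close>\<close>

lemma GL_carrier: "carrier (GL n) = {A \<in> carrier_mat n n. det A \<noteq> 0}"
proof -
  have "A \<in> carrier_mat n n \<and> det A \<noteq> 0" if unit: "A \<in> Units (ring_mat TYPE(complex) n ())" for A
  proof -
    obtain B where B: "A \<in> carrier_mat n n" "B \<in> carrier_mat n n" "A * B = 1\<^sub>m n"
      using unit unfolding Units_def ring_mat_def by auto
    then have "det A * det B = 1" using det_mult[of A n B] by simp
    then show ?thesis using B by auto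
  qed
  then show ?thesis using det_non_zero_imp_unit[of _ n "()"] unfolding GL_def units_of_def by auto
qed

lemma mat_rep_imp_representation:
  fixes G (structure)
  assumes "group G" "mat_rep G n \<rho>"
  shows "representation G n \<rho>"
proof -
  interpret G: group G by fact
  have "det (\<rho> g) \<noteq> 0" if g: "g \<in> carrier G" for g
  proof -
    have "\<rho> g * \<rho> (inv g) = 1\<^sub>m n" using assms g unfolding mat_rep_def by (metis G.inv_closed G.r_inv)
    then have "det (\<rho> g) * det (\<rho> (inv g)) = 1"
      using assms g det_mult[of "\<rho> g" n "\<rho> (inv g)"] by (simp add: mat_rep_def)
    then show ?thesis by auto
  qed
  then have "\<rho> g \<in> carrier (GL n)" if "g \<in> carrier G" for g
    using assms(2) that by (auto simp: GL_carrier mat_rep_def)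
  moreover have "x \<otimes>\<^bsub>GL n\<^esub> y = x * y" for x y by (simp add: GL_def units_of_def ring_mat_def)
  ultimately show ?thesis using assms(2) by (auto simp: representation_def mat_rep_def intro!: homI)
qed

section \<open>Characters of torsion abelian groups\<close>

text \<open>There are at least two roots, so one of them avoids 1. This keeps an extended character
  nontrivial at the new element even if \<open>c = 1\<close>.\<close>

lemma complex_nth_root_ne_1:
  fixes c :: complex
  assumes "n \<ge> 2" "c \<noteq> 0"
  obtains z where "z ^ n = c" "z \<noteq> 1"
proof -
  have "card {z. z ^ n = c} = n" using assms by (intro card_nth_roots) auto
  then have "\<not> {z. z ^ n = c} \<subseteq> {1}" using assms card_mono[of "{1::complex}" "{z. z ^ n = c}"] by fastforce
  then show ?thesis using that by blast
qed

locale torsion_comm_group = comm_group +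
  assumes torsion: "x \<in> carrier G \<Longrightarrow> \<exists>n::nat. n > 0 \<and> x [^] n = \<one>"
begin

text \<open>A partial character, given by its graph. Closure under inverses and single-valuedness follow
  because the group is torsion.\<close>

definition partial_char :: "('a \<times> complex) set \<Rightarrow> bool" where
  "partial_char R \<longleftrightarrow> R \<subseteq> carrier G \<times> (UNIV - {0}) \<and> (\<one>, 1) \<in> R \<and>
     (\<forall>a z b w. (a,z) \<in> R \<longrightarrow> (b,w) \<in> R \<longrightarrow> (a \<otimes> b, z * w) \<in> R) \<and> (\<forall>z. (\<one>,z) \<in> R \<longrightarrow> z = 1)"

lemma partial_charD:
  assumes "partial_char R"
  shows "(a,z) \<in> R \<Longrightarrow> a \<in> carrier G" "(a,z) \<in> R \<Longrightarrow> z \<noteq> 0" "(\<one>,1) \<in> R"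
    "(a,z) \<in> R \<Longrightarrow> (b,w) \<in> R \<Longrightarrow> (a \<otimes> b, z * w) \<in> R" "(\<one>,z) \<in> R \<Longrightarrow> z = 1"
  using assms unfolding partial_char_def by blast+

lemma partial_char_pow:
  assumes "partial_char R" "(a,z) \<in> R"
  shows "(a [^] (n::nat), z ^ n) \<in> R"
proof (induction n)
  case 0 then show ?case using partial_charD[OF assms(1)] by simp
next
  case (Suc n)
  from partial_charD(4)[OF assms(1) Suc assms(2)] show ?case by (simp add: mult.commute)
qed

lemma partial_char_inv:
  assumes R: "partial_char R" "(a,z) \<in> R"
  shows "(inv a, inverse z) \<in> R"
proof -
  have a: "a \<in> carrier G" and z: "z \<noteq> 0" using partial_charD[OF R(1)] R(2) by blast+
  obtain n where n: "n > 0" "a [^] (n::nat) = \<one>" using torsion[OF a] by blast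
  then obtain k where k: "n = Suc k" using gr0_implies_Suc by blast
  have "z ^ n = 1" using partial_char_pow[OF R, of n] n partial_charD(5)[OF R(1)] by metis
  then have "inverse z = z ^ k" using z k by (simp add: field_simps)
  moreover have "inv a = a [^] k" using n k a by (metis inv_equality nat_pow_Suc nat_pow_closed)
  ultimately show ?thesis using partial_char_pow[OF R] by simp
qed

lemma partial_char_unique:
  assumes R: "partial_char R" "(a,z) \<in> R" "(a,w) \<in> R"
  shows "z = w"
proof -
  have "a \<in> carrier G" "w \<noteq> 0" using partial_charD[OF R(1)] R by blast+
  moreover have "(a \<otimes> inv a, z * inverse w) \<in> R" using partial_charD(4)[OF R(1,2) partial_char_inv[OF R(1,3)]] .
  ultimately show ?thesis using partial_charD(5)[OF R(1)] by (metis nonzero_eq_divide_eq divide_inverse r_inv mult_1)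
qed

text \<open>If \<open>r\<close> is the least positive exponent with \<open>t [^] r\<close> in the
  domain, the value at \<open>t\<close> has to be an \<open>r\<close>-th root of the value at
  \<open>t [^] r\<close>, and any such root works. As \<open>t\<close> is outside the domain,
  \<open>r\<close> is at least 2 and a root other than 1 is available.\<close>

lemma partial_char_extend:
  assumes R: "partial_char R" and t: "t \<in> carrier G" "t \<notin> Domain R"
  obtains R' \<zeta> where "partial_char R'" "R \<subseteq> R'" "(t,\<zeta>) \<in> R'" "\<zeta> \<noteq> 1"
proof -
  note D = partial_charD[OF R]
  define r where "r = (LEAST r::nat. r > 0 \<and> t [^] r \<in> Domain R)"
  obtain n where n: "n > 0" "t [^] (n::nat) = \<one>" using torsion[OF t(1)] by blast
  then have ex: "n > 0 \<and> t [^] n \<in> Domain R" using D(3) by auto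
  have r: "r > 0" "t [^] r \<in> Domain R" using LeastI[of "\<lambda>r. r > 0 \<and> t [^] r \<in> Domain R", OF ex] by (auto simp: r_def)
  have least: "s = 0" if "s < r" "t [^] s \<in> Domain R" for s
    using not_less_Least[of s "\<lambda>r. r > 0 \<and> t [^] r \<in> Domain R"] that by (auto simp: r_def)
  have "r \<noteq> 1" using r(2) t by auto
  then have r2: "r \<ge> 2" using r(1) by simp
  obtain c where c: "(t [^] r, c) \<in> R" using r by blast
  obtain \<zeta> where \<zeta>: "\<zeta> ^ r = c" "\<zeta> \<noteq> 1" using complex_nth_root_ne_1[OF r2 D(2)[OF c]] by blast
  have \<zeta>0: "\<zeta> \<noteq> 0" using \<zeta>(1) D(2)[OF c] r(1) by auto
  define R' where "R' = {(a \<otimes> t [^] i, z * \<zeta> ^ i) | a z i. (a,z) \<in> R \<and> i \<in> (UNIV :: nat set)}"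
  have "partial_char R'"
    unfolding partial_char_def
  proof (intro conjI allI impI)
    show "R' \<subseteq> carrier G \<times> (UNIV - {0})" using D(1,2) t(1) \<zeta>0 by (auto simp: R'_def)
    show "(\<one>, 1) \<in> R'" unfolding R'_def using D(3) t(1)
      by (intro CollectI exI[of _ \<one>] exI[of _ 1] exI[of _ 0]) auto
    fix a z b w assume "(a,z) \<in> R'" "(b,w) \<in> R'"
    then obtain a' z' i b' w' j where ab: "(a',z') \<in> R" "(b',w') \<in> R" "a = a' \<otimes> t [^] (i::nat)" "z = z' * \<zeta> ^ i"
      "b = b' \<otimes> t [^] (j::nat)" "w = w' * \<zeta> ^ j" by (auto simp: R'_def)
    have "a \<otimes> b = (a' \<otimes> b') \<otimes> t [^] (i + j)"
      using ab t(1) D(1)[OF ab(1)] D(1)[OF ab(2)] by (simp add: nat_pow_mult[symmetric] m_ac)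
    moreover have "z * w = (z' * w') * \<zeta> ^ (i + j)" using ab by (simp add: power_add)
    ultimately show "(a \<otimes> b, z * w) \<in> R'" using D(4)[OF ab(1,2)] by (auto simp: R'_def)
  next
    fix z assume "(\<one>, z) \<in> R'"
    then obtain a w i where a: "(a,w) \<in> R" "\<one> = a \<otimes> t [^] (i::nat)" "z = w * \<zeta> ^ i" by (auto simp: R'_def)
    have ac: "a \<in> carrier G" using D(1)[OF a(1)] .
    have "inv a = t [^] i" using a(2) ac t(1) by (metis inv_unique' m_comm nat_pow_closed)
    then have dom: "t [^] i \<in> Domain R" using partial_char_inv[OF R a(1)] by auto
    \<comment> \<open>By minimality of \<open>r\<close> the remainder \<open>s\<close> is zero, so
      only powers of \<open>t [^] r\<close> meet the old domain, and there \<open>\<zeta>\<close>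
      agrees with the given values.\<close>
    define q s where "q = i div r" "s = i mod r"
    have i: "i = r * q + s" by (simp add: q_s_def)
    have cq: "(t [^] (r * q), c ^ q) \<in> R"
      using partial_char_pow[OF R c, of q] t(1) by (simp add: nat_pow_pow)
    obtain u where u: "(t [^] i, u) \<in> R" using dom by blast
    have "t [^] i \<otimes> inv (t [^] (r * q)) = t [^] s"
      unfolding i using t(1) by (simp add: nat_pow_mult[symmetric] m_ac)
    then have "t [^] s \<in> Domain R" using D(4)[OF u partial_char_inv[OF R cq]] by auto
    then have "s = 0" using least r(1) by (simp add: q_s_def)
    then have irq: "i = r * q" using i by simp
    have "(a \<otimes> t [^] i, w * c ^ q) \<in> R" using D(4)[OF a(1) cq] irq by simp
    then have "w * c ^ q = 1" using D(5) a(2) by simp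
    then show "z = 1" using a(3) \<zeta>(1) irq by (simp add: power_mult)
  qed
  moreover have "R \<subseteq> R'"
  proof
    fix x assume x: "x \<in> R"
    then show "x \<in> R'" unfolding R'_def using D(1)[of "fst x" "snd x"]
      by (intro CollectI exI[of _ "fst x"] exI[of _ "snd x"] exI[of _ 0]) auto
  qed
  moreover have "(t,\<zeta>) \<in> R'" unfolding R'_def using D(3) t(1)
      by (intro CollectI exI[of _ \<one>] exI[of _ 1] exI[of _ 1]) auto
  ultimately show ?thesis using that \<zeta>(2) by blast
qed

definition chars :: "('a \<Rightarrow> complex) set" where
  "chars = {\<theta>. (\<forall>x\<in>carrier G. \<forall>y\<in>carrier G. \<theta> (x \<otimes> y) = \<theta> x * \<theta> y) \<and> \<theta> \<one> = 1}"

text \<open>Zorn's lemma on graphs of partial characters: a maximal one is total, since otherwise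
  \<open>partial_char_extend\<close> would enlarge it.\<close>

theorem char_separating:
  assumes D: "subgroup D G" and e: "e \<in> carrier G" "e \<notin> D"
  obtains \<theta> where "\<theta> \<in> chars" "\<And>d. d \<in> D \<Longrightarrow> \<theta> d = 1" "\<theta> e \<noteq> 1"
proof -
  interpret D: subgroup D G by fact
  have "partial_char (D \<times> {1})" by (auto simp: partial_char_def)
  \<comment> \<open>The value at \<open>e\<close> is fixed before passing to a maximal extension, so
    every extension of \<open>R0\<close> separates \<open>e\<close> from \<open>D\<close>.\<close>
  then obtain R0 \<zeta> where R0: "partial_char R0" "D \<times> {1} \<subseteq> R0" "(e,\<zeta>) \<in> R0" "\<zeta> \<noteq> 1"
    using partial_char_extend[of "D \<times> {1}" e] e by blast
  define \<A> where "\<A> = {R. partial_char R \<and> R0 \<subseteq> R}"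
  have "\<exists>M\<in>\<A>. \<forall>R\<in>\<A>. M \<subseteq> R \<longrightarrow> R = M"
  proof (rule subset_Zorn_nonempty)
    show "\<A> \<noteq> {}" using R0 by (auto simp: \<A>_def)
    fix \<C> assume C: "\<C> \<noteq> {}" "subset.chain \<A> \<C>"
    have P: "partial_char R" "R0 \<subseteq> R" if "R \<in> \<C>" for R
      using C(2) that by (auto simp: subset.chain_def \<A>_def)
    have "partial_char (\<Union>\<C>)"
      unfolding partial_char_def
    proof (intro conjI allI impI)
      show "\<Union>\<C> \<subseteq> carrier G \<times> (UNIV - {0})" using partial_charD(1,2)[OF P(1)] by fast
      show "(\<one>, 1) \<in> \<Union>\<C>" using C(1) partial_charD(3)[OF P(1)] by blast
      show "z = 1" if "(\<one>, z) \<in> \<Union>\<C>" for z using that partial_charD(5)[OF P(1)] by blast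
      fix a z b w assume "(a,z) \<in> \<Union>\<C>" "(b,w) \<in> \<Union>\<C>"
      then obtain R1 R2 where R: "R1 \<in> \<C>" "R2 \<in> \<C>" "(a,z) \<in> R1" "(b,w) \<in> R2" by blast
      have "R1 \<subseteq> R2 \<or> R2 \<subseteq> R1" using C(2) R by (auto simp: subset.chain_def)
      then show "(a \<otimes> b, z * w) \<in> \<Union>\<C>"
        using R partial_charD(4)[OF P(1), of R1 a z b w] partial_charD(4)[OF P(1), of R2 a z b w] by blast
    qed
    moreover have "R0 \<subseteq> \<Union>\<C>" using C(1) P(2) by blast
    ultimately show "\<Union>\<C> \<in> \<A>" by (simp add: \<A>_def)
  qed
  then obtain M where M: "partial_char M" "R0 \<subseteq> M" "\<And>R. partial_char R \<Longrightarrow> R0 \<subseteq> R \<Longrightarrow> M \<subseteq> R \<Longrightarrow> R = M"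
    by (auto simp: \<A>_def)
  have dom: "\<exists>z. (t,z) \<in> M" if t: "t \<in> carrier G" for t
  proof (rule ccontr)
    assume "\<not> ?thesis"
    then have "t \<notin> Domain M" by blast
    then obtain R' \<zeta>' where "partial_char R'" "M \<subseteq> R'" "(t,\<zeta>') \<in> R'"
      using partial_char_extend[OF M(1) t] by blast
    then show False using M \<open>t \<notin> Domain M\<close> by blast
  qed
  define \<theta> where "\<theta> t = (THE z. (t,z) \<in> M)" for t
  have lam: "\<theta> t = z" if "(t,z) \<in> M" for t z
    unfolding \<theta>_def using that partial_char_unique[OF M(1)] by (intro the_equality) auto
  have "\<theta> \<in> chars"
    unfolding chars_def
  proof (intro CollectI conjI ballI)
    fix x y assume "x \<in> carrier G" "y \<in> carrier G"
    then obtain z w where zw: "(x,z) \<in> M" "(y,w) \<in> M" using dom by blast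
    show "\<theta> (x \<otimes> y) = \<theta> x * \<theta> y"
      using lam[OF partial_charD(4)[OF M(1) zw]] lam[OF zw(1)] lam[OF zw(2)] by simp
  qed (use lam partial_charD(3)[OF M(1)] in blast)
  moreover have "\<theta> d = 1" if "d \<in> D" for d using lam R0(2) M(2) that by blast
  moreover have "\<theta> e \<noteq> 1" using lam[of e \<zeta>] R0 M(2) by blast
  ultimately show ?thesis using that by blast
qed

lemma char_norm:
  assumes "\<theta> \<in> chars" "x \<in> carrier G"
  shows "norm (\<theta> x) = 1"
proof -
  obtain n where n: "n > 0" "x [^] (n::nat) = \<one>" using torsion assms by blast
  have "\<theta> (x [^] k) = \<theta> x ^ k" for k :: nat
    using assms by (induction k) (auto simp: chars_def mult.commute)
  then have "\<theta> x ^ n = 1" using n assms by (metis (mono_tags, lifting) chars_def mem_Collect_eq)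
  then have "norm (\<theta> x) ^ n = 1" by (metis norm_one norm_power)
  then show ?thesis using power_eq_imp_eq_base[of "norm (\<theta> x)" n 1] n by simp
qed

end

section \<open>Induced representations\<close>

text \<open>Unitarity is expressed as a relation between the entries at \<open>g\<close> and at its
  inverse. In this form it is immediate for block sums and for induced matrices.\<close>

definition unitary_mat_rep :: "('g, 'x) monoid_scheme \<Rightarrow> nat \<Rightarrow> ('g \<Rightarrow> complex mat) \<Rightarrow> bool" where
  "unitary_mat_rep G n \<rho> \<longleftrightarrow> mat_rep G n \<rho> \<and>
     (\<forall>g\<in>carrier G. \<forall>i<n. \<forall>j<n. \<rho> (inv\<^bsub>G\<^esub> g) $$ (i,j) = cnj (\<rho> g $$ (j,i)))"

lemma mat_adjoint_index:
  fixes A :: "complex mat"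
  assumes "A \<in> carrier_mat n n" "i < n" "j < n"
  shows "mat_adjoint A $$ (i,j) = cnj (A $$ (j,i))"
  using assms by (simp add: mat_adjoint_def mat_of_rows_def)

lemma unitary_mat_rep_imp_unitary_rep:
  fixes G (structure)
  assumes "group G" and \<rho>: "unitary_mat_rep G n \<rho>"
  shows "unitary_rep G n \<rho>"
proof -
  interpret G: group G by fact
  have rep: "mat_rep G n \<rho>" using \<rho> by (simp add: unitary_mat_rep_def)
  have "mat_adjoint (\<rho> g) * \<rho> g = 1\<^sub>m n \<and> \<rho> g * mat_adjoint (\<rho> g) = 1\<^sub>m n" if g: "g \<in> carrier G" for g
  proof -
    have c: "\<rho> g \<in> carrier_mat n n" "\<rho> (inv g) \<in> carrier_mat n n" using rep g by (auto simp: mat_rep_def)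
    have "mat_adjoint (\<rho> g) = \<rho> (inv g)"
      using c \<rho> g mat_adjoint_index[OF c(1)] by (intro eq_matI) (auto simp: unitary_mat_rep_def mat_adjoint_def)
    then show ?thesis using rep g unfolding mat_rep_def by (metis G.inv_closed G.l_inv G.r_inv)
  qed
  then show ?thesis using mat_rep_imp_representation[OF assms(1) rep] by (simp add: unitary_rep_def)
qed

lemma unitary_mat_rep_sum:
  fixes G (structure)
  assumes "group G" and \<rho>: "unitary_mat_rep G n \<rho>" and \<sigma>: "unitary_mat_rep G m \<sigma>"
  shows "\<exists>\<tau>. unitary_mat_rep G (n + m) \<tau> \<and> (\<forall>g\<in>carrier G. tr (\<tau> g) = tr (\<rho> g) + tr (\<sigma> g))"
proof -
  interpret G: group G by fact
  have r: "mat_rep G n \<rho>" "mat_rep G m \<sigma>" using \<rho> \<sigma> by (auto simp: unitary_mat_rep_def)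
  have c: "\<rho> g \<in> carrier_mat n n" "\<sigma> g \<in> carrier_mat m m" if "g \<in> carrier G" for g
    using r that by (auto simp: mat_rep_def)
  define \<tau> where "\<tau> g = four_block_mat (\<rho> g) (0\<^sub>m n m) (0\<^sub>m m n) (\<sigma> g)" for g
  have mult: "\<tau> (g \<otimes> h) = \<tau> g * \<tau> h" if g: "g \<in> carrier G" and h: "h \<in> carrier G" for g h
  proof -
    have e: "\<rho> (g \<otimes> h) = \<rho> g * \<rho> h" "\<sigma> (g \<otimes> h) = \<sigma> g * \<sigma> h"
      using r g h by (auto simp: mat_rep_def)
    show ?thesis unfolding \<tau>_def e using c[OF g] c[OF h]
      by (subst mult_four_block_mat[of _ n n _ m _ m _ _ n _ m]) auto
  qed
  have "mat_rep G (n + m) \<tau>"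
    unfolding mat_rep_def
  proof (intro conjI ballI)
    show "\<tau> g \<in> carrier_mat (n + m) (n + m)" if "g \<in> carrier G" for g
      using c[OF that] unfolding \<tau>_def by (intro four_block_carrier_mat)
    show "\<tau> \<one> = 1\<^sub>m (n + m)" using r by (simp add: \<tau>_def mat_rep_def)
  qed (rule mult)
  moreover have "\<tau> (inv g) $$ (i,j) = cnj (\<tau> g $$ (j,i))"
    if g: "g \<in> carrier G" and ij: "i < n + m" "j < n + m" for g i j
  proof -
    have "\<rho> (inv g) $$ (i,j) = cnj (\<rho> g $$ (j,i))" if "i < n" "j < n" using \<rho> g that by (simp add: unitary_mat_rep_def)
    moreover have "\<sigma> (inv g) $$ (i - n,j - n) = cnj (\<sigma> g $$ (j - n,i - n))" if "\<not> i < n" "\<not> j < n"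
      using \<sigma> g that ij by (simp add: unitary_mat_rep_def)
    ultimately show ?thesis using c[OF g] c[of "inv g"] g ij by (auto simp: \<tau>_def)
  qed
  moreover have "tr (\<tau> g) = tr (\<rho> g) + tr (\<sigma> g)" if "g \<in> carrier G" for g
    unfolding \<tau>_def using c[OF that] by (rule tr_four_block)
  ultimately show ?thesis by (auto simp: unitary_mat_rep_def)
qed

locale finite_index_normal = group +
  fixes T
  assumes normal: "T \<lhd> G" and fin_index: "finite (rcosets T)"
begin

sublocale T: normal T G by (rule normal)

text \<open>Representatives of the cosets \<open>r i T\<close>, numbered from 0 so that they can
  index matrix rows. Normality converts between these and the right cosets counted by
  \<open>fin_index\<close>.\<close>

lemma transversal:
  "\<exists>k r. (0::nat) < k \<and> (\<forall>i<k. r i \<in> carrier G) \<and>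
    (\<forall>g\<in>carrier G. \<exists>!i. i < k \<and> inv (r i) \<otimes> g \<in> T)"
proof -
  define k where "k = card (rcosets T)"
  obtain b where b: "bij_betw b {0..<k} (rcosets T)" using ex_bij_betw_nat_finite[OF fin_index] k_def by blast
  define r where "r i = (SOME x. x \<in> carrier G \<and> T #> x = b i)" for i
  have r: "r i \<in> carrier G \<and> T #> r i = b i" if "i < k" for i
  proof -
    have "b i \<in> rcosets T" using b that by (auto simp: bij_betw_def)
    then have "\<exists>x. x \<in> carrier G \<and> T #> x = b i" by (auto simp: RCOSETS_def)
    then show ?thesis unfolding r_def by (rule someI_ex)
  qed
  have iff: "inv (r i) \<otimes> g \<in> T \<longleftrightarrow> T #> g = b i" if i: "i < k" and g: "g \<in> carrier G" for i g
  proof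
    assume "inv (r i) \<otimes> g \<in> T"
    then have "r i \<otimes> (inv (r i) \<otimes> g) \<otimes> inv (r i) \<in> T" using r[OF i] T.inv_op_closed2 by blast
    then have "g \<otimes> inv (r i) \<in> T" using r[OF i] g by (simp add: m_assoc[symmetric])
    then have "(g \<otimes> inv (r i)) \<otimes> r i \<in> T #> r i" by (auto simp: r_coset_def)
    then have "g \<in> T #> r i" using r[OF i] g by (simp add: m_assoc)
    then show "T #> g = b i" using repr_independence[OF _ _ T.subgroup_axioms] r[OF i] by metis
  next
    assume "T #> g = b i"
    then have "g \<in> T #> r i" using rcos_self[OF g T.subgroup_axioms] r[OF i] by metis
    then obtain t where t: "t \<in> T" "g = t \<otimes> r i" by (auto simp: r_coset_def)
    then have "inv (r i) \<otimes> g = inv (r i) \<otimes> t \<otimes> r i" using r[OF i] by (simp add: m_assoc)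
    then show "inv (r i) \<otimes> g \<in> T" using T.inv_op_closed1[of "r i" t] r[OF i] t by simp
  qed
  have "\<exists>!i. i < k \<and> inv (r i) \<otimes> g \<in> T" if g: "g \<in> carrier G" for g
  proof -
    have "T #> g \<in> rcosets T" using g by (auto simp: RCOSETS_def)
    then have "T #> g \<in> b ` {0..<k}" using bij_betw_imp_surj_on[OF b] by blast
    then obtain i where i: "i < k" "b i = T #> g" by auto
    show ?thesis
    proof (rule ex1I[of _ i])
      show "i < k \<and> inv (r i) \<otimes> g \<in> T" using i iff[OF _ g] by simp
      fix j assume j: "j < k \<and> inv (r j) \<otimes> g \<in> T"
      then have "b j = b i" using i(2) iff[of j, OF _ g] by simp
      then show "j = i" using inj_onD[OF bij_betw_imp_inj_on[OF b]] i(1) j by simp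
    qed
  qed
  moreover from this[OF one_closed] have "k > 0" by auto
  ultimately show ?thesis using r by (intro exI[of _ k] exI[of _ r]) simp
qed

text \<open>The induced representation in monomial form. Since \<open>T\<close> is normal, a
  diagonal position of the matrix of \<open>s\<close> is occupied exactly when \<open>s\<close> lies
  in \<open>T\<close>, hence the zero trace elsewhere.\<close>

lemma induced_rep:
  assumes r: "\<And>i. i < k \<Longrightarrow> r i \<in> carrier G"
    and ex1: "\<And>g. g \<in> carrier G \<Longrightarrow> \<exists>!i. i < k \<and> inv (r i) \<otimes> g \<in> T"
    and \<theta>: "\<And>x y. x \<in> T \<Longrightarrow> y \<in> T \<Longrightarrow> \<theta> (x \<otimes> y) = \<theta> x * \<theta> y" "\<theta> \<one> = 1"
      "\<And>x. x \<in> T \<Longrightarrow> norm (\<theta> x :: complex) = 1"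
  shows "\<exists>\<rho>. unitary_mat_rep G k \<rho> \<and>
    (\<forall>s\<in>carrier G. tr (\<rho> s) = (if s \<in> T then \<Sum>i<k. \<theta> (inv (r i) \<otimes> s \<otimes> r i) else 0))"
proof -
  define u where "u s i j = inv (r i) \<otimes> s \<otimes> r j" for s i j
  define \<rho> where "\<rho> s = mat k k (\<lambda>(i,j). if u s i j \<in> T then \<theta> (u s i j) else 0)" for s
  have u: "u s i j \<in> carrier G" if "s \<in> carrier G" "i < k" "j < k" for s i j
    using that r by (simp add: u_def)
  have comp: "u s i l \<otimes> u s' l j = u (s \<otimes> s') i j"
    if "s \<in> carrier G" "s' \<in> carrier G" "i < k" "j < k" "l < k" for s s' i j l
  proof -
    have "u s i l \<otimes> u s' l j = inv (r i) \<otimes> (s \<otimes> (r l \<otimes> (inv (r l) \<otimes> (s' \<otimes> r j))))"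
      using that r by (simp add: u_def m_assoc)
    also have "r l \<otimes> (inv (r l) \<otimes> (s' \<otimes> r j)) = s' \<otimes> r j"
      using that r by (simp add: m_assoc[symmetric])
    finally show ?thesis using that r by (simp add: u_def m_assoc)
  qed
  have \<theta>inv: "\<theta> (inv x) = cnj (\<theta> x)" if x: "x \<in> T" for x
  proof -
    have "\<theta> (inv x) * \<theta> x = 1" using \<theta>(1)[of "inv x" x] \<theta>(2) x by simp
    moreover have "cnj (\<theta> x) * \<theta> x = 1" using \<theta>(3)[OF x] complex_norm_square[of "\<theta> x"] by (simp add: mult.commute)
    ultimately have "\<theta> (inv x) * \<theta> x = cnj (\<theta> x) * \<theta> x" by simp
    moreover have "\<theta> x \<noteq> 0" using \<theta>(3)[OF x] by auto
    ultimately show ?thesis by simp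
  qed
  have one: "\<rho> \<one> = 1\<^sub>m k"
  proof (rule eq_matI)
    fix i j assume "i < dim_row (1\<^sub>m k :: complex mat)" "j < dim_col (1\<^sub>m k :: complex mat)"
    then have ij: "i < k" "j < k" by auto
    have e: "u \<one> i j = inv (r i) \<otimes> r j" using r ij by (simp add: u_def)
    have "inv (r j) \<otimes> r j \<in> T" using r ij by simp
    then have "inv (r i) \<otimes> r j \<in> T \<longleftrightarrow> i = j" using ex1[OF r[OF ij(2)]] ij by blast
    then show "\<rho> \<one> $$ (i,j) = 1\<^sub>m k $$ (i,j)" using ij e r \<theta>(2) by (auto simp: \<rho>_def)
  qed (auto simp: \<rho>_def)
  have mult: "\<rho> (s \<otimes> s') = \<rho> s * \<rho> s'" if s: "s \<in> carrier G" "s' \<in> carrier G" for s s'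
  proof (rule eq_matI)
    fix i j assume "i < dim_row (\<rho> s * \<rho> s')" "j < dim_col (\<rho> s * \<rho> s')"
    then have ij: "i < k" "j < k" by (auto simp: \<rho>_def)
    have eqv: "u s' l j = inv (r l) \<otimes> (s' \<otimes> r j)" if "l < k" for l using that ij r s by (simp add: u_def m_assoc)
    have "s' \<otimes> r j \<in> carrier G" using s r ij by simp
    \<comment> \<open>Column \<open>j\<close> of the second factor has a single nonzero entry, in
      row \<open>l0\<close>, so the matrix product has at most one term.\<close>
    from ex1[OF this] obtain l0 where l0': "l0 < k \<and> inv (r l0) \<otimes> (s' \<otimes> r j) \<in> T"
      "\<forall>l. l < k \<and> inv (r l) \<otimes> (s' \<otimes> r j) \<in> T \<longrightarrow> l = l0" by (rule ex1E)
    have l0: "l0 < k" "u s' l0 j \<in> T" using l0'(1) eqv by auto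
    have uniq: "l = l0" if "l < k" "u s' l j \<in> T" for l
      using l0'(2) that unfolding eqv[OF that(1)] by simp
    have "(\<rho> s * \<rho> s') $$ (i,j) = (\<Sum>l<k. \<rho> s $$ (i,l) * \<rho> s' $$ (l,j))"
      using ij by (intro mult_mat_index) (auto simp: \<rho>_def)
    also have "\<dots> = (\<Sum>l\<in>{l0}. \<rho> s $$ (i,l) * \<rho> s' $$ (l,j))"
      using l0 ij by (intro sum.mono_neutral_right) (auto simp: \<rho>_def dest: uniq)
    also have "\<dots> = (if u s i l0 \<in> T then \<theta> (u s i l0) else 0) * \<theta> (u s' l0 j)"
      using l0 ij by (simp add: \<rho>_def)
    also have "\<dots> = \<rho> (s \<otimes> s') $$ (i,j)"
    proof (cases "u s i l0 \<in> T")
      case True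
      then show ?thesis using \<theta>(1)[OF True l0(2)] comp[OF s ij l0(1)] T.m_closed[OF True l0(2)] ij by (simp add: \<rho>_def)
    next
      case False
      have "u (s \<otimes> s') i j \<notin> T"
      proof
        assume "u (s \<otimes> s') i j \<in> T"
        then have "u s i l0 \<otimes> u s' l0 j \<otimes> inv (u s' l0 j) \<in> T" using comp[OF s ij l0(1)] l0(2) by simp
        then show False using False u[OF s(1) ij(1) l0(1)] u[OF s(2) l0(1) ij(2)] by (simp add: m_assoc)
      qed
      then show ?thesis using False ij by (simp add: \<rho>_def)
    qed
    finally show "\<rho> (s \<otimes> s') $$ (i,j) = (\<rho> s * \<rho> s') $$ (i,j)" by simp
  qed (auto simp: \<rho>_def)
  have star: "\<rho> (inv s) $$ (i,j) = cnj (\<rho> s $$ (j,i))" if s: "s \<in> carrier G" and ij: "i < k" "j < k" for s i j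
  proof -
    have e: "u (inv s) i j = inv (u s j i)" using s ij r by (simp add: u_def inv_mult_group m_assoc)
    have "inv (u s j i) \<in> T \<longleftrightarrow> u s j i \<in> T" using T.m_inv_closed u[OF s ij(2,1)] by (metis inv_inv)
    then show ?thesis using ij e \<theta>inv by (simp add: \<rho>_def)
  qed
  have trace: "tr (\<rho> s) = (if s \<in> T then \<Sum>i<k. \<theta> (inv (r i) \<otimes> s \<otimes> r i) else 0)" if s: "s \<in> carrier G" for s
  proof -
    have iff: "u s i i \<in> T \<longleftrightarrow> s \<in> T" if i: "i < k" for i
    proof
      assume "u s i i \<in> T"
      then have "r i \<otimes> u s i i \<otimes> inv (r i) \<in> T" using T.inv_op_closed2 r[OF i] by blast
      also have "r i \<otimes> u s i i \<otimes> inv (r i) = (r i \<otimes> inv (r i)) \<otimes> s \<otimes> (r i \<otimes> inv (r i))"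
        using r[OF i] s unfolding u_def by (simp only: m_assoc m_closed inv_closed)
      finally show "s \<in> T" using r[OF i] s by simp
    next
      assume "s \<in> T" then show "u s i i \<in> T" using T.inv_op_closed1 r[OF i] by (simp add: u_def)
    qed
    have "tr (\<rho> s) = (\<Sum>i<k. if s \<in> T then \<theta> (u s i i) else 0)"
      using iff by (simp add: tr_def \<rho>_def)
    then show ?thesis by (simp add: u_def)
  qed
  have "unitary_mat_rep G k \<rho>"
    unfolding unitary_mat_rep_def mat_rep_def
  proof (intro conjI ballI allI impI)
    show "\<rho> g \<in> carrier_mat k k" for g by (simp add: \<rho>_def)
  qed (rule one mult star; assumption)+
  then show ?thesis using trace by blast
qed

definition T_chars :: "('a \<Rightarrow> complex) set" where
  "T_chars = {\<theta>. (\<forall>x\<in>T. \<forall>y\<in>T. \<theta> (x \<otimes> y) = \<theta> x * \<theta> y) \<and> \<theta> \<one> = 1 \<and> (\<forall>x\<in>T. norm (\<theta> x) = 1)}"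

text \<open>Each summand is induced separately and need not be invariant under conjugation; only the
  sum \<open>h\<close> is, and this collapses the sum over the transversal to \<open>k\<close>
  copies of \<open>h\<close>.\<close>

lemma induced_rep_of_sum:
  assumes "set \<theta>s \<subseteq> T_chars" and h: "\<And>t. t \<in> T \<Longrightarrow> h t = (\<Sum>\<theta>\<leftarrow>\<theta>s. \<theta> t)"
    and inv: "\<And>s t. s \<in> carrier G \<Longrightarrow> t \<in> T \<Longrightarrow> h (s \<otimes> t \<otimes> inv s) = h t"
  shows "\<exists>k n \<rho>. k > (0::nat) \<and> unitary_mat_rep G n \<rho> \<and>
    (\<forall>s\<in>carrier G. tr (\<rho> s) = (if s \<in> T then of_nat k * h s else 0))"
proof -
  from transversal obtain k r where k: "(0::nat) < k" and r': "\<forall>i<k. r i \<in> carrier G"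
    and ex1': "\<forall>g\<in>carrier G. \<exists>!i. i < k \<and> inv (r i) \<otimes> g \<in> T" by (elim exE conjE)
  note r = r'[rule_format] and ex1 = bspec[OF ex1']
  have "\<exists>n \<rho>. unitary_mat_rep G n \<rho> \<and>
      (\<forall>s\<in>carrier G. tr (\<rho> s) = (if s \<in> T then \<Sum>i<k. \<Sum>\<theta>\<leftarrow>\<theta>s. \<theta> (inv (r i) \<otimes> s \<otimes> r i) else 0))"
    using assms(1)
  proof (induction \<theta>s)
    case Nil
    have "unitary_mat_rep G 0 (\<lambda>_. 1\<^sub>m 0)" by (auto simp: unitary_mat_rep_def mat_rep_def)
    then show ?case by (intro exI[of _ 0] exI[of _ "\<lambda>_. 1\<^sub>m 0"]) (simp add: tr_def)
  next
    case (Cons \<theta> \<theta>s)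
    then obtain n \<rho> where \<rho>: "unitary_mat_rep G n \<rho>"
      "\<forall>s\<in>carrier G. tr (\<rho> s) = (if s \<in> T then \<Sum>i<k. \<Sum>\<theta>\<leftarrow>\<theta>s. \<theta> (inv (r i) \<otimes> s \<otimes> r i) else 0)" by auto
    from Cons.prems have \<theta>: "\<theta> \<in> T_chars" by simp
    have "\<exists>\<sigma>. unitary_mat_rep G k \<sigma> \<and>
        (\<forall>s\<in>carrier G. tr (\<sigma> s) = (if s \<in> T then \<Sum>i<k. \<theta> (inv (r i) \<otimes> s \<otimes> r i) else 0))"
      by (rule induced_rep[OF r ex1]) (use \<theta> in \<open>auto simp: T_chars_def\<close>)
    then obtain \<sigma> where \<sigma>: "unitary_mat_rep G k \<sigma>"
      "\<forall>s\<in>carrier G. tr (\<sigma> s) = (if s \<in> T then \<Sum>i<k. \<theta> (inv (r i) \<otimes> s \<otimes> r i) else 0)" by blast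
    obtain \<tau> where "unitary_mat_rep G (k + n) \<tau>" "\<forall>g\<in>carrier G. tr (\<tau> g) = tr (\<sigma> g) + tr (\<rho> g)"
      using unitary_mat_rep_sum[OF is_group \<sigma>(1) \<rho>(1)] by blast
    then show ?case using \<sigma>(2) \<rho>(2)
      by (intro exI[of _ "k + n"] exI[of _ \<tau>]) (simp add: sum.distrib)
  qed
  then obtain n \<rho> where \<rho>: "unitary_mat_rep G n \<rho>"
    "\<And>s. s \<in> carrier G \<Longrightarrow> tr (\<rho> s) = (if s \<in> T then \<Sum>i<k. \<Sum>\<theta>\<leftarrow>\<theta>s. \<theta> (inv (r i) \<otimes> s \<otimes> r i) else 0)" by blast
  have "(\<Sum>\<theta>\<leftarrow>\<theta>s. \<theta> (inv (r i) \<otimes> s \<otimes> r i)) = h s" if "i < k" "s \<in> T" for i s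
    using h[OF T.inv_op_closed1[OF r[OF that(1)] that(2)]] inv[of "inv (r i)" s] r that by simp
  then have "(\<Sum>i<k. \<Sum>\<theta>\<leftarrow>\<theta>s. \<theta> (inv (r i) \<otimes> s \<otimes> r i)) = of_nat k * h s" if "s \<in> T" for s
    using that by simp
  then have "\<forall>s\<in>carrier G. tr (\<rho> s) = (if s \<in> T then of_nat k * h s else 0)" using \<rho>(2) by simp
  then show ?thesis using k \<rho>(1) by blast
qed

end

section \<open>The structure of discrete $p$-toral groups\<close>

lemma group_prufer: "p > 0 \<Longrightarrow> group (prufer_group p)"
proof (rule groupI)
  assume p: "p > 0"
  fix x y assume "x \<in> carrier (prufer_group p)" "y \<in> carrier (prufer_group p)"
  then obtain a b where ab: "x ^ (p ^ a) = 1" "y ^ (p ^ b) = 1" by (auto simp: prufer_group_def)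
  have "(x * y) ^ (p ^ (a + b)) = (x ^ (p ^ a)) ^ (p ^ b) * (y ^ (p ^ b)) ^ (p ^ a)"
    by (simp add: power_mult_distrib power_add power_mult[symmetric] mult.commute)
  then show "x \<otimes>\<^bsub>prufer_group p\<^esub> y \<in> carrier (prufer_group p)" using ab by (auto simp: prufer_group_def)
next
  fix x assume p: "p > 0" and "x \<in> carrier (prufer_group p)"
  then obtain a where a: "x ^ (p ^ a) = 1" by (auto simp: prufer_group_def)
  then have "x \<noteq> 0" using p by (cases "x = 0") (auto simp: power_0_left)
  then show "\<exists>y\<in>carrier (prufer_group p). y \<otimes>\<^bsub>prufer_group p\<^esub> x = \<one>\<^bsub>prufer_group p\<^esub>"
    using a by (intro bexI[of _ "inverse x"]) (auto simp: prufer_group_def power_inverse)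
qed (auto simp: prufer_group_def)

lemma group_toral: "p > 0 \<Longrightarrow> group (toral_group p k)"
  by (simp add: toral_group_def group_prufer)

lemma toral_mult: "x \<otimes>\<^bsub>toral_group p k\<^esub> y = (\<lambda>i\<in>{..<k}. x i * y i)"
  by (simp add: toral_group_def prufer_group_def)

lemma toral_one: "\<one>\<^bsub>toral_group p k\<^esub> = (\<lambda>i\<in>{..<k}. 1)"
  by (simp add: toral_group_def prufer_group_def)

lemma toral_pow: "x [^]\<^bsub>toral_group p k\<^esub> (n::nat) = (\<lambda>i\<in>{..<k}. x i ^ n)"
proof (induction n)
  case 0
  show ?case by (simp add: nat_pow_def toral_one)
next
  case (Suc n)
  have "x [^]\<^bsub>toral_group p k\<^esub> Suc n = x [^]\<^bsub>toral_group p k\<^esub> n \<otimes>\<^bsub>toral_group p k\<^esub> x"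
    by (simp add: nat_pow_def)
  also have "\<dots> = (\<lambda>i\<in>{..<k}. x i ^ Suc n)"
    unfolding Suc toral_mult by (rule ext) (simp add: mult.commute)
  finally show ?case .
qed

lemma toral_carrier:
  "x \<in> carrier (toral_group p k) \<longleftrightarrow> x \<in> extensional {..<k} \<and> (\<forall>i<k. \<exists>n. x i ^ (p ^ n) = 1)"
  by (auto simp: toral_group_def prufer_group_def PiE_iff)

lemma toral_divisible:
  assumes "p > 0" "x \<in> carrier (toral_group p k)"
  shows "\<exists>y\<in>carrier (toral_group p k). y [^]\<^bsub>toral_group p k\<^esub> (p ^ n) = x"
proof -
  have "\<exists>z. z ^ (p ^ n) = x i" for i
  proof (cases "x i = 0")
    case False
    then have "card {z. z ^ (p ^ n) = x i} > 0" using card_nth_roots[of "x i" "p ^ n"] assms(1) by simp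
    then show ?thesis by (metis (mono_tags, lifting) card_gt_0_iff empty_Collect_eq)
  qed (use assms(1) in \<open>auto intro!: exI[of _ 0]\<close>)
  then obtain y0 where y0: "\<And>i. y0 i ^ (p ^ n) = x i" by metis
  define y where "y = (\<lambda>i\<in>{..<k}. y0 i)"
  have "\<exists>a. y i ^ (p ^ a) = 1" if i: "i < k" for i
  proof -
    obtain a where "x i ^ (p ^ a) = 1" using assms(2) i by (auto simp: toral_carrier)
    then have "y i ^ (p ^ (n + a)) = 1" using y0[of i] i by (simp add: y_def power_add power_mult)
    then show ?thesis by blast
  qed
  then have y: "y \<in> carrier (toral_group p k)" by (auto simp: toral_carrier y_def)
  have "y [^]\<^bsub>toral_group p k\<^esub> (p ^ n) = x"
    unfolding toral_pow using y0 assms(2) by (auto simp: y_def toral_carrier fun_eq_iff extensional_def)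
  then show ?thesis using y by blast
qed

lemma toral_torsion:
  assumes "x \<in> carrier (toral_group p k)"
  shows "\<exists>n. x [^]\<^bsub>toral_group p k\<^esub> (p ^ n) = \<one>\<^bsub>toral_group p k\<^esub>"
proof -
  have "\<forall>i. \<exists>n. i < k \<longrightarrow> x i ^ (p ^ n) = 1" using assms by (simp add: toral_carrier)
  then obtain a where a: "\<And>i. i < k \<Longrightarrow> x i ^ (p ^ a i) = 1" by metis
  define n where "n = (\<Sum>i<k. a i)"
  have "x i ^ (p ^ n) = 1" if i: "i < k" for i
  proof -
    have "a i \<le> n" unfolding n_def using i by (intro member_le_sum) auto
    then have "p ^ n = p ^ a i * p ^ (n - a i)" by (simp add: power_add[symmetric])
    then show ?thesis using a[OF i] by (simp add: power_mult)
  qed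
  then show ?thesis unfolding toral_pow
    by (intro exI[of _ n]) (auto simp: toral_one)
qed

lemma toral_finite_torsion:
  assumes "p > 0"
  shows "finite {x \<in> carrier (toral_group p k). x [^]\<^bsub>toral_group p k\<^esub> (p ^ n) = \<one>\<^bsub>toral_group p k\<^esub>}"
proof (rule finite_subset)
  show "{x \<in> carrier (toral_group p k). x [^]\<^bsub>toral_group p k\<^esub> (p ^ n) = \<one>\<^bsub>toral_group p k\<^esub>}
      \<subseteq> PiE {..<k} (\<lambda>_. {z. z ^ (p ^ n) = 1})"
  proof
    fix x assume x: "x \<in> {x \<in> carrier (toral_group p k). x [^]\<^bsub>toral_group p k\<^esub> (p ^ n) = \<one>\<^bsub>toral_group p k\<^esub>}"
    then have e: "(\<lambda>i\<in>{..<k}. x i ^ (p ^ n)) = (\<lambda>i\<in>{..<k}. 1)" by (simp add: toral_pow toral_one)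
    have "x i ^ (p ^ n) = 1" if "i < k" for i
      using fun_cong[OF e, of i] that by simp
    then show "x \<in> PiE {..<k} (\<lambda>_. {z. z ^ (p ^ n) = 1})" using x by (auto simp: toral_carrier PiE_iff)
  qed
  show "finite (PiE {..<k} (\<lambda>_. {z::complex. z ^ (p ^ n) = 1}))"
    using assms by (intro finite_PiE) (auto simp: finite_nth_roots)
qed

text \<open>The isomorphism of \<open>T\<close> with a power of the Pruefer group is replaced by its
  consequences: divisibility, torsion, and finitely many elements of each exponent. \<open>N\<close>
  is a power of \<open>p\<close> that carries \<open>G\<close> into \<open>T\<close>; the order of
  the quotient will be taken.\<close>

locale p_toral_extension = finite_index_normal G T for G (structure) and T +
  fixes p N :: nat
  assumes p: "Factorial_Ring.prime p"
    and T_comm: "x \<in> T \<Longrightarrow> y \<in> T \<Longrightarrow> x \<otimes> y = y \<otimes> x"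
    and T_divisible: "x \<in> T \<Longrightarrow> \<exists>y\<in>T. y [^] (p ^ n) = x"
    and T_torsion: "x \<in> T \<Longrightarrow> \<exists>n. x [^] (p ^ n) = \<one>"
    and T_finite_torsion: "finite {x \<in> T. x [^] (p ^ n) = \<one>}"
    and N: "\<exists>m. N = p ^ m"
    and pow_N: "g \<in> carrier G \<Longrightarrow> g [^] N \<in> T"

lemma discrete_p_toral_imp_extension:
  fixes G (structure)
  assumes p: "Factorial_Ring.prime p" and G: "discrete_p_toral p G"
  shows "\<exists>T N. p_toral_extension G T p N"
proof -
  have p0: "p > 0" using p prime_gt_0_nat by blast
  interpret group G using G by (simp add: discrete_p_toral_def)
  obtain T k where T: "T \<lhd> G" "G\<lparr>carrier := T\<rparr> \<cong> toral_group p k" "finite_p_group p (G Mod T)"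
    using G by (auto simp: discrete_p_toral_def)
  interpret T: normal T G by fact
  interpret GT: group "G\<lparr>carrier := T\<rparr>" using T.subgroup_is_group is_group by blast
  let ?U = "toral_group p k"
  interpret U: group ?U using group_toral[OF p0] .
  obtain f where f: "f \<in> Group.iso (G\<lparr>carrier := T\<rparr>) ?U" using T(2) by (auto simp: is_iso_def)
  then interpret f: group_hom "G\<lparr>carrier := T\<rparr>" ?U f
    by unfold_locales (simp add: Group.iso_def)
  have bij: "bij_betw f T (carrier ?U)" using f by (simp add: Group.iso_def)
  have inj: "x = y" if "x \<in> T" "y \<in> T" "f x = f y" for x y
    using bij that by (auto simp: bij_betw_def inj_on_def)
  have fU: "f x \<in> carrier ?U" if "x \<in> T" for x using f.hom_closed that by simp
  have fm: "f (x \<otimes> y) = f x \<otimes>\<^bsub>?U\<^esub> f y" if "x \<in> T" "y \<in> T" for x y using f.hom_mult that by simp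
  have f1: "f \<one> = \<one>\<^bsub>?U\<^esub>" using f.hom_one by simp
  have fp: "f (x [^] (n::nat)) = f x [^]\<^bsub>?U\<^esub> n" if "x \<in> T" for x n
    using f.hom_nat_pow[of x n] that nat_pow_consistent[of x n T] by simp
  have pT: "x [^] (n::nat) \<in> T" if "x \<in> T" for x n
    using that by (induction n) auto
  have fin: "finite (carrier (G Mod T))" "group (G Mod T)" using T(3) by (auto simp: finite_p_group_def)
  obtain m where m: "Coset.order (G Mod T) = p ^ m" using T(3) by (auto simp: finite_p_group_def)
  have "p_toral_extension G T p (p ^ m)"
  proof unfold_locales
    show "finite (rcosets T)" using fin by (simp add: FactGroup_def)
    show "Factorial_Ring.prime p" by fact
    show "\<exists>m'. p ^ m = p ^ m'" by blast
    show "x \<otimes> y = y \<otimes> x" if "x \<in> T" "y \<in> T" for x y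
    proof -
      have "f x \<otimes>\<^bsub>?U\<^esub> f y = f y \<otimes>\<^bsub>?U\<^esub> f x"
        unfolding toral_mult by (simp add: mult.commute)
      then show ?thesis using that by (intro inj) (simp_all add: fm)
    qed
    show "\<exists>y\<in>T. y [^] (p ^ n) = x" if x: "x \<in> T" for x n
    proof -
      obtain y where y: "y \<in> carrier ?U" "y [^]\<^bsub>?U\<^esub> (p ^ n) = f x" using toral_divisible[OF p0 fU[OF x]] by blast
      from y(1) have "y \<in> f ` T" unfolding bij_betw_imp_surj_on[OF bij] .
      then obtain y' where y': "y' \<in> T" "f y' = y" by (elim imageE) simp
      have "f (y' [^] (p ^ n)) = f x" unfolding fp[OF y'(1)] y'(2) y(2) ..
      then have "y' [^] (p ^ n) = x" by (rule inj[OF pT[OF y'(1)] x])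
      then show ?thesis using y' by blast
    qed
    show "\<exists>n. x [^] (p ^ n) = \<one>" if x: "x \<in> T" for x
    proof -
      obtain n where "f x [^]\<^bsub>?U\<^esub> (p ^ n) = \<one>\<^bsub>?U\<^esub>" using toral_torsion[OF fU[OF x]] by blast
      then have "f (x [^] (p ^ n)) = f \<one>" unfolding fp[OF x] f1 .
      then have "x [^] (p ^ n) = \<one>" by (rule inj[OF pT[OF x] T.one_closed])
      then show ?thesis by blast
    qed
    show "finite {x \<in> T. x [^] (p ^ n) = \<one>}" for n
    proof (rule inj_on_finite)
      show "inj_on f {x \<in> T. x [^] (p ^ n) = \<one>}" using inj by (auto simp: inj_on_def)
      show "f ` {x \<in> T. x [^] (p ^ n) = \<one>} \<subseteq> {x \<in> carrier ?U. x [^]\<^bsub>?U\<^esub> (p ^ n) = \<one>\<^bsub>?U\<^esub>}"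
      proof
        fix z assume "z \<in> f ` {x \<in> T. x [^] (p ^ n) = \<one>}"
        then obtain x where x: "x \<in> T" "x [^] (p ^ n) = \<one>" "z = f x" by blast
        then show "z \<in> {x \<in> carrier ?U. x [^]\<^bsub>?U\<^esub> (p ^ n) = \<one>\<^bsub>?U\<^esub>}"
          using fU[OF x(1)] fp[OF x(1), of "p ^ n"] f1 by simp
      qed
    qed (rule toral_finite_torsion[OF p0])
    show "g [^] (p ^ m) \<in> T" if g: "g \<in> carrier G" for g
    proof -
      have "(T #> g) \<in> carrier (G Mod T)" using g by (auto simp: FactGroup_def RCOSETS_def)
      from group.pow_order_eq_1[OF fin(2) this] have "T #> (g [^] (p ^ m)) = T"
        unfolding m T.FactGroup_pow[OF g] by (simp add: FactGroup_def)
      then show ?thesis using g by (metis coset_join1 nat_pow_closed T.subgroup_axioms T.subset)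
    qed
  qed
  then show ?thesis by blast
qed

context p_toral_extension
begin

lemma inv_mult_cancel: "x \<in> carrier G \<Longrightarrow> y \<in> carrier G \<Longrightarrow> inv x \<otimes> (x \<otimes> y) = y"
  by (simp add: m_assoc[symmetric])

lemma commute_if_conj_fixed:
  assumes "x \<in> carrier G" "d \<in> carrier G" "x \<otimes> d \<otimes> inv x = d"
  shows "x \<otimes> d = d \<otimes> x"
proof -
  have "x \<otimes> d = (x \<otimes> d \<otimes> inv x) \<otimes> x" using assms(1,2) by (simp add: m_assoc)
  then show ?thesis using assms(3) by simp
qed

lemma p_pos: "p > 0" using p prime_gt_0_nat by blast

lemma N_pos: "N > 0" using N p_pos by auto

lemma T_carrier: "t \<in> T \<Longrightarrow> t \<in> carrier G" by (rule T.mem_carrier)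

lemma T_pow: "t \<in> T \<Longrightarrow> t [^] (n::nat) \<in> T" by (induction n) auto

lemma T_conj: "g \<in> carrier G \<Longrightarrow> t \<in> T \<Longrightarrow> g \<otimes> t \<otimes> inv g \<in> T" by (rule T.inv_op_closed2)

lemma T_pow_mult: "s \<in> T \<Longrightarrow> t \<in> T \<Longrightarrow> (s \<otimes> t) [^] (n::nat) = s [^] n \<otimes> t [^] n"
  by (rule pow_mult_distrib) (auto simp: T_comm T_carrier)

lemma conj_pow:
  assumes "g \<in> carrier G" "t \<in> carrier G"
  shows "(g \<otimes> t \<otimes> inv g) [^] (n::nat) = g \<otimes> t [^] n \<otimes> inv g"
proof (induction n)
  case 0 then show ?case using assms by simp
next
  case (Suc n)
  have "g \<otimes> t [^] n \<otimes> inv g \<otimes> (g \<otimes> t \<otimes> inv g) = g \<otimes> t [^] n \<otimes> (inv g \<otimes> (g \<otimes> (t \<otimes> inv g)))"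
    using assms by (simp add: m_assoc)
  also have "inv g \<otimes> (g \<otimes> (t \<otimes> inv g)) = t \<otimes> inv g" using assms by (simp add: m_assoc[symmetric])
  finally show ?case using assms Suc by (simp add: m_assoc)
qed

lemma torsion: "g \<in> carrier G \<Longrightarrow> \<exists>n::nat. n > 0 \<and> g [^] n = \<one>"
proof -
  assume g: "g \<in> carrier G"
  obtain n where "(g [^] N) [^] (p ^ n) = \<one>" using T_torsion[OF pow_N[OF g]] by blast
  then have "g [^] (N * p ^ n) = \<one>" using g by (simp add: nat_pow_pow)
  then show ?thesis using N_pos p_pos by (intro exI[of _ "N * p ^ n"]) simp
qed

section \<open>Local finiteness\<close>

lemma common_exponent:
  assumes "finite F" "F \<subseteq> T"
  shows "\<exists>n. \<forall>x\<in>F. x [^] (p ^ n) = \<one>"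
  using assms
proof (induction F rule: finite_induct)
  case (insert x F)
  then obtain n where n: "\<forall>x\<in>F. x [^] (p ^ n) = \<one>" by auto
  obtain m where m: "x [^] (p ^ m) = \<one>" using T_torsion insert by blast
  have "y [^] (p ^ (n + m)) = \<one>" if y: "y \<in> insert x F" for y
  proof -
    have yc: "y \<in> carrier G" using y insert.prems T_carrier by blast
    have "y [^] (p ^ (n + m)) = (y [^] (p ^ n)) [^] (p ^ m)" "y [^] (p ^ (n + m)) = (y [^] (p ^ m)) [^] (p ^ n)"
      using yc by (simp_all add: nat_pow_pow power_add mult.commute)
    then show ?thesis using y n m by auto
  qed
  then show ?case by blast
qed auto

lemma finite_closed_imp_subgroup:
  assumes "finite H" "H \<noteq> {}" "H \<subseteq> carrier G" and mult: "\<And>x y. x \<in> H \<Longrightarrow> y \<in> H \<Longrightarrow> x \<otimes> y \<in> H"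
  shows "subgroup H G"
proof -
  have pow: "g [^] Suc n \<in> H" if "g \<in> H" for g n
  proof (induction n)
    case 0 then show ?case using that assms(3) by (simp add: subset_iff)
  next
    case (Suc n) then show ?case using mult[OF Suc that] by simp
  qed
  have inv: "inv g \<in> H" if g: "g \<in> H" for g
  proof -
    have gc: "g \<in> carrier G" using g assms(3) by blast
    obtain n where n: "n > 0" "g [^] (n::nat) = \<one>" using torsion[OF gc] by blast
    then obtain k where k: "n = Suc k" using gr0_implies_Suc by blast
    have "g [^] Suc (k + k) \<otimes> g = g [^] (n + n)" using k by simp
    also have "\<dots> = \<one>" using n gc by (simp add: nat_pow_mult[symmetric])
    finally have "inv g = g [^] Suc (k + k)" using gc by (intro inv_equality) auto
    then show ?thesis using pow[OF g] by simp
  qed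
  show ?thesis by (rule subgroupI) (use assms inv in auto)
qed

text \<open>Split every \<open>g\<close> as a representative times an element \<open>t g\<close> of
  \<open>T\<close>. The parts in \<open>T\<close> of the given elements and of all products of two
  representatives are finitely many, so they lie in one finite torsion subgroup \<open>K\<close>,
  and the translates \<open>r i K\<close> together form a finite subgroup.\<close>

lemma locally_finite:
  assumes U: "finite U" "U \<subseteq> carrier G"
  shows "\<exists>H. subgroup H G \<and> finite H \<and> U \<subseteq> H"
proof -
  from transversal obtain k r where k: "(0::nat) < k" and r': "\<forall>i<k. r i \<in> carrier G"
    and ex1': "\<forall>g\<in>carrier G. \<exists>!i. i < k \<and> inv (r i) \<otimes> g \<in> T" by (elim exE conjE)
  note r = r'[rule_format] and ex1 = bspec[OF ex1']
  define c where "c g = (SOME i. i < k \<and> inv (r i) \<otimes> g \<in> T)" for g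
  have c: "c g < k \<and> inv (r (c g)) \<otimes> g \<in> T" if "g \<in> carrier G" for g
    unfolding c_def by (rule someI_ex[OF ex1_implies_ex[OF ex1[OF that]]])
  define t where "t g = inv (r (c g)) \<otimes> g" for g
  have t: "t g \<in> T" "g = r (c g) \<otimes> t g" if "g \<in> carrier G" for g
    using c[OF that] r[of "c g"] that by (simp_all add: t_def m_assoc[symmetric])
  define F where "F = t ` U \<union> (\<lambda>(i,j). t (r i \<otimes> r j)) ` ({..<k} \<times> {..<k})"
  have "finite F" "F \<subseteq> T" using U r t(1) by (auto simp: F_def)
  then obtain n where n: "\<forall>x\<in>F. x [^] (p ^ n) = \<one>" using common_exponent by blast
  \<comment> \<open>Taking all elements of exponent \<open>p ^ n\<close>, rather than the group
    generated by \<open>F\<close>, makes \<open>K\<close> stable under conjugation by the whole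
    group while it remains finite.\<close>
  define K where "K = {x \<in> T. x [^] (p ^ n) = \<one>}"
  have K: "finite K" "F \<subseteq> K" "K \<subseteq> T" using T_finite_torsion n \<open>F \<subseteq> T\<close> by (auto simp: K_def)
  have K1: "\<one> \<in> K" by (simp add: K_def)
  have Km: "x \<otimes> y \<in> K" if "x \<in> K" "y \<in> K" for x y using that T_pow_mult by (simp add: K_def)
  have Kc: "inv g \<otimes> x \<otimes> g \<in> K" if "g \<in> carrier G" "x \<in> K" for g x
    using that conj_pow[of "inv g" x] T_conj[of "inv g" x] T_carrier by (simp add: K_def)
  define H where "H = (\<lambda>(i,x). r i \<otimes> x) ` ({..<k} \<times> K)"
  have Hc: "H \<subseteq> carrier G" using r K(3) T_carrier by (auto simp: H_def)
  have "subgroup H G"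
  proof (rule finite_closed_imp_subgroup)
    show "finite H" using K by (simp add: H_def)
    show "H \<noteq> {}" using k K1 by (auto simp: H_def)
    fix g h assume "g \<in> H" "h \<in> H"
    then obtain i x j y where ij: "i < k" "j < k" "x \<in> K" "y \<in> K" "g = r i \<otimes> x" "h = r j \<otimes> y"
      by (auto simp: H_def)
    note cs = r[OF ij(1)] r[OF ij(2)] T_carrier[of x] T_carrier[of y] K(3) ij(3,4)
    have rr: "r i \<otimes> r j \<in> carrier G" using cs by simp
    have tF: "t (r i \<otimes> r j) \<in> K" using K(2) ij by (auto simp: F_def)
    have xy: "x \<in> carrier G" "y \<in> carrier G" using cs by blast+
    define z where "z = inv (r j) \<otimes> x \<otimes> r j"
    have z: "z \<in> K" "z \<in> carrier G" unfolding z_def using Kc[OF cs(2) ij(3)] cs xy by auto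
    have rz: "r j \<otimes> z = x \<otimes> r j" unfolding z_def using cs xy by (simp add: m_assoc[symmetric])
    have "g \<otimes> h = r i \<otimes> (x \<otimes> r j) \<otimes> y" unfolding ij(5,6) using cs(1,2) xy by (simp add: m_assoc)
    also have "\<dots> = (r i \<otimes> r j) \<otimes> (z \<otimes> y)" unfolding rz[symmetric] using cs(1,2) xy z by (simp add: m_assoc)
    also have "\<dots> = r (c (r i \<otimes> r j)) \<otimes> t (r i \<otimes> r j) \<otimes> (z \<otimes> y)" using t(2)[OF rr] by simp
    also have "\<dots> = r (c (r i \<otimes> r j)) \<otimes> (t (r i \<otimes> r j) \<otimes> (z \<otimes> y))"
      using r c[OF rr] t(1)[OF rr] T_carrier z(2) xy by (intro m_assoc) auto
    finally have gh: "g \<otimes> h = r (c (r i \<otimes> r j)) \<otimes> (t (r i \<otimes> r j) \<otimes> (z \<otimes> y))" .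
    have "(c (r i \<otimes> r j), t (r i \<otimes> r j) \<otimes> (z \<otimes> y)) \<in> {..<k} \<times> K"
      using Km[OF tF Km[OF z(1) ij(4)]] c[OF rr] by simp
    then show "g \<otimes> h \<in> H" unfolding H_def gh by (rule rev_image_eqI) simp
  qed (rule Hc)
  moreover have "U \<subseteq> H"
  proof
    fix g assume g: "g \<in> U"
    then have "g \<in> carrier G" using U by blast
    then have gt: "g = r (c g) \<otimes> t g" "c g < k" using t c by blast+
    moreover have "t g \<in> K" using g K by (auto simp: F_def)
    ultimately have "(c g, t g) \<in> {..<k} \<times> K" by simp
    then show "g \<in> H" unfolding H_def by (rule rev_image_eqI) (simp add: gt(1)[symmetric])
  qed
  moreover have "finite H" using K by (simp add: H_def)
  ultimately show ?thesis by blast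
qed

text \<open>An injective endomorphism permutes each finite group of elements of exponent
  \<open>p ^ n\<close>, and these groups exhaust \<open>T\<close>.\<close>

lemma injective_endo_surj:
  assumes hom: "\<And>x y. x \<in> T \<Longrightarrow> y \<in> T \<Longrightarrow> \<phi> (x \<otimes> y) = \<phi> x \<otimes> \<phi> y" and \<phi>: "\<phi> ` T \<subseteq> T" "inj_on \<phi> T"
  shows "\<phi> ` T = T"
proof
  show "T \<subseteq> \<phi> ` T"
  proof
    fix t assume t: "t \<in> T"
    then obtain n where n: "t [^] (p ^ n) = \<one>" using T_torsion by blast
    have c: "\<phi> x \<in> T" if "x \<in> T" for x using \<phi>(1) that by blast
    have "\<phi> \<one> \<otimes> \<phi> \<one> = \<phi> \<one>" using hom[of \<one> \<one>] by simp
    then have one: "\<phi> \<one> = \<one>" using c[OF T.one_closed] T_carrier by simp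
    have pow: "\<phi> (x [^] (m::nat)) = \<phi> x [^] m" if x: "x \<in> T" for x m
    proof (induction m)
      case 0 then show ?case by (simp add: one)
    next
      case (Suc m) then show ?case using hom[OF T_pow[OF x] x] by simp
    qed
    let ?K = "{x \<in> T. x [^] (p ^ n) = \<one>}"
    have "\<phi> ` ?K \<subseteq> ?K"
    proof
      fix z assume "z \<in> \<phi> ` ?K"
      then obtain x where x: "x \<in> T" "x [^] (p ^ n) = \<one>" "z = \<phi> x" by blast
      then show "z \<in> ?K" using pow[OF x(1), of "p ^ n"] one c by simp
    qed
    then have "\<phi> ` ?K = ?K" using T_finite_torsion \<phi>(2) by (intro endo_inj_surj) (auto intro: inj_on_subset)
    moreover have "t \<in> ?K" using t n by simp
    ultimately show "t \<in> \<phi> ` T" by blast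
  qed
qed (rule \<phi>(1))

section \<open>Norm maps on the torus\<close>

fun norm_upto :: "'a \<Rightarrow> 'a \<Rightarrow> nat \<Rightarrow> 'a" where
  "norm_upto x t 0 = \<one>"
| "norm_upto x t (Suc n) = norm_upto x t n \<otimes> (x [^] n \<otimes> t \<otimes> inv (x [^] n))"

definition norm_image :: "'a \<Rightarrow> 'a set" where
  "norm_image x = (\<lambda>t. norm_upto x t N) ` T"

lemma norm_upto_T: "x \<in> carrier G \<Longrightarrow> t \<in> T \<Longrightarrow> norm_upto x t n \<in> T"
  by (induction n) (auto simp: T_conj)

lemma norm_upto_mult:
  assumes "x \<in> carrier G" "s \<in> T" "t \<in> T"
  shows "norm_upto x (s \<otimes> t) n = norm_upto x s n \<otimes> norm_upto x t n"
proof (induction n)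
  case (Suc n)
  let ?c = "\<lambda>t. x [^] n \<otimes> t \<otimes> inv (x [^] n)"
  have y: "x [^] n \<in> carrier G" using assms by simp
  have "?c (s \<otimes> t) = ?c s \<otimes> ?c t"
  proof -
    have "?c s \<otimes> ?c t = x [^] n \<otimes> s \<otimes> (inv (x [^] n) \<otimes> (x [^] n \<otimes> (t \<otimes> inv (x [^] n))))"
      using y assms T_carrier by (simp add: m_assoc)
    also have "inv (x [^] n) \<otimes> (x [^] n \<otimes> (t \<otimes> inv (x [^] n))) = t \<otimes> inv (x [^] n)"
      using y assms T_carrier by (simp add: m_assoc[symmetric])
    finally show ?thesis using y assms T_carrier by (simp add: m_assoc)
  qed
  moreover have "a \<otimes> b \<otimes> (d \<otimes> e) = a \<otimes> d \<otimes> (b \<otimes> e)" if "a \<in> T" "b \<in> T" "d \<in> T" "e \<in> T" for a b d e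
  proof -
    have "a \<otimes> b \<otimes> (d \<otimes> e) = a \<otimes> (b \<otimes> d) \<otimes> e" using that T_carrier by (simp add: m_assoc)
    also have "\<dots> = a \<otimes> d \<otimes> (b \<otimes> e)" unfolding T_comm[OF that(2,3)] using that T_carrier by (simp add: m_assoc)
    finally show ?thesis .
  qed
  ultimately show ?case using Suc assms norm_upto_T[OF assms(1)] T_conj[OF y] by simp
qed simp

lemma norm_image_subgroup: "x \<in> carrier G \<Longrightarrow> subgroup (norm_image x) G"
proof (rule subgroupI)
  assume x: "x \<in> carrier G"
  show sub: "norm_image x \<subseteq> carrier G" using norm_upto_T[OF x] T_carrier by (auto simp: norm_image_def)
  show "norm_image x \<noteq> {}" unfolding norm_image_def using T.one_closed by blast
  fix a assume "a \<in> norm_image x"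
  then obtain s where s: "s \<in> T" "a = norm_upto x s N" by (auto simp: norm_image_def)
  have one: "norm_upto x \<one> N \<otimes> norm_upto x \<one> N = norm_upto x \<one> N" using norm_upto_mult[OF x T.one_closed T.one_closed, of N] by simp
  have "norm_upto x \<one> N = \<one>" using one norm_upto_T[OF x T.one_closed] T_carrier by simp
  then have "norm_upto x (inv s) N \<otimes> a = \<one>" using norm_upto_mult[OF x _ s(1), of "inv s" N] s T_carrier by simp
  then have "inv a = norm_upto x (inv s) N" using s norm_upto_T[OF x] T_carrier by (intro inv_equality) auto
  then show "inv a \<in> norm_image x" using s by (auto simp: norm_image_def)
  fix b assume "b \<in> norm_image x"
  then obtain t where t: "t \<in> T" "b = norm_upto x t N" by (auto simp: norm_image_def)
  have "a \<otimes> b = norm_upto x (s \<otimes> t) N" using norm_upto_mult[OF x s(1) t(1), of N] s t by simp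
  then show "a \<otimes> b \<in> norm_image x" unfolding norm_image_def using T.m_closed[OF s(1) t(1)] by (rule image_eqI)
qed

lemma norm_image_T: "x \<in> carrier G \<Longrightarrow> norm_image x \<subseteq> T"
  using norm_upto_T by (auto simp: norm_image_def)

lemma norm_image_divisible:
  assumes x: "x \<in> carrier G" and d: "d \<in> norm_image x"
  shows "\<exists>e\<in>norm_image x. e [^] (p ^ n) = d"
proof -
  obtain t where t: "t \<in> T" "d = norm_upto x t N" using d by (auto simp: norm_image_def)
  obtain s where s: "s \<in> T" "s [^] (p ^ n) = t" using T_divisible[OF t(1)] by blast
  have "norm_upto x (s [^] (m::nat)) N = norm_upto x s N [^] m" if "m > 0" for m
    using that
  proof (induction m rule: nat_induct_non_zero)
    case 1 then show ?case using s norm_upto_T[OF x] T_carrier by simp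
  next
    case (Suc m) then show ?case using norm_upto_mult[OF x T_pow[OF s(1)] s(1)] by simp
  qed
  from this[of "p ^ n"] show ?thesis using s t p_pos by (auto simp: norm_image_def)
qed

text \<open>Conjugation by \<open>x\<close> turns factor \<open>i\<close> of the partial norm into
  factor \<open>i + 1\<close>; multiplying by \<open>t\<close> supplies the missing factor 0, which
  may stand on the right because \<open>T\<close> is abelian.\<close>

lemma norm_shift:
  assumes x: "x \<in> carrier G" and t: "t \<in> T"
  shows "x \<otimes> norm_upto x t n \<otimes> inv x \<otimes> t = norm_upto x t (Suc n)"
proof (induction n)
  case 0 then show ?case using x t T_carrier by simp
next
  case (Suc n)
  let ?a = "norm_upto x t n" and ?c = "x [^] n \<otimes> t \<otimes> inv (x [^] n)"
  have c: "?a \<in> T" "?c \<in> T" "x \<otimes> ?c \<otimes> inv x \<in> T" using norm_upto_T[OF x t] T_conj x t by auto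
  have "x \<otimes> (?a \<otimes> ?c) \<otimes> inv x = (x \<otimes> ?a \<otimes> inv x) \<otimes> (x \<otimes> ?c \<otimes> inv x)"
  proof -
    have "(x \<otimes> ?a \<otimes> inv x) \<otimes> (x \<otimes> ?c \<otimes> inv x) = x \<otimes> ?a \<otimes> (inv x \<otimes> (x \<otimes> (?c \<otimes> inv x)))"
      using x T_carrier[OF c(1)] T_carrier[OF c(2)] by (simp only: m_assoc m_closed inv_closed)
    also have "inv x \<otimes> (x \<otimes> (?c \<otimes> inv x)) = ?c \<otimes> inv x"
      using x T_carrier[OF c(2)] by (intro inv_mult_cancel) (simp_all only: m_closed inv_closed)
    finally show ?thesis using x T_carrier[OF c(1)] T_carrier[OF c(2)] by (simp only: m_assoc m_closed inv_closed)
  qed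
  moreover have "x \<otimes> ?c \<otimes> inv x = x [^] Suc n \<otimes> t \<otimes> inv (x [^] Suc n)"
  proof -
    have s: "x [^] Suc n = x \<otimes> x [^] n" using x by (rule nat_pow_Suc2)
    show ?thesis unfolding s using x T_carrier[OF t] by (simp add: inv_mult_group m_assoc)
  qed
  ultimately have "x \<otimes> norm_upto x t (Suc n) \<otimes> inv x \<otimes> t = (x \<otimes> ?a \<otimes> inv x) \<otimes> ((x [^] Suc n \<otimes> t \<otimes> inv (x [^] Suc n)) \<otimes> t)"
    using x t c T_carrier by (simp add: m_assoc)
  also have "(x [^] Suc n \<otimes> t \<otimes> inv (x [^] Suc n)) \<otimes> t = t \<otimes> (x [^] Suc n \<otimes> t \<otimes> inv (x [^] Suc n))"
    using T_conj[OF _ t, of "x [^] Suc n"] x t by (intro T_comm) auto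
  also have "(x \<otimes> ?a \<otimes> inv x) \<otimes> (t \<otimes> (x [^] Suc n \<otimes> t \<otimes> inv (x [^] Suc n))) =
      norm_upto x t (Suc n) \<otimes> (x [^] Suc n \<otimes> t \<otimes> inv (x [^] Suc n))"
    unfolding Suc[symmetric] using x t c T_carrier by (simp add: m_assoc del: nat_pow_Suc norm_upto.simps)
  also have "\<dots> = norm_upto x t (Suc (Suc n))" by (rule norm_upto.simps(2)[symmetric])
  finally show ?case .
qed

text \<open>For \<open>n = N\<close> the additional last factor in \<open>norm_shift\<close> is
  \<open>t\<close> itself, since \<open>x [^] N\<close> lies in the abelian group \<open>T\<close>.
  Cancelling \<open>t\<close> shows that \<open>x\<close> fixes the norm.\<close>

lemma norm_image_commutes:
  assumes x: "x \<in> carrier G" and d: "d \<in> norm_image x"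
  shows "x \<otimes> d = d \<otimes> x"
proof -
  obtain t where t: "t \<in> T" "d = norm_upto x t N" using d by (auto simp: norm_image_def)
  have dT: "d \<in> T" using norm_image_T[OF x] d by blast
  have "x [^] N \<otimes> t \<otimes> inv (x [^] N) = t"
    using T_comm[OF pow_N[OF x] t(1)] x T_carrier[OF t(1)] by (simp add: m_assoc)
  then have "x \<otimes> d \<otimes> inv x \<otimes> t = d \<otimes> t" using norm_shift[OF x t(1), of N] t(2) by simp
  then have "x \<otimes> d \<otimes> inv x = d" using x T_carrier[OF dT] T_carrier[OF t(1)] by simp
  then show ?thesis using x T_carrier[OF dT] by (intro commute_if_conj_fixed)
qed

text \<open>Origin of the exponent \<open>N * N\<close>: the element \<open>x [^] N\<close> lies in
  \<open>T\<close> and is fixed by \<open>x\<close>, so its norm is its \<open>N\<close>-th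
  power.\<close>

lemma pow_mem_norm_image:
  assumes x: "x \<in> carrier G"
  shows "x [^] (N * N) \<in> norm_image x"
proof -
  have "norm_upto x (x [^] N) n = (x [^] N) [^] n" for n
  proof (induction n)
    case (Suc n)
    have "x [^] n \<otimes> x [^] N = x [^] N \<otimes> x [^] n" using x by (simp add: nat_pow_mult add.commute)
    then have "x [^] n \<otimes> x [^] N \<otimes> inv (x [^] n) = x [^] N" using x by (simp add: m_assoc)
    then show ?case using Suc by simp
  qed simp
  from this[of N] have "x [^] (N * N) = norm_upto x (x [^] N) N" using x by (simp add: nat_pow_pow)
  then show ?thesis unfolding norm_image_def using pow_N[OF x] by (intro image_eqI)
qed

text \<open>Powers of \<open>u \<otimes> x\<close> and of \<open>x\<close> differ by elements of
  \<open>T\<close>, which act trivially on \<open>T\<close>. Hence the norm image is a function on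
  the finite set of cosets.\<close>

lemma norm_image_coset:
  assumes x: "x \<in> carrier G" and u: "u \<in> T"
  shows "norm_image (u \<otimes> x) = norm_image x"
proof -
  have pow: "\<exists>v\<in>T. (u \<otimes> x) [^] n = v \<otimes> x [^] n" for n :: nat
  proof (induction n)
    case 0 then show ?case by (intro bexI[of _ \<one>]) auto
  next
    case (Suc n)
    then obtain v where v: "v \<in> T" "(u \<otimes> x) [^] n = v \<otimes> x [^] n" by blast
    have "v \<otimes> x [^] n \<otimes> (u \<otimes> x) = v \<otimes> (x [^] n \<otimes> u \<otimes> inv (x [^] n)) \<otimes> (x [^] n \<otimes> x)"
    proof -
      have "inv (x [^] n) \<otimes> (x [^] n \<otimes> x) = x" using x by (simp add: m_assoc[symmetric])
      then show ?thesis using x T_carrier[OF u] T_carrier[OF v(1)] by (simp add: m_assoc)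
    qed
    then show ?case using v T_conj[of "x [^] n" u] x u by (intro bexI[of _ "v \<otimes> (x [^] n \<otimes> u \<otimes> inv (x [^] n))"]) auto
  qed
  have "norm_upto (u \<otimes> x) t n = norm_upto x t n" if t: "t \<in> T" for t n
  proof (induction n)
    case (Suc n)
    obtain v where v: "v \<in> T" "(u \<otimes> x) [^] n = v \<otimes> x [^] n" using pow by blast
    let ?c = "x [^] n \<otimes> t \<otimes> inv (x [^] n)"
    have c: "?c \<in> T" using T_conj t x by simp
    have "(v \<otimes> x [^] n) \<otimes> t \<otimes> inv (v \<otimes> x [^] n) = v \<otimes> ?c \<otimes> inv v"
      using x t v T_carrier by (simp add: inv_mult_group m_assoc)
    also have "\<dots> = ?c" unfolding T_comm[OF v(1) c] using T_carrier[OF v(1)] T_carrier[OF c] by (simp only: m_assoc inv_closed r_inv r_one)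
    finally show ?case using Suc v(2) by simp
  qed simp
  then show ?thesis by (simp add: norm_image_def)
qed

lemma finite_norm_images: "finite (norm_image ` carrier G)"
proof (rule finite_subset)
  show "norm_image ` carrier G \<subseteq> (\<lambda>C. norm_image (SOME y. y \<in> C)) ` (rcosets T)"
  proof
    fix D assume "D \<in> norm_image ` carrier G"
    then obtain x where x: "x \<in> carrier G" "D = norm_image x" by blast
    have "(SOME y. y \<in> T #> x) \<in> T #> x" using rcos_self[OF x(1) T.subgroup_axioms] by (rule someI)
    then obtain u where "u \<in> T" "(SOME y. y \<in> T #> x) = u \<otimes> x" by (auto simp: r_coset_def)
    then have "D = norm_image (SOME y. y \<in> T #> x)" using norm_image_coset[OF x(1)] x(2) by simp
    then show "D \<in> (\<lambda>C. norm_image (SOME y. y \<in> C)) ` (rcosets T)" using x(1) by (auto simp: RCOSETS_def)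
  qed
qed (use fin_index in simp)

end

section \<open>Characters of the torus vanishing on prescribed cosets\<close>

context p_toral_extension
begin

sublocale TG: torsion_comm_group "G\<lparr>carrier := T\<rparr>"
  rewrites "carrier (G\<lparr>carrier := T\<rparr>) = T" and "\<one>\<^bsub>G\<lparr>carrier := T\<rparr>\<^esub> = \<one>" and "x \<otimes>\<^bsub>G\<lparr>carrier := T\<rparr>\<^esub> y = x \<otimes> y"
proof -
  interpret GT: group "G\<lparr>carrier := T\<rparr>" using T.subgroup_is_group is_group by blast
  interpret GT: comm_group "G\<lparr>carrier := T\<rparr>" by (rule GT.group_comm_groupI) (simp add: T_comm)
  show "torsion_comm_group (G\<lparr>carrier := T\<rparr>)"
  proof unfold_locales
    fix x assume "x \<in> carrier (G\<lparr>carrier := T\<rparr>)"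
    then have x: "x \<in> T" by simp
    obtain n where "n > 0" "x [^] (n::nat) = \<one>" using torsion[OF T_carrier[OF x]] by blast
    then show "\<exists>n::nat. n > 0 \<and> x [^]\<^bsub>G\<lparr>carrier := T\<rparr>\<^esub> n = \<one>\<^bsub>G\<lparr>carrier := T\<rparr>\<^esub>"
      using nat_pow_consistent[of x n T] by (intro exI[of _ n]) simp
  qed
qed simp_all

lemma T_char_separating:
  assumes D: "subgroup D G" "D \<subseteq> T" and e: "e \<in> T" "e \<notin> D"
  shows "\<exists>\<theta>\<in>T_chars. (\<forall>d\<in>D. \<theta> d = 1) \<and> \<theta> e \<noteq> 1"
proof -
  have "subgroup D (G\<lparr>carrier := T\<rparr>)" using D by (simp add: subgroup_incl T.subgroup_axioms)
  then obtain \<theta> where \<theta>: "\<theta> \<in> TG.chars" "\<And>d. d \<in> D \<Longrightarrow> \<theta> d = 1" "\<theta> e \<noteq> 1"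
    using TG.char_separating[of D e] e by blast
  moreover have "\<theta> \<in> T_chars" using \<theta>(1) TG.char_norm[OF \<theta>(1)] by (simp add: TG.chars_def T_chars_def)
  ultimately show ?thesis by blast
qed

lemma T_chars_pow:
  assumes "\<theta> \<in> T_chars" "t \<in> T"
  shows "\<theta> (t [^] (n::nat)) = \<theta> t ^ n"
proof (induction n)
  case 0 then show ?case using assms by (simp add: T_chars_def)
next
  case (Suc n)
  have "\<theta> (t [^] n \<otimes> t) = \<theta> (t [^] n) * \<theta> t" using assms T_pow[OF assms(2)] by (simp add: T_chars_def)
  then show ?case using Suc by (simp add: mult.commute)
qed

text \<open>A list and not a set, because products of such sums can repeat a linear
  character.\<close>

definition T_character :: "('a \<Rightarrow> complex) \<Rightarrow> bool" where
  "T_character h \<longleftrightarrow> (\<exists>\<theta>s. set \<theta>s \<subseteq> T_chars \<and> (\<forall>t\<in>T. h t = (\<Sum>\<theta>\<leftarrow>\<theta>s. \<theta> t)))"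

lemma T_character_mult:
  assumes "T_character g" "T_character h"
  shows "T_character (\<lambda>t. g t * h t)"
proof -
  obtain \<theta>s \<psi>s where gh: "set \<theta>s \<subseteq> T_chars" "\<forall>t\<in>T. g t = (\<Sum>\<theta>\<leftarrow>\<theta>s. \<theta> t)"
    "set \<psi>s \<subseteq> T_chars" "\<forall>t\<in>T. h t = (\<Sum>\<theta>\<leftarrow>\<psi>s. \<theta> t)"
    using assms by (auto simp: T_character_def)
  define xs where "xs = concat (map (\<lambda>\<theta>. map (\<lambda>\<psi> t. \<theta> t * \<psi> t) \<psi>s) \<theta>s)"
  have "(\<lambda>t. \<theta> t * \<psi> t) \<in> T_chars" if "\<theta> \<in> T_chars" "\<psi> \<in> T_chars" for \<theta> \<psi>
    using that by (auto simp: T_chars_def norm_mult)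
  then have "set xs \<subseteq> T_chars" using gh(1,3) by (auto simp: xs_def)
  moreover have "(\<Sum>\<theta>\<leftarrow>xs. \<theta> t) = (\<Sum>\<theta>\<leftarrow>\<theta>s. \<theta> t) * (\<Sum>\<theta>\<leftarrow>\<psi>s. \<theta> t)" for t
    unfolding xs_def
    by (induction \<theta>s) (simp_all add: sum_list_const_mult o_def algebra_simps)
  ultimately show ?thesis using gh(2,4) by (auto simp: T_character_def)
qed

lemma T_character_one: "T_character (\<lambda>t. 1)"
  unfolding T_character_def by (intro exI[of _ "[\<lambda>t. 1]"]) (simp add: T_chars_def)

lemma T_character_prod:
  "finite I \<Longrightarrow> (\<And>i. i \<in> I \<Longrightarrow> T_character (f i)) \<Longrightarrow> T_character (\<lambda>t. \<Prod>i\<in>I. f i t)"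
proof (induction I rule: finite_induct)
  case empty then show ?case using T_character_one by simp
next
  case (insert i I)
  then have "T_character (\<lambda>t. f i t * (\<Prod>i\<in>I. f i t))" by (intro T_character_mult) auto
  then show ?case using insert.hyps by simp
qed

lemma T_character_geometric:
  assumes "\<theta> \<in> T_chars"
  shows "T_character (\<lambda>t. \<Sum>i<q. \<theta> t ^ i)"
proof -
  have "(\<lambda>t. \<theta> t ^ i) \<in> T_chars" for i
    using assms by (auto simp: T_chars_def norm_power power_mult_distrib)
  moreover have "(\<Sum>i<q. \<theta> t ^ i) = (\<Sum>\<theta>\<leftarrow>map (\<lambda>i t. \<theta> t ^ i) [0..<q]. \<theta> t)" for t
    by (simp add: o_def interv_sum_list_conv_sum_set_nat atLeast0LessThan)
  ultimately show ?thesis unfolding T_character_def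
    by (intro exI[of _ "map (\<lambda>i t. \<theta> t ^ i) [0..<q]"]) auto
qed

text \<open>If \<open>\<theta>\<close> is trivial on \<open>D\<close> and \<open>\<theta> e \<noteq> 1\<close> with \<open>e\<close> of order dividing \<open>q\<close>, the geometric sum
  \<open>1 + \<theta> + \<dots> + \<theta> ^ (q - 1)\<close> vanishes on the coset \<open>D e\<close>; by divisibility of \<open>D\<close> such cosets exhaust
  the \<open>t \<notin> D\<close> with \<open>t ^ q \<in> D\<close>. The product over \<open>W\<close> restores invariance.\<close>

lemma vanishing_character:
  assumes W: "finite W" "\<And>w. w \<in> W \<Longrightarrow> w \<in> extensional T" "\<And>w. w \<in> W \<Longrightarrow> w ` T = T"
      "\<And>w x y. w \<in> W \<Longrightarrow> x \<in> T \<Longrightarrow> y \<in> T \<Longrightarrow> w (x \<otimes> y) = w x \<otimes> w y"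
      "\<And>v w. v \<in> W \<Longrightarrow> w \<in> W \<Longrightarrow> compose T w v \<in> W" "(\<lambda>t\<in>T. t) \<in> W"
    and \<D>: "finite \<D>" "\<And>D. D \<in> \<D> \<Longrightarrow> subgroup D G" "\<And>D. D \<in> \<D> \<Longrightarrow> D \<subseteq> T"
      "\<And>D d. D \<in> \<D> \<Longrightarrow> d \<in> D \<Longrightarrow> \<exists>c\<in>D. c [^] q = d"
    and q: "q = p ^ m"
  shows "\<exists>h. T_character h \<and> h \<one> \<noteq> 0 \<and> (\<forall>w\<in>W. \<forall>t\<in>T. h (w t) = h t) \<and>
    (\<forall>D\<in>\<D>. \<forall>t\<in>T. t \<notin> D \<longrightarrow> t [^] q \<in> D \<longrightarrow> h t = 0)"
proof -
  \<comment> \<open>The elements of exponent \<open>q\<close> outside \<open>D\<close> represent all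
    cosets of \<open>D\<close> on which \<open>h\<close> must vanish; there are finitely many of
    them.\<close>
  define E where "E D = {e \<in> T. e [^] q = \<one> \<and> e \<notin> D}" for D
  have finE: "finite (E D)" for D
    by (rule finite_subset[OF _ T_finite_torsion[of m]]) (auto simp: E_def q)
  define I where "I = Sigma \<D> E"
  have finI: "finite I" using \<D>(1) finE by (auto simp: I_def)
  have "\<forall>x\<in>I. \<exists>\<theta>. \<theta> \<in> T_chars \<and> (\<forall>d\<in>fst x. \<theta> d = 1) \<and> \<theta> (snd x) \<noteq> 1"
  proof
    fix x assume "x \<in> I"
    then obtain D e where x: "x = (D,e)" "D \<in> \<D>" "e \<in> T" "e \<notin> D" by (auto simp: I_def E_def)
    show "\<exists>\<theta>. \<theta> \<in> T_chars \<and> (\<forall>d\<in>fst x. \<theta> d = 1) \<and> \<theta> (snd x) \<noteq> 1"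
      using T_char_separating[OF \<D>(2,3)[OF x(2)] x(3,4)] x(1) by auto
  qed
  then obtain \<theta> where \<theta>: "\<And>x. x \<in> I \<Longrightarrow> \<theta> x \<in> T_chars" "\<And>x d. x \<in> I \<Longrightarrow> d \<in> fst x \<Longrightarrow> \<theta> x d = 1"
      "\<And>x. x \<in> I \<Longrightarrow> \<theta> x (snd x) \<noteq> 1"
    unfolding bchoice_iff by blast
  define f where "f t = (\<Prod>x\<in>I. \<Sum>i<q. \<theta> x t ^ i)" for t
  define h where "h t = (\<Prod>w\<in>W. f (w t))" for t
  have wT: "w t \<in> T" if "w \<in> W" "t \<in> T" for w t using W(3)[OF that(1)] that(2) by blast
  have w1: "w \<one> = \<one>" if "w \<in> W" for w
  proof -
    have "w \<one> \<otimes> w \<one> = w \<one>" using W(4)[OF that T.one_closed T.one_closed] by simp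
    then show ?thesis using T_carrier[OF wT[OF that T.one_closed]] by simp
  qed
  have "T_character h" unfolding h_def f_def
  proof (intro T_character_prod W(1) finI)
    fix w x assume wx: "w \<in> W" "x \<in> I"
    have "(\<lambda>t. \<theta> x (w t)) \<in> T_chars"
      using \<theta>(1)[OF wx(2)] wT[OF wx(1)] w1[OF wx(1)] W(4)[OF wx(1)] by (auto simp: T_chars_def)
    then show "T_character (\<lambda>t. \<Sum>i<q. \<theta> x (w t) ^ i)" by (rule T_character_geometric)
  qed
  moreover have "h \<one> \<noteq> 0"
  proof -
    \<comment> \<open>At the identity every geometric sum consists of \<open>q\<close> ones, so
      \<open>h \<one>\<close> is a power of \<open>q\<close>.\<close>
    have "(\<Sum>i<q. \<theta> x (w \<one>) ^ i) = of_nat q" if "w \<in> W" "x \<in> I" for w x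
      using \<theta>(1)[OF that(2)] w1[OF that(1)] by (simp add: T_chars_def)
    then have "h \<one> = (\<Prod>w\<in>W. \<Prod>x\<in>I. of_nat q)" by (simp add: h_def f_def)
    then show ?thesis using q p_pos by simp
  qed
  moreover have "h (v t) = h t" if v: "v \<in> W" and t: "t \<in> T" for v t
  proof -
    let ?c = "\<lambda>w. compose T w v"
    \<comment> \<open>Composition with \<open>v\<close> on the right is injective because
      \<open>v\<close> maps onto \<open>T\<close>. On the finite set \<open>W\<close> it is
      therefore a permutation of the factors of \<open>h\<close>.\<close>
    have inj: "inj_on ?c W"
    proof (rule inj_onI)
      fix w w' assume w: "w \<in> W" "w' \<in> W" "?c w = ?c w'"
      show "w = w'"
      proof (rule extensionalityI[of _ T])
        fix s assume "s \<in> T"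
        then have "s \<in> v ` T" using W(3)[OF v] by simp
        then obtain u where u: "u \<in> T" "s = v u" by blast
        show "w s = w' s" using fun_cong[OF w(3), of u] u by (simp add: compose_def)
      qed (use W(2) w in auto)
    qed
    have "?c ` W = W" using W(1) W(5)[OF v] inj by (intro endo_inj_surj) auto
    then have "(\<Prod>w\<in>W. f (w t)) = (\<Prod>w\<in>W. f (?c w t))" using prod.reindex[OF inj, of "\<lambda>w. f (w t)"] by simp
    then show ?thesis using t by (simp add: h_def compose_def)
  qed
  moreover have "h t = 0" if D: "D \<in> \<D>" and t: "t \<in> T" "t \<notin> D" "t [^] q \<in> D" for D t
  proof -
    obtain d where d: "d \<in> D" "d [^] q = t [^] q" using \<D>(4)[OF D t(3)] by blast
    have dT: "d \<in> T" using \<D>(3)[OF D] d by blast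
    interpret D: subgroup D G using \<D>(2)[OF D] .
    define e where "e = inv d \<otimes> t"
    have e: "e \<in> T" "t = d \<otimes> e" using t dT T_carrier by (auto simp: e_def m_assoc[symmetric])
    have "e \<notin> D" using e(2) t(2) d(1) by auto
    moreover have "e [^] q = \<one>"
    proof -
      have "t [^] q = t [^] q \<otimes> e [^] q" using T_pow_mult[OF dT e(1), of q] d(2) unfolding e(2)[symmetric] by simp
      then show ?thesis using T_carrier[OF t(1)] T_carrier[OF e(1)] by simp
    qed
    ultimately have x: "(D,e) \<in> I" using D e(1) by (auto simp: I_def E_def)
    let ?z = "\<theta> (D,e) t"
    have z: "?z = \<theta> (D,e) e" using \<theta>(1)[OF x] \<theta>(2)[OF x, of d] d(1) dT e by (simp add: T_chars_def)
    then have "?z \<noteq> 1" "?z ^ q = 1" using \<theta>(3)[OF x] T_chars_pow[OF \<theta>(1)[OF x] e(1), of q] \<open>e [^] q = \<one>\<close> \<theta>(1)[OF x]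
      by (auto simp: T_chars_def)
    then have "(\<Sum>i<q. ?z ^ i) = 0" by (simp add: geometric_sum)
    then have "f t = 0" using x finI unfolding f_def by (intro prod_zero) auto
    \<comment> \<open>The factor of \<open>h t\<close> at the identity of \<open>W\<close> is
      \<open>f t\<close>, so one vanishing factor suffices.\<close>
    then have "f ((\<lambda>t\<in>T. t) t) = 0" using t(1) by simp
    then show ?thesis unfolding h_def by (intro prod_zero[OF W(1)] bexI[OF _ W(6)])
  qed
  ultimately show ?thesis by blast
qed

end

section \<open>Sizes of centralizers\<close>

lemma size_le_refl: "size_le a a" by (simp add: size_le_def)

lemma size_le_trans: "size_le a b \<Longrightarrow> size_le b c \<Longrightarrow> size_le a c" by (auto simp: size_le_def)

lemma size_le_total: "size_le a b \<or> size_le b a" by (auto simp: size_le_def)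

lemma finite_size_le_max:
  assumes "finite A" "A \<noteq> {}"
  shows "\<exists>a\<in>A. \<forall>b\<in>A. size_le b a"
  using assms
proof (induction A rule: finite_ne_induct)
  case (singleton x) then show ?case by (simp add: size_le_refl)
next
  case (insert x A)
  then obtain a where a: "a \<in> A" "\<forall>b\<in>A. size_le b a" by blast
  show ?case
  proof (cases "size_le x a")
    case True then show ?thesis using a by blast
  next
    case False
    then have "size_le a x" using size_le_total by blast
    then show ?thesis using a size_le_trans size_le_refl by blast
  qed
qed

context p_toral_extension
begin

lemma subgroup_pow_mem: "subgroup H G \<Longrightarrow> x \<in> H \<Longrightarrow> x [^] (n::nat) \<in> H"
  by (induction n) (auto simp: subgroup.one_closed subgroup.m_closed)

definition divisible_part :: "'a set \<Rightarrow> 'a set" where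
  "divisible_part Z = {x \<in> Z. \<forall>n. \<exists>y\<in>Z. y [^] (p ^ n) = x}"

text \<open>The identity component of a subgroup, its rank, and (up to a factor bounded by the index of \<open>T\<close>)
  its number of components only depend on its intersection with \<open>T\<close>.\<close>

lemma identity_component_subgroup:
  assumes Q: "subgroup Q G"
  shows "identity_component p (G\<lparr>carrier := Q\<rparr>) = divisible_part (Q \<inter> T)"
proof -
  obtain m where m: "N = p ^ m" using N by blast
  have Qc: "x \<in> carrier G" if "x \<in> Q" for x using subgroup.mem_carrier[OF Q that] .
  have pw: "x [^]\<^bsub>G\<lparr>carrier := Q\<rparr>\<^esub> (n::nat) = x [^] n" if "x \<in> Q" for x n
    using nat_pow_consistent[of x n Q] that by simp
  have *: "x \<in> divisible_part (Q \<inter> T)" if x: "x \<in> Q" and d: "\<forall>n. \<exists>y\<in>Q. y [^] (p ^ n) = x" for x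
  proof -
    have div: "\<exists>y\<in>Q \<inter> T. y [^] (p ^ n) = x" for n
    proof -
      \<comment> \<open>The root is taken \<open>m\<close> levels deeper than requested: raising it
        to the power \<open>N = p ^ m\<close> pushes it into \<open>T\<close> and leaves a root of
        exponent \<open>p ^ n\<close>.\<close>
      obtain y where y: "y \<in> Q" "y [^] (p ^ (m + n)) = x" using d by blast
      have "(y [^] N) [^] (p ^ n) = x" using y Qc by (simp add: m nat_pow_pow power_add)
      moreover have "y [^] N \<in> Q \<inter> T" using y subgroup_pow_mem[OF Q] pow_N Qc by simp
      ultimately show ?thesis by blast
    qed
    from div[of 0] obtain y where "y \<in> Q \<inter> T" "y [^] (p ^ 0) = x" by blast
    then have "x \<in> Q \<inter> T" using Qc by simp
    then show ?thesis using div by (simp add: divisible_part_def)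
  qed
  have "identity_component p (G\<lparr>carrier := Q\<rparr>) = {x \<in> Q. \<forall>n. \<exists>y\<in>Q. y [^] (p ^ n) = x}"
    unfolding identity_component_def using pw by (auto cong: bex_cong)
  also have "\<dots> = divisible_part (Q \<inter> T)"
  proof
    show "{x \<in> Q. \<forall>n. \<exists>y\<in>Q. y [^] (p ^ n) = x} \<subseteq> divisible_part (Q \<inter> T)" using * by blast
    show "divisible_part (Q \<inter> T) \<subseteq> {x \<in> Q. \<forall>n. \<exists>y\<in>Q. y [^] (p ^ n) = x}"
      unfolding divisible_part_def by blast
  qed
  finally show ?thesis .
qed

text \<open>Two elements of \<open>Q\<close> in the same coset of \<open>T\<close> differ by an
  element of \<open>Q \<inter> T\<close>, so each coset of \<open>T\<close> contributes at most as
  many cosets of \<open>D\<close> as \<open>Q \<inter> T\<close> does.\<close>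

lemma card_rcosets_bound:
  assumes Q: "subgroup Q G" and D: "D \<subseteq> Q \<inter> T"
  shows "card ((\<lambda>q. D #> q) ` Q) \<le> card (rcosets T) * card ((\<lambda>z. D #> z) ` (Q \<inter> T))"
proof (cases "finite ((\<lambda>z. D #> z) ` (Q \<inter> T))")
  \<comment> \<open>Here the left-hand set is infinite too, and its \<open>card\<close> is 0 by
    convention.\<close>
  case False
  moreover have "(\<lambda>z. D #> z) ` (Q \<inter> T) \<subseteq> (\<lambda>q. D #> q) ` Q" by blast
  ultimately have "infinite ((\<lambda>q. D #> q) ` Q)" using finite_subset by blast
  then show ?thesis by simp
next
  case True
  let ?B = "(\<lambda>z. D #> z) ` (Q \<inter> T)"
  have Qc: "x \<in> carrier G" if "x \<in> Q" for x using subgroup.mem_carrier[OF Q that] .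
  have Dc: "D \<subseteq> carrier G" using D Qc by blast
  have sub: "(\<lambda>q. D #> q) ` (Q \<inter> C) \<subseteq> (\<lambda>B. B #> q0) ` ?B" if C: "C \<in> rcosets T" and q0: "q0 \<in> Q \<inter> C" for C q0
  proof
    fix X' assume "X' \<in> (\<lambda>q. D #> q) ` (Q \<inter> C)"
    then obtain q where q: "q \<in> Q" "q \<in> C" "X' = D #> q" by blast
    obtain g where g: "g \<in> carrier G" "C = T #> g" using C by (auto simp: RCOSETS_def)
    obtain a b where ab: "a \<in> T" "q = a \<otimes> g" "b \<in> T" "q0 = b \<otimes> g" using q(2) q0 g(2) by (auto simp: r_coset_def)
    define z where "z = q \<otimes> inv q0"
    have zQ: "z \<in> Q" unfolding z_def using q(1) q0 subgroup.m_inv_closed[OF Q] subgroup.m_closed[OF Q] by blast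
    have "z = a \<otimes> inv b" unfolding z_def ab(2,4) using T.mem_carrier[OF ab(1)] T.mem_carrier[OF ab(3)] g(1)
      by (simp add: inv_mult_group m_assoc) (simp add: m_assoc[symmetric])
    then have "z \<in> T" using ab(1,3) by simp
    then have z: "z \<in> Q \<inter> T" using zQ by simp
    have "q = z \<otimes> q0" unfolding z_def using Qc[OF q(1)] q0 Qc by (simp add: m_assoc)
    then have "X' = (D #> z) #> q0" using coset_mult_assoc[OF Dc Qc[OF zQ], of q0] q(3) q0 Qc by simp
    then show "X' \<in> (\<lambda>B. B #> q0) ` ?B" using z by blast
  qed
  have le: "finite ((\<lambda>q. D #> q) ` (Q \<inter> C)) \<and> card ((\<lambda>q. D #> q) ` (Q \<inter> C)) \<le> card ?B" if C: "C \<in> rcosets T" for C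
  proof (cases "Q \<inter> C = {}")
    case False
    then obtain q0 where q0: "q0 \<in> Q \<inter> C" by blast
    note s = sub[OF C q0]
    have f: "finite ((\<lambda>B. B #> q0) ` ?B)" using True by (rule finite_imageI)
    have "card ((\<lambda>q. D #> q) ` (Q \<inter> C)) \<le> card ((\<lambda>B. B #> q0) ` ?B)" using f s by (rule card_mono)
    also have "\<dots> \<le> card ?B" using True by (rule card_image_le)
    finally show ?thesis using finite_subset[OF s f] by blast
  qed simp
  have "(\<lambda>q. D #> q) ` Q = (\<Union>C\<in>rcosets T. (\<lambda>q. D #> q) ` (Q \<inter> C))"
  proof
    show "(\<lambda>q. D #> q) ` Q \<subseteq> (\<Union>C\<in>rcosets T. (\<lambda>q. D #> q) ` (Q \<inter> C))"
    proof
      fix Y assume "Y \<in> (\<lambda>q. D #> q) ` Q"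
      then obtain q where q: "q \<in> Q" "Y = D #> q" by blast
      then have "T #> q \<in> rcosets T" "q \<in> T #> q"
        using Qc rcos_self[OF _ T.subgroup_axioms] by (auto simp: RCOSETS_def)
      then show "Y \<in> (\<Union>C\<in>rcosets T. (\<lambda>q. D #> q) ` (Q \<inter> C))" using q by blast
    qed
  qed blast
  then have "card ((\<lambda>q. D #> q) ` Q) \<le> (\<Sum>C\<in>rcosets T. card ((\<lambda>q. D #> q) ` (Q \<inter> C)))"
    using card_UN_le[OF fin_index] by simp
  also have "\<dots> \<le> (\<Sum>C\<in>rcosets T. card ?B)" using le by (intro sum_mono) blast
  finally show ?thesis by simp
qed

text \<open>The rank is left as an unevaluated description. It only matters that it is determined by
  \<open>Q \<inter> T\<close>, whatever its value.\<close>

lemma toral_size_subgroup: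
  assumes Q: "subgroup Q G"
  shows "toral_size p (G\<lparr>carrier := Q\<rparr>) =
    ((THE k. G\<lparr>carrier := divisible_part (Q \<inter> T)\<rparr> \<cong> toral_group p k), card ((\<lambda>q. divisible_part (Q \<inter> T) #> q) ` Q))"
proof -
  have "rcosets\<^bsub>G\<lparr>carrier := Q\<rparr>\<^esub> D = (\<lambda>q. D #> q) ` Q" for D
    by (auto simp: RCOSETS_def r_coset_def)
  then show ?thesis
    unfolding toral_size_def toral_rank_def identity_component_subgroup[OF Q] FactGroup_def Coset.order_def
    by simp
qed

lemma finite_toral_sizes:
  assumes \<Q>: "\<And>Q. Q \<in> \<Q> \<Longrightarrow> subgroup Q G" and fin: "finite ((\<lambda>Q. Q \<inter> T) ` \<Q>)"
  shows "finite ((\<lambda>Q. toral_size p (G\<lparr>carrier := Q\<rparr>)) ` \<Q>)"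
proof (rule finite_subset)
  let ?r = "\<lambda>Z. THE k. G\<lparr>carrier := divisible_part Z\<rparr> \<cong> toral_group p k"
  let ?b = "\<lambda>Z. card (rcosets T) * card ((\<lambda>z. divisible_part Z #> z) ` Z)"
  show "finite (\<Union>Z\<in>(\<lambda>Q. Q \<inter> T) ` \<Q>. {?r Z} \<times> {..?b Z})" using fin by blast
  show "(\<lambda>Q. toral_size p (G\<lparr>carrier := Q\<rparr>)) ` \<Q> \<subseteq> (\<Union>Z\<in>(\<lambda>Q. Q \<inter> T) ` \<Q>. {?r Z} \<times> {..?b Z})"
  proof
    fix s assume "s \<in> (\<lambda>Q. toral_size p (G\<lparr>carrier := Q\<rparr>)) ` \<Q>"
    then obtain Q where Q: "Q \<in> \<Q>" "s = toral_size p (G\<lparr>carrier := Q\<rparr>)" by blast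
    have D: "divisible_part (Q \<inter> T) \<subseteq> Q \<inter> T" by (auto simp: divisible_part_def)
    have "s \<in> {?r (Q \<inter> T)} \<times> {..?b (Q \<inter> T)}"
      unfolding Q(2) toral_size_subgroup[OF \<Q>[OF Q(1)]] using card_rcosets_bound[OF \<Q>[OF Q(1)] D] by simp
    then show "s \<in> (\<Union>Z\<in>(\<lambda>Q. Q \<inter> T) ` \<Q>. {?r Z} \<times> {..?b Z})" using Q(1) by blast
  qed
qed

section \<open>Centralizers of maximal size\<close>

lemma centralizer_subgroup: "P \<subseteq> carrier G \<Longrightarrow> subgroup (centralizer G P) G"
proof (rule subgroupI)
  assume P: "P \<subseteq> carrier G"
  show "centralizer G P \<subseteq> carrier G" by (auto simp: centralizer_def)
  have "\<one> \<in> centralizer G P" using P by (auto simp: centralizer_def)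
  then show "centralizer G P \<noteq> {}" by blast
  fix a assume a: "a \<in> centralizer G P"
  then have ac: "a \<in> carrier G" by (simp add: centralizer_def)
  have "inv a \<otimes> x = x \<otimes> inv a" if x: "x \<in> P" for x
  proof -
    have xc: "x \<in> carrier G" using x P by blast
    have ax: "a \<otimes> x = x \<otimes> a" using a x by (simp add: centralizer_def)
    have "inv a \<otimes> x = inv a \<otimes> (x \<otimes> a) \<otimes> inv a" using ac xc by (simp add: m_assoc)
    also have "\<dots> = x \<otimes> inv a" unfolding ax[symmetric] using ac xc by (simp add: m_assoc[symmetric])
    finally show ?thesis .
  qed
  then show "inv a \<in> centralizer G P" using ac by (simp add: centralizer_def)
  fix b assume b: "b \<in> centralizer G P"
  then have bc: "b \<in> carrier G" by (simp add: centralizer_def)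
  have "a \<otimes> b \<otimes> x = x \<otimes> (a \<otimes> b)" if x: "x \<in> P" for x
  proof -
    have xc: "x \<in> carrier G" using x P by blast
    have "a \<otimes> x = x \<otimes> a" "b \<otimes> x = x \<otimes> b" using a b x by (auto simp: centralizer_def)
    then have "a \<otimes> (b \<otimes> x) = x \<otimes> a \<otimes> b" using ac bc xc by (simp add: m_assoc[symmetric])
    then show ?thesis using ac bc xc by (simp add: m_assoc)
  qed
  then show "a \<otimes> b \<in> centralizer G P" using ac bc by (simp add: centralizer_def)
qed

text \<open>As \<open>T\<close> is abelian, \<open>C\<^sub>T(P)\<close> only depends on the image of \<open>P\<close> in the finite quotient by \<open>T\<close>.\<close>

lemma finite_T_centralizers: "finite ((\<lambda>P. centralizer G P \<inter> T) ` {P. P \<subseteq> carrier G})"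
proof (rule finite_subset)
  show "finite ((\<lambda>\<C>. centralizer G (\<Union>\<C>) \<inter> T) ` Pow (rcosets T))" using fin_index by simp
  show "(\<lambda>P. centralizer G P \<inter> T) ` {P. P \<subseteq> carrier G} \<subseteq> (\<lambda>\<C>. centralizer G (\<Union>\<C>) \<inter> T) ` Pow (rcosets T)"
  proof
    fix Z assume "Z \<in> (\<lambda>P. centralizer G P \<inter> T) ` {P. P \<subseteq> carrier G}"
    then obtain P where P: "P \<subseteq> carrier G" "Z = centralizer G P \<inter> T" by blast
    define \<C> where "\<C> = (\<lambda>x. T #> x) ` P"
    have "centralizer G (\<Union>\<C>) \<inter> T = centralizer G P \<inter> T"
    proof
      show "centralizer G (\<Union>\<C>) \<inter> T \<subseteq> centralizer G P \<inter> T"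
        using P(1) rcos_self[OF _ T.subgroup_axioms] by (auto simp: centralizer_def \<C>_def)
      show "centralizer G P \<inter> T \<subseteq> centralizer G (\<Union>\<C>) \<inter> T"
      proof
        fix t assume t: "t \<in> centralizer G P \<inter> T"
        have "t \<otimes> y = y \<otimes> t" if "y \<in> \<Union>\<C>" for y
        proof -
          obtain x s where xs: "x \<in> P" "s \<in> T" "y = s \<otimes> x" using \<open>y \<in> \<Union>\<C>\<close> by (auto simp: \<C>_def r_coset_def)
          have c: "x \<in> carrier G" "s \<in> carrier G" "t \<in> carrier G" using xs P(1) t T.mem_carrier by auto
          have "t \<otimes> x = x \<otimes> t" using t xs(1) by (simp add: centralizer_def)
          moreover have "t \<otimes> s = s \<otimes> t" using t xs(2) by (intro T_comm) auto
          ultimately show ?thesis unfolding xs(3) using c by (metis m_assoc)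
        qed
        moreover have "t \<in> carrier G" "t \<in> T" using t by (auto simp: centralizer_def)
        ultimately show "t \<in> centralizer G (\<Union>\<C>) \<inter> T" unfolding centralizer_def by blast
      qed
    qed
    moreover have "\<C> \<in> Pow (rcosets T)" using P(1) by (auto simp: \<C>_def RCOSETS_def)
    ultimately show "Z \<in> (\<lambda>\<C>. centralizer G (\<Union>\<C>) \<inter> T) ` Pow (rcosets T)" using P(2) by blast
  qed
qed

text \<open>The family may be infinite, but centralizers have only finitely many intersections with
  \<open>T\<close>, hence only finitely many sizes, and a maximum exists.\<close>

lemma exists_max_centralizer:
  assumes "\<P> \<noteq> {}" "\<And>P. P \<in> \<P> \<Longrightarrow> P \<subseteq> carrier G"
  shows "\<exists>P\<in>\<P>. \<forall>P'\<in>\<P>. size_le (toral_size p (G\<lparr>carrier := centralizer G P'\<rparr>)) (toral_size p (G\<lparr>carrier := centralizer G P\<rparr>))"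
proof -
  let ?Q = "centralizer G ` \<P>"
  have "finite ((\<lambda>Q. Q \<inter> T) ` ?Q)"
    by (rule finite_subset[OF _ finite_T_centralizers]) (use assms(2) in auto)
  then have "finite ((\<lambda>Q. toral_size p (G\<lparr>carrier := Q\<rparr>)) ` ?Q)"
    using centralizer_subgroup assms(2) by (intro finite_toral_sizes) auto
  from finite_size_le_max[OF this] assms(1) show ?thesis by auto
qed

end

section \<open>Saturated fusion systems\<close>

lemma (in group) normalizer_iff:
  assumes "P \<subseteq> carrier G"
  shows "g \<in> normalizer G P \<longleftrightarrow> g \<in> carrier G \<and> (\<lambda>x. g \<otimes> x \<otimes> inv g) ` P = P"
proof -
  have "g <# P #> inv g = (\<lambda>x. g \<otimes> x \<otimes> inv g) ` P" by (auto simp: l_coset_def r_coset_def)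
  then show ?thesis using assms by (auto simp: normalizer_def stabilizer_def)
qed

locale saturated_fusion = p_toral_extension +
  fixes F :: "'a mor_sets"
  assumes fusion: "fusion_system p G F" and saturated: "saturated p G F"
begin

lemmas fusionD = fusion[unfolded fusion_system_def, THEN conjunct2]

lemma Hom_conj_subset: "subgroup P G \<Longrightarrow> subgroup Q G \<Longrightarrow> Hom_conj G P Q \<subseteq> F P Q"
  by (rule fusionD[THEN conjunct1, rule_format, THEN conjunct1])

lemma mor_subset: "subgroup P G \<Longrightarrow> subgroup Q G \<Longrightarrow> F P Q \<subseteq> Inj_hom G P Q"
  by (rule fusionD[THEN conjunct1, rule_format, THEN conjunct2])

lemma conj_mor:
  assumes "subgroup P G" "subgroup Q G" "g \<in> carrier G" "conj_map G P g ` P \<subseteq> Q"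
  shows "conj_map G P g \<in> F P Q"
proof -
  have "conj_map G P g \<in> Hom_conj G P Q" using assms(3,4) by (auto simp: Hom_conj_def)
  then show ?thesis using Hom_conj_subset[OF assms(1,2)] by (rule rev_subsetD)
qed

lemma mor_facts:
  assumes "subgroup P G" "subgroup Q G" "\<phi> \<in> F P Q"
  shows "\<phi> \<in> extensional P" "\<phi> ` P \<subseteq> Q" "inj_on \<phi> P" "x \<in> P \<Longrightarrow> y \<in> P \<Longrightarrow> \<phi> (x \<otimes> y) = \<phi> x \<otimes> \<phi> y"
proof -
  have i: "\<phi> \<in> Inj_hom G P Q" using assms(3) mor_subset[OF assms(1,2)] by (rule rev_subsetD)
  then show "\<phi> \<in> extensional P" "inj_on \<phi> P" by (simp_all add: Inj_hom_def mon_def)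
  have h: "\<phi> \<in> hom (G\<lparr>carrier := P\<rparr>) (G\<lparr>carrier := Q\<rparr>)" using i by (simp add: Inj_hom_def mon_def)
  show "\<phi> ` P \<subseteq> Q" using hom_in_carrier[OF h] by auto
  show "x \<in> P \<Longrightarrow> y \<in> P \<Longrightarrow> \<phi> (x \<otimes> y) = \<phi> x \<otimes> \<phi> y" using hom_mult[OF h, of x y] by simp
qed

lemma comp_mor:
  "subgroup P G \<Longrightarrow> subgroup Q G \<Longrightarrow> subgroup R G \<Longrightarrow> \<phi> \<in> F P Q \<Longrightarrow> \<psi> \<in> F Q R \<Longrightarrow> compose P \<psi> \<phi> \<in> F P R"
  by (rule fusionD[THEN conjunct2, THEN conjunct1, rule_format])

lemma incl_mor:
  assumes P: "subgroup P G" and Q: "subgroup Q G" and PQ: "P \<subseteq> Q"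
  shows "(\<lambda>x\<in>P. x) \<in> F P Q"
proof -
  have "conj_map G P \<one> = (\<lambda>x\<in>P. x)"
    unfolding conj_map_def by (rule restrict_ext) (use subgroup.mem_carrier[OF P] in simp)
  moreover have "(\<lambda>x\<in>P. x) ` P \<subseteq> Q" using PQ by auto
  ultimately show ?thesis using conj_mor[OF P Q one_closed] by simp
qed

lemma restrict_mor:
  assumes "subgroup A G" "subgroup P G" "subgroup Q G" "A \<subseteq> P" "\<phi> \<in> F P Q"
  shows "restrict \<phi> A \<in> F A Q"
proof -
  have "compose A \<phi> (\<lambda>x\<in>A. x) \<in> F A Q" by (rule comp_mor[OF assms(1-3) incl_mor[OF assms(1,2,4)] assms(5)])
  moreover have "compose A \<phi> (\<lambda>x\<in>A. x) = restrict \<phi> A" by (auto simp: compose_def restrict_def)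
  ultimately show ?thesis by simp
qed

lemma F_isoD:
  assumes "subgroup P G" "subgroup Q G" "\<phi> \<in> F_iso F P Q"
  shows "\<phi> \<in> F P Q" "\<phi> ` P = Q"
    "\<exists>\<psi>\<in>F_iso F Q P. (\<forall>x\<in>P. \<psi> (\<phi> x) = x) \<and> (\<forall>y\<in>Q. \<phi> (\<psi> y) = y)"
proof -
  obtain \<psi> where \<psi>: "\<phi> \<in> F P Q" "\<psi> \<in> F Q P" "compose P \<psi> \<phi> = (\<lambda>x\<in>P. x)" "compose Q \<phi> \<psi> = (\<lambda>x\<in>Q. x)"
    using assms(3) unfolding F_iso_def by blast
  show "\<phi> \<in> F P Q" by fact
  have a: "\<forall>x\<in>P. \<psi> (\<phi> x) = x"
  proof
    fix x assume "x \<in> P" then show "\<psi> (\<phi> x) = x" using fun_cong[OF \<psi>(3), of x] by (simp add: compose_def)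
  qed
  have b: "\<forall>y\<in>Q. \<phi> (\<psi> y) = y"
  proof
    fix y assume "y \<in> Q" then show "\<phi> (\<psi> y) = y" using fun_cong[OF \<psi>(4), of y] by (simp add: compose_def)
  qed
  have c: "\<phi> ` P \<subseteq> Q" "\<psi> ` Q \<subseteq> P" using mor_facts(2)[OF assms(1,2) \<psi>(1)] mor_facts(2)[OF assms(2,1) \<psi>(2)] by blast+
  show "\<phi> ` P = Q"
  proof
    show "Q \<subseteq> \<phi> ` P"
    proof
      fix y assume y: "y \<in> Q"
      then have "\<psi> y \<in> P" using c by blast
      then show "y \<in> \<phi> ` P" using b y by (intro image_eqI[of _ _ "\<psi> y"]) auto
    qed
  qed (rule c)
  have "\<psi> \<in> F_iso F Q P" using \<psi> unfolding F_iso_def by blast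
  then show "\<exists>\<psi>\<in>F_iso F Q P. (\<forall>x\<in>P. \<psi> (\<phi> x) = x) \<and> (\<forall>y\<in>Q. \<phi> (\<psi> y) = y)" using a b by blast
qed

text \<open>The factorisation axiom provides an isomorphism onto some
  \<open>R \<subseteq> Q\<close>, and comparing values identifies \<open>R\<close> with the image.
  Later changes of codomain rest on this.\<close>

lemma mor_image:
  assumes P: "subgroup P G" and Q: "subgroup Q G" and \<phi>: "\<phi> \<in> F P Q"
  shows "subgroup (\<phi> ` P) G" "\<phi> \<in> F_iso F P (\<phi> ` P)"
proof -
  obtain R \<psi> where R: "subgroup R G" "R \<subseteq> Q" "\<psi> \<in> F_iso F P R" "\<phi> = compose P (\<lambda>x\<in>R. x) \<psi>"
    using fusionD[THEN conjunct2, THEN conjunct2, rule_format, OF P Q \<phi>]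
    by (elim exE conjE)
  have im: "\<psi> ` P = R" "\<psi> \<in> F P R" using F_isoD[OF P R(1,3)] by blast+
  have "\<phi> = \<psi>"
  proof (rule extensionalityI[of _ P])
    show "\<phi> \<in> extensional P" by (rule mor_facts(1)[OF P Q \<phi>])
    show "\<psi> \<in> extensional P" by (rule mor_facts(1)[OF P R(1) im(2)])
    fix x assume x: "x \<in> P"
    then have "\<psi> x \<in> R" using im by blast
    then show "\<phi> x = \<psi> x" using x unfolding R(4) by (simp add: compose_def)
  qed
  then show "subgroup (\<phi> ` P) G" "\<phi> \<in> F_iso F P (\<phi> ` P)" using im R by auto
qed

lemma mor_codomain:
  assumes P: "subgroup P G" and Q: "subgroup Q G" and R: "subgroup R G" and \<phi>: "\<phi> \<in> F P Q" "\<phi> ` P \<subseteq> R"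
  shows "\<phi> \<in> F P R"
proof -
  have I: "subgroup (\<phi> ` P) G" "\<phi> \<in> F P (\<phi> ` P)" using mor_image[OF P Q \<phi>(1)] F_isoD(1)[OF P] by blast+
  have "compose P (\<lambda>x\<in>\<phi> ` P. x) \<phi> \<in> F P R" by (rule comp_mor[OF P I(1) R I(2) incl_mor[OF I(1) R \<phi>(2)]])
  moreover have "compose P (\<lambda>x\<in>\<phi> ` P. x) \<phi> = \<phi>"
    by (rule extensionalityI[of _ P]) (simp_all add: compose_def mor_facts(1)[OF P Q \<phi>(1)])
  ultimately show ?thesis by simp
qed

lemma F_iso_iff:
  assumes P: "subgroup P G" and Q: "subgroup Q G"
  shows "\<phi> \<in> F_iso F P Q \<longleftrightarrow> \<phi> \<in> F P Q \<and> \<phi> ` P = Q"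
proof
  assume "\<phi> \<in> F P Q \<and> \<phi> ` P = Q"
  then show "\<phi> \<in> F_iso F P Q" using mor_image(2)[OF P Q, of \<phi>] by simp
next
  assume "\<phi> \<in> F_iso F P Q"
  then show "\<phi> \<in> F P Q \<and> \<phi> ` P = Q" using F_isoD(1,2)[OF P Q] by simp
qed

lemma F_iso_comp:
  assumes P: "subgroup P G" and Q: "subgroup Q G" and R: "subgroup R G" and "\<phi> \<in> F_iso F P Q" "\<psi> \<in> F_iso F Q R"
  shows "compose P \<psi> \<phi> \<in> F_iso F P R"
proof -
  have i: "\<phi> \<in> F P Q" "\<phi> ` P = Q" "\<psi> \<in> F Q R" "\<psi> ` Q = R" using assms F_iso_iff by blast+
  have "compose P \<psi> \<phi> ` P = \<psi> ` \<phi> ` P" unfolding image_image by (rule image_cong) (simp_all add: compose_def)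
  then have "compose P \<psi> \<phi> ` P = R" using i(2,4) by simp
  then show ?thesis using comp_mor[OF P Q R i(1,3)] F_iso_iff[OF P R] by blast
qed

text \<open>Choose a conjugate with the largest centralizer. By transitivity the conjugates of
  \<open>Q\<close> are among those of \<open>P\<close>, so maximality carries over to the class of
  \<open>Q\<close>.\<close>

lemma exists_fully_centralized:
  assumes P: "subgroup P G"
  shows "\<exists>Q \<phi>. subgroup Q G \<and> \<phi> \<in> F_iso F P Q \<and> fully_centralized p G F Q"
proof -
  let ?P = "{Q. F_conjugate G F P Q}"
  have "(\<lambda>x\<in>P. x) \<in> F_iso F P P" using incl_mor[OF P P] F_iso_iff[OF P P] by auto
  then have "P \<in> ?P" using P by (auto simp: F_conjugate_def)
  then have ne: "?P \<noteq> {}" by blast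
  have "Q \<subseteq> carrier G" if "Q \<in> ?P" for Q using that subgroup.subset by (auto simp: F_conjugate_def)
  from exists_max_centralizer[OF ne this] obtain Q where Q: "F_conjugate G F P Q"
    "\<And>Q'. F_conjugate G F P Q' \<Longrightarrow> size_le (toral_size p (G\<lparr>carrier := centralizer G Q'\<rparr>)) (toral_size p (G\<lparr>carrier := centralizer G Q\<rparr>))"
    by auto
  obtain \<phi> where \<phi>: "subgroup Q G" "\<phi> \<in> F_iso F P Q" using Q(1) by (auto simp: F_conjugate_def)
  have "F_conjugate G F P Q'" if "F_conjugate G F Q Q'" for Q'
  proof -
    obtain \<psi> where "subgroup Q' G" "\<psi> \<in> F_iso F Q Q'" using \<open>F_conjugate G F Q Q'\<close> by (auto simp: F_conjugate_def)
    then show ?thesis using F_iso_comp[OF P \<phi>(1) _ \<phi>(2)] P by (auto simp: F_conjugate_def)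
  qed
  then have "fully_centralized p G F Q" using Q(2) by (simp add: fully_centralized_def)
  then show ?thesis using \<phi> by blast
qed

section \<open>Extension of morphisms\<close>

lemma N_ext_iff:
  assumes P: "subgroup P G" and \<phi>: "\<phi> \<in> F P (carrier G)"
  shows "g \<in> N_ext G P \<phi> \<longleftrightarrow> g \<in> normalizer G P \<and>
    (\<exists>s\<in>carrier G. \<forall>x\<in>P. \<phi> (g \<otimes> x \<otimes> inv g) = s \<otimes> \<phi> x \<otimes> inv s)"
proof -
  note f = mor_facts[OF P subgroup_self \<phi>]
  let ?h = "\<lambda>y\<in>\<phi> ` P. \<phi> (conj_map G P g (inv_into P \<phi> y))"
  have hx: "?h (\<phi> x) = \<phi> (g \<otimes> x \<otimes> inv g)" if "x \<in> P" for x
    using that f(3) by (simp add: conj_map_def)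
  have "?h \<in> Hom_conj G (\<phi> ` P) (\<phi> ` P) \<longleftrightarrow> (\<exists>s\<in>carrier G. \<forall>x\<in>P. \<phi> (g \<otimes> x \<otimes> inv g) = s \<otimes> \<phi> x \<otimes> inv s)"
    if g: "g \<in> normalizer G P"
  proof
    assume "?h \<in> Hom_conj G (\<phi> ` P) (\<phi> ` P)"
    then obtain s where s: "s \<in> carrier G" "?h = conj_map G (\<phi> ` P) s" by (auto simp: Hom_conj_def)
    have "\<phi> (g \<otimes> x \<otimes> inv g) = s \<otimes> \<phi> x \<otimes> inv s" if x: "x \<in> P" for x
      using fun_cong[OF s(2), of "\<phi> x"] hx[OF x] x unfolding conj_map_def[of G "\<phi> ` P"] by simp
    then show "\<exists>s\<in>carrier G. \<forall>x\<in>P. \<phi> (g \<otimes> x \<otimes> inv g) = s \<otimes> \<phi> x \<otimes> inv s" using s(1) by blast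
  next
    assume "\<exists>s\<in>carrier G. \<forall>x\<in>P. \<phi> (g \<otimes> x \<otimes> inv g) = s \<otimes> \<phi> x \<otimes> inv s"
    then obtain s where s: "s \<in> carrier G" "\<And>x. x \<in> P \<Longrightarrow> \<phi> (g \<otimes> x \<otimes> inv g) = s \<otimes> \<phi> x \<otimes> inv s" by blast
    have e: "?h = conj_map G (\<phi> ` P) s"
    proof (rule extensionalityI[of _ "\<phi> ` P"])
      fix y assume y: "y \<in> \<phi> ` P"
      then obtain x where "x \<in> P" "y = \<phi> x" by blast
      then show "?h y = conj_map G (\<phi> ` P) s y" using hx s(2) y unfolding conj_map_def[of G "\<phi> ` P"] by auto
    qed (auto simp: conj_map_def)
    have gP: "(\<lambda>x. g \<otimes> x \<otimes> inv g) ` P = P" using g normalizer_iff[OF subgroup.subset[OF P]] by blast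
    have "conj_map G (\<phi> ` P) s ` (\<phi> ` P) \<subseteq> \<phi> ` P"
    proof
      fix z assume "z \<in> conj_map G (\<phi> ` P) s ` (\<phi> ` P)"
      then obtain x where x: "x \<in> P" "z = conj_map G (\<phi> ` P) s (\<phi> x)" by blast
      then have "z = \<phi> (g \<otimes> x \<otimes> inv g)" using s(2) by (simp add: conj_map_def)
      then show "z \<in> \<phi> ` P" using gP x(1) by blast
    qed
    then show "?h \<in> Hom_conj G (\<phi> ` P) (\<phi> ` P)" unfolding e using s(1) by (auto simp: Hom_conj_def)
  qed
  then show ?thesis unfolding N_ext_def by blast
qed

lemma N_ext_subgroup:
  assumes P: "subgroup P G" and \<phi>: "\<phi> \<in> F P (carrier G)"
  shows "subgroup (N_ext G P \<phi>) G"
proof -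
  note iff = N_ext_iff[OF P \<phi>] and f = mor_facts[OF P subgroup_self \<phi>]
  have nsub: "subgroup (normalizer G P) G" by (rule normalizer_imp_subgroup[OF subgroup.subset[OF P]])
  have Pc: "x \<in> carrier G" if "x \<in> P" for x using subgroup.mem_carrier[OF P that] .
  have nP: "g \<otimes> x \<otimes> inv g \<in> P" if "g \<in> normalizer G P" "x \<in> P" for g x
    using that normalizer_iff[OF subgroup.subset[OF P]] by blast
  have nc: "g \<in> carrier G" if "g \<in> normalizer G P" for g using subgroup.mem_carrier[OF nsub that] .
  have \<phi>c: "\<phi> x \<in> carrier G" if "x \<in> P" for x using f(2) that by blast
  have cc: "(a \<otimes> b) \<otimes> x \<otimes> inv (a \<otimes> b) = a \<otimes> (b \<otimes> x \<otimes> inv b) \<otimes> inv a"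
    if "a \<in> carrier G" "b \<in> carrier G" "x \<in> carrier G" for a b x
    using that by (simp add: inv_mult_group m_assoc)
  have ci: "inv a \<otimes> (a \<otimes> x \<otimes> inv a) \<otimes> a = x" if "a \<in> carrier G" "x \<in> carrier G" for a x
    using that by (simp add: m_assoc inv_mult_cancel)
  show ?thesis
  proof (rule subgroupI)
    show "N_ext G P \<phi> \<subseteq> carrier G" using iff nc by blast
    have "\<one> \<in> N_ext G P \<phi>" unfolding iff
      using subgroup.one_closed[OF nsub] Pc \<phi>c by (auto intro!: bexI[of _ \<one>])
    then show "N_ext G P \<phi> \<noteq> {}" by blast
    fix a assume "a \<in> N_ext G P \<phi>"
    then obtain s where a: "a \<in> normalizer G P" and s: "s \<in> carrier G" "\<And>x. x \<in> P \<Longrightarrow> \<phi> (a \<otimes> x \<otimes> inv a) = s \<otimes> \<phi> x \<otimes> inv s"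
      using iff by blast
    have ia: "inv a \<in> normalizer G P" using subgroup.m_inv_closed[OF nsub a] .
    have "\<phi> (inv a \<otimes> x \<otimes> inv (inv a)) = inv s \<otimes> \<phi> x \<otimes> inv (inv s)" if x: "x \<in> P" for x
    proof -
      define z where "z = inv a \<otimes> x \<otimes> a"
      have z: "z \<in> P" using nP[OF ia x] nc[OF a] by (simp add: z_def)
      have "a \<otimes> z \<otimes> inv a = x" using nc[OF a] Pc[OF x] ci[of "inv a" x] by (simp add: z_def)
      then have "\<phi> x = s \<otimes> \<phi> z \<otimes> inv s" using s(2)[OF z] by simp
      then have "inv s \<otimes> \<phi> x \<otimes> s = \<phi> z" using ci[OF s(1) \<phi>c[OF z]] by simp
      then show ?thesis using s(1) nc[OF a] by (simp add: z_def)
    qed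
    then show "inv a \<in> N_ext G P \<phi>" using iff ia s(1) by blast
    fix b assume "b \<in> N_ext G P \<phi>"
    then obtain r where b: "b \<in> normalizer G P" and r: "r \<in> carrier G" "\<And>x. x \<in> P \<Longrightarrow> \<phi> (b \<otimes> x \<otimes> inv b) = r \<otimes> \<phi> x \<otimes> inv r"
      using iff by blast
    have "\<phi> ((a \<otimes> b) \<otimes> x \<otimes> inv (a \<otimes> b)) = (s \<otimes> r) \<otimes> \<phi> x \<otimes> inv (s \<otimes> r)" if x: "x \<in> P" for x
      unfolding cc[OF nc[OF a] nc[OF b] Pc[OF x]] cc[OF s(1) r(1) \<phi>c[OF x]] s(2)[OF nP[OF b x]] r(2)[OF x] ..
    moreover have "a \<otimes> b \<in> normalizer G P" using subgroup.m_closed[OF nsub a b] .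
    ultimately show "a \<otimes> b \<in> N_ext G P \<phi>" using iff s(1) r(1) m_closed by blast
  qed
qed

text \<open>An element centralizing \<open>P\<close> induces the identity on \<open>P\<close>, and
  the identity is induced on the image by the unit. So the centralizer lies in
  \<open>N_ext G P \<phi>\<close>, where axiom (II) applies. Agreement is restricted to the
  intersection because \<open>P\<close> need not be abelian.\<close>

lemma extend_to_centralizer:
  assumes P: "subgroup P G" and \<phi>: "\<phi> \<in> F P (carrier G)" and fc: "fully_centralized p G F (\<phi> ` P)"
  shows "\<exists>\<psi>\<in>F (centralizer G P) (carrier G). \<forall>x\<in>P \<inter> centralizer G P. \<psi> x = \<phi> x"
proof -
  obtain \<phi>' where \<phi>': "\<phi>' \<in> F (N_ext G P \<phi>) (carrier G)" "\<And>x. x \<in> P \<Longrightarrow> \<phi>' x = \<phi> x"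
    using saturated P \<phi> fc unfolding saturated_def by blast
  have Pc: "P \<subseteq> carrier G" by (rule subgroup.subset[OF P])
  have C: "subgroup (centralizer G P) G" by (rule centralizer_subgroup[OF Pc])
  have "centralizer G P \<subseteq> N_ext G P \<phi>"
  proof
    fix g assume g: "g \<in> centralizer G P"
    then have gc: "g \<in> carrier G" by (simp add: centralizer_def)
    have fx: "g \<otimes> x \<otimes> inv g = x" if x: "x \<in> P" for x
    proof -
      have "g \<otimes> x = x \<otimes> g" "x \<in> carrier G" using g x Pc by (auto simp: centralizer_def)
      then show ?thesis using gc by (simp add: m_assoc)
    qed
    have "g \<in> normalizer G P" using normalizer_iff[OF Pc] gc fx by simp
    moreover have "\<phi> (g \<otimes> x \<otimes> inv g) = \<one> \<otimes> \<phi> x \<otimes> inv \<one>" if x: "x \<in> P" for x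
    proof -
      have "\<phi> x \<in> carrier G" using mor_facts(2)[OF P subgroup_self \<phi>] x by blast
      then show ?thesis using fx[OF x] by simp
    qed
    ultimately show "g \<in> N_ext G P \<phi>" using N_ext_iff[OF P \<phi>] one_closed by blast
  qed
  then have "restrict \<phi>' (centralizer G P) \<in> F (centralizer G P) (carrier G)"
    by (rule restrict_mor[OF C N_ext_subgroup[OF P \<phi>] subgroup_self _ \<phi>'(1)])
  then show ?thesis using \<phi>'(2) by (intro bexI) auto
qed

lemma mor_pow:
  assumes A: "subgroup A G" and \<psi>: "\<psi> \<in> F A Q" and Q: "subgroup Q G" and x: "x \<in> A"
  shows "\<psi> (x [^] (n::nat)) = \<psi> x [^] n"
proof (induction n)
  case 0
  have o: "\<one> \<in> A" using subgroup.one_closed[OF A] .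
  have "\<psi> \<one> \<in> carrier G" using mor_facts(2)[OF A Q \<psi>] o subgroup.subset[OF Q] by blast
  moreover have "\<psi> \<one> \<otimes> \<psi> \<one> = \<psi> \<one>" using mor_facts(4)[OF A Q \<psi> o o] by simp
  ultimately show ?case by simp
next
  case (Suc n)
  then show ?case using mor_facts(4)[OF A Q \<psi> subgroup_pow_mem[OF A x] x] by simp
qed

text \<open>Morphisms preserve \<open>N\<close>-th powers, and all \<open>N\<close>-th powers lie in
  \<open>T\<close>.\<close>

lemma divisible_image_T:
  assumes A: "subgroup A G" and \<psi>: "\<psi> \<in> F A (carrier G)" and d: "\<And>x. x \<in> D \<Longrightarrow> \<exists>y\<in>A. y [^] N = x"
  shows "\<psi> ` D \<subseteq> T"
proof
  fix z assume "z \<in> \<psi> ` D"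
  then obtain x where x: "x \<in> D" "z = \<psi> x" by blast
  obtain y where y: "y \<in> A" "y [^] N = x" using d[OF x(1)] by blast
  have "\<psi> y \<in> carrier G" using mor_facts(2)[OF A subgroup_self \<psi>] y(1) by blast
  then have "\<psi> y [^] N \<in> T" by (rule pow_N)
  then show "z \<in> T" using mor_pow[OF A \<psi> subgroup_self y(1), of N] y(2) x(2) by simp
qed

lemma T_divisible_N: "x \<in> T \<Longrightarrow> \<exists>y\<in>T. y [^] N = x"
  using N T_divisible by blast

text \<open>Since \<open>T\<close> is divisible it is mapped into itself, and then onto itself by
  \<open>injective_endo_surj\<close>. So every morphism defined on \<open>T\<close> or more yields
  an element of the automorphism group of \<open>T\<close> in \<open>F\<close>.\<close>

lemma restrict_T_iso:
  assumes A: "subgroup A G" and TA: "T \<subseteq> A" and \<psi>: "\<psi> \<in> F A (carrier G)"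
  shows "restrict \<psi> T \<in> F_iso F T T"
proof -
  let ?w = "restrict \<psi> T"
  have Ts: "subgroup T G" by (rule T.subgroup_axioms)
  have w: "?w \<in> F T (carrier G)" by (rule restrict_mor[OF Ts A subgroup_self TA \<psi>])
  have "?w ` T \<subseteq> T" by (rule divisible_image_T[OF Ts w T_divisible_N])
  moreover from this have "?w ` T = T"
    using mor_facts[OF Ts subgroup_self w] by (intro injective_endo_surj) auto
  ultimately show ?thesis using mor_codomain[OF Ts subgroup_self Ts w] F_iso_iff[OF Ts Ts] by blast
qed

text \<open>\<open>T\<close> is its only conjugate, hence fully normalized, and axiom (I) makes the
  outer automorphism group finite. The inner automorphisms are trivial because \<open>T\<close> is
  abelian.\<close>

lemma finite_Aut_T: "finite (F_iso F T T)"
proof -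
  let ?A = "F_iso F T T" and ?H = "Inn_group G T"
  let ?B = "(AutoGroup (G\<lparr>carrier := T\<rparr>))\<lparr>carrier := ?A\<rparr>"
  have Ts: "subgroup T G" by (rule T.subgroup_axioms)
  have conj: "P' = T" if P': "F_conjugate G F T P'" for P'
  proof -
    obtain \<phi> where \<phi>: "subgroup P' G" "\<phi> \<in> F_iso F T P'" using P' by (auto simp: F_conjugate_def)
    then have i: "\<phi> \<in> F T P'" "\<phi> ` T = P'" using F_iso_iff[OF Ts \<phi>(1)] by blast+
    have f: "\<phi> \<in> F T (carrier G)"
      using mor_codomain[OF Ts \<phi>(1) subgroup_self i(1)] i(2) subgroup.subset[OF \<phi>(1)] by blast
    have "restrict \<phi> T \<in> F_iso F T T" by (rule restrict_T_iso[OF Ts subset_refl f])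
    then have "restrict \<phi> T ` T = T" using F_iso_iff[OF Ts Ts] by blast
    then show ?thesis using i(2) by simp
  qed
  have "fully_normalized p G F T" unfolding fully_normalized_def using conj size_le_refl by blast
  then have fin: "finite (carrier (Out_F G F T))" using saturated Ts unfolding saturated_def by blast
  have H: "?H = {\<lambda>x\<in>T. x}"
  proof -
    have "conj_map G T g = (\<lambda>x\<in>T. x)" if g: "g \<in> T" for g
      unfolding conj_map_def
    proof (rule restrict_ext)
      fix x assume x: "x \<in> T"
      show "g \<otimes> x \<otimes> inv g = x" using T_comm[OF g x] T_carrier[OF g] T_carrier[OF x] by (simp add: m_assoc)
    qed
    then have "conj_map G T ` T = (\<lambda>g. (\<lambda>x\<in>T. x)) ` T" by (rule image_cong[OF refl])
    then show ?thesis using T.one_closed unfolding Inn_group_def Setcompr_eq_image Collect_mem_eq by auto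
  qed
  have bij: "a \<in> Bij T" if "a \<in> ?A" for a
  proof -
    have a: "a \<in> F T T" "a ` T = T" using that F_iso_iff[OF Ts Ts] by blast+
    then show ?thesis using mor_facts(1,3)[OF Ts Ts a(1)] by (auto simp: Bij_def bij_betw_def)
  qed
  have mult: "x \<otimes>\<^bsub>?B\<^esub> y = compose T x y" if "x \<in> Bij T" "y \<in> Bij T" for x y
    using that by (simp add: AutoGroup_def BijGroup_def)
  \<comment> \<open>Cosets of the trivial inner automorphism group are singletons, which identifies
    the quotient with the automorphism group itself.\<close>
  have coset: "?H #>\<^bsub>?B\<^esub> a = {a}" if a: "a \<in> ?A" for a
  proof -
    have b: "a \<in> extensional T" "bij_betw a T T" using bij[OF a] by (auto simp: Bij_def)
    from bij_betw_imp_funcset[OF b(2)] b(1) have "compose T (\<lambda>x\<in>T. x) a = a" by (rule Id_compose)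
    then show ?thesis unfolding H r_coset_def using mult[OF id_Bij bij[OF a]] by simp
  qed
  have "carrier (Out_F G F T) = (\<Union>a\<in>?A. {?H #>\<^bsub>?B\<^esub> a})"
    by (simp add: Out_F_def Out_quot_def FactGroup_def RCOSETS_def)
  also have "\<dots> = (\<Union>a\<in>?A. {{a}})" by (rule SUP_cong) (simp_all only: coset)
  also have "\<dots> = (\<lambda>a. {a}) ` ?A" by blast
  finally have "carrier (Out_F G F T) = (\<lambda>a. {a}) ` ?A" .
  then have "finite ((\<lambda>a. {a}) ` ?A)" using fin by simp
  then show ?thesis by (rule finite_imageD) (auto simp: inj_on_def)
qed

end

section \<open>Invariance\<close>

context saturated_fusion
begin

lemma T_subgroup: "subgroup T G" by (rule T.subgroup_axioms)

lemma Aut_TD: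
  assumes "w \<in> F_iso F T T"
  shows "w ` T = T" "inj_on w T" "w \<in> extensional T" "t \<in> T \<Longrightarrow> w t \<in> T"
    "x \<in> T \<Longrightarrow> y \<in> T \<Longrightarrow> w (x \<otimes> y) = w x \<otimes> w y" "t \<in> T \<Longrightarrow> w (t [^] (n::nat)) = w t [^] n"
proof -
  have w: "w \<in> F T T" "w ` T = T" using F_isoD(1,2)[OF T_subgroup T_subgroup assms] by simp_all
  note f = mor_facts[OF T_subgroup T_subgroup w(1)]
  show "w ` T = T" "inj_on w T" "w \<in> extensional T" using w(2) f(1,3) by simp_all
  show "t \<in> T \<Longrightarrow> w t \<in> T" using w(2) by blast
  show "x \<in> T \<Longrightarrow> y \<in> T \<Longrightarrow> w (x \<otimes> y) = w x \<otimes> w y" by (rule f(4))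
  show "t \<in> T \<Longrightarrow> w (t [^] (n::nat)) = w t [^] n" by (rule mor_pow[OF T_subgroup w(1) T_subgroup])
qed

lemma Aut_T_inverse:
  assumes "w \<in> F_iso F T T"
  obtains v where "v \<in> F_iso F T T" "\<And>t. t \<in> T \<Longrightarrow> v (w t) = t" "\<And>t. t \<in> T \<Longrightarrow> w (v t) = t"
  using F_isoD(3)[OF T_subgroup T_subgroup assms] that by (elim bexE conjE) simp

lemma mor_into_carrier:
  assumes P: "subgroup P G" and Q: "subgroup Q G" and \<phi>: "\<phi> \<in> F_iso F P Q"
  shows "\<phi> \<in> F P (carrier G)" "\<phi> ` P = Q"
proof -
  have i: "\<phi> \<in> F P Q" "\<phi> ` P = Q" using F_isoD(1,2)[OF P Q \<phi>] by simp_all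
  show "\<phi> ` P = Q" by fact
  have "\<phi> ` P \<subseteq> carrier G" using i(2) subgroup.subset[OF Q] by simp
  then show "\<phi> \<in> F P (carrier G)" by (rule mor_codomain[OF P Q subgroup_self i(1)])
qed

lemma T_subset_centralizer: "D \<subseteq> T \<Longrightarrow> T \<subseteq> centralizer G D"
  using T_comm T_carrier by (auto simp: centralizer_def)

text \<open>The abelian group \<open>T\<close> lies in the centralizer of each of its subgroups, so
  an extension over the centralizer restricts to \<open>T\<close>.\<close>

lemma extend_to_T:
  assumes D: "subgroup D G" "D \<subseteq> T" and \<sigma>: "\<sigma> \<in> F D (carrier G)" and fc: "fully_centralized p G F (\<sigma> ` D)"
  shows "\<exists>w\<in>F_iso F T T. \<forall>d\<in>D. w d = \<sigma> d"
proof -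
  obtain \<psi> where \<psi>: "\<psi> \<in> F (centralizer G D) (carrier G)" "\<forall>x\<in>D \<inter> centralizer G D. \<psi> x = \<sigma> x"
    using extend_to_centralizer[OF D(1) \<sigma> fc] by blast
  have C: "subgroup (centralizer G D) G" by (rule centralizer_subgroup[OF subgroup.subset[OF D(1)]])
  have TC: "T \<subseteq> centralizer G D" by (rule T_subset_centralizer[OF D(2)])
  have "restrict \<psi> T \<in> F_iso F T T" by (rule restrict_T_iso[OF C TC \<psi>(1)])
  moreover have "restrict \<psi> T d = \<sigma> d" if d: "d \<in> D" for d
  proof -
    have "d \<in> T" using d D(2) by blast
    then show ?thesis using \<psi>(2) TC d by auto
  qed
  ultimately show ?thesis by blast
qed

text \<open>Morphisms on divisible subgroups of \<open>T\<close> come from \<open>Aut\<^sub>F(T)\<close>: compare the extensions to \<open>T\<close> of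
  two isomorphisms onto a common fully centralized subgroup.\<close>

lemma divisible_mor_extends:
  assumes D: "subgroup D G" "D \<subseteq> T" "\<And>d. d \<in> D \<Longrightarrow> \<exists>y\<in>D. y [^] N = d" and \<psi>: "\<psi> \<in> F D (carrier G)"
  shows "\<exists>w\<in>F_iso F T T. \<forall>d\<in>D. w d = \<psi> d"
proof -
  obtain Q \<sigma> where Q: "subgroup Q G" "\<sigma> \<in> F_iso F D Q" "fully_centralized p G F Q"
    using exists_fully_centralized[OF D(1)] by blast
  let ?D = "\<psi> ` D"
  have D': "subgroup ?D G" "\<psi> \<in> F_iso F D ?D" by (rule mor_image[OF D(1) subgroup_self \<psi>])+
  \<comment> \<open>Divisibility enters here: it keeps the image of \<open>\<psi>\<close> inside
    \<open>T\<close>, so the isomorphism from this image to \<open>Q\<close> extends to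
    \<open>T\<close> as well.\<close>
  have D'T: "?D \<subseteq> T" by (rule divisible_image_T[OF D(1) \<psi> D(3)])
  obtain \<chi> where \<chi>: "\<chi> \<in> F_iso F ?D D" "\<forall>x\<in>D. \<chi> (\<psi> x) = x" using F_isoD(3)[OF D(1) D'] by blast
  have \<sigma>': "compose ?D \<sigma> \<chi> \<in> F_iso F ?D Q" by (rule F_iso_comp[OF D'(1) D(1) Q(1) \<chi>(1) Q(2)])
  obtain w where w: "w \<in> F_iso F T T" "\<forall>d\<in>D. w d = \<sigma> d"
    using extend_to_T[OF D(1,2)] mor_into_carrier[OF D(1) Q(1,2)] Q(3) by metis
  obtain w' where w': "w' \<in> F_iso F T T" "\<forall>d\<in>?D. w' d = compose ?D \<sigma> \<chi> d"
    using extend_to_T[OF D'(1) D'T] mor_into_carrier[OF D'(1) Q(1) \<sigma>'] Q(3) by metis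
  obtain v where v: "v \<in> F_iso F T T" "\<And>t. t \<in> T \<Longrightarrow> v (w' t) = t" using Aut_T_inverse[OF w'(1)] by metis
  have "compose T v w \<in> F_iso F T T" by (rule F_iso_comp[OF T_subgroup T_subgroup T_subgroup w(1) v(1)])
  moreover have "compose T v w d = \<psi> d" if d: "d \<in> D" for d
  proof -
    have pd: "\<psi> d \<in> ?D" using d by (rule imageI)
    have "w' (\<psi> d) = \<sigma> d" using w'(2) pd \<chi>(2) d by (simp add: compose_def)
    then have "v (w d) = v (w' (\<psi> d))" using w(2) d by simp
    then show ?thesis using v(2)[of "\<psi> d"] pd D'T d D(2) by (auto simp: compose_def)
  qed
  ultimately show ?thesis by blast
qed

section \<open>Cyclic subgroups and invariance of values\<close>

definition powers :: "'a \<Rightarrow> 'a set" where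
  "powers x = range (\<lambda>n::nat. x [^] n)"

lemma powers_subgroup:
  assumes x: "x \<in> carrier G"
  shows "subgroup (powers x) G"
proof (rule subgroupI)
  show "powers x \<subseteq> carrier G" "powers x \<noteq> {}" using x by (auto simp: powers_def)
  fix a assume "a \<in> powers x"
  then obtain n where a: "a = x [^] (n::nat)" by (auto simp: powers_def)
  \<comment> \<open>Torsion makes inverses nonnegative powers, so natural exponents already give the
    full cyclic group.\<close>
  obtain m where m: "m > 0" "x [^] (m::nat) = \<one>" using torsion[OF x] by blast
  then obtain k where k: "m = Suc k" using gr0_implies_Suc by blast
  have "x [^] (n * k) \<otimes> a = x [^] (m * n)" unfolding a k using x by (simp add: nat_pow_mult add.commute mult.commute)
  also have "\<dots> = \<one>" using m(2) x by (simp add: nat_pow_pow[symmetric])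
  finally have "inv a = x [^] (n * k)" using x a by (intro inv_equality) auto
  then show "inv a \<in> powers x" by (auto simp: powers_def)
  fix b assume "b \<in> powers x"
  then obtain l where "b = x [^] (l::nat)" by (auto simp: powers_def)
  then have "a \<otimes> b = x [^] (n + l)" using a x by (simp add: nat_pow_mult)
  then show "a \<otimes> b \<in> powers x" by (auto simp: powers_def)
qed

lemma powers_self: "x \<in> carrier G \<Longrightarrow> x \<in> powers x"
  unfolding powers_def by (rule range_eqI[of _ _ 1]) simp

lemma powers_subset: "subgroup H G \<Longrightarrow> x \<in> H \<Longrightarrow> powers x \<subseteq> H"
  using subgroup_pow_mem by (auto simp: powers_def)

lemma mor_powers:
  assumes P: "subgroup P G" and \<phi>: "\<phi> \<in> F P (carrier G)" and x: "x \<in> P"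
  shows "\<phi> ` powers x = powers (\<phi> x)"
  unfolding powers_def image_image using mor_pow[OF P \<phi> subgroup_self x] by simp

lemma powers_centralizer:
  assumes x: "x \<in> carrier G" and A: "A \<subseteq> carrier G" "\<And>a. a \<in> A \<Longrightarrow> x \<otimes> a = a \<otimes> x"
  shows "A \<subseteq> centralizer G (powers x)"
proof
  fix a assume a: "a \<in> A"
  have "x \<in> centralizer G A" using x A(2) by (simp add: centralizer_def)
  then have "powers x \<subseteq> centralizer G A" by (rule powers_subset[OF centralizer_subgroup[OF A(1)]])
  then have "b \<otimes> a = a \<otimes> b" if "b \<in> powers x" for b using that a by (auto simp: centralizer_def)
  then show "a \<in> centralizer G (powers x)" using a A(1) by (auto simp: centralizer_def)
qed

text \<open>A fully centralized image lets \<open>\<phi>\<close> extend over the centralizer of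
  \<open>powers x\<close>. This contains both \<open>x\<close> and \<open>norm_image x\<close>, so
  the position of \<open>x\<close> relative to its norm image can be transported.\<close>

lemma fully_centralized_invariance:
  assumes h: "\<And>w t. w \<in> F_iso F T T \<Longrightarrow> t \<in> T \<Longrightarrow> h (w t) = h t"
    and van: "\<And>x t. x \<in> carrier G \<Longrightarrow> t \<in> T \<Longrightarrow> t \<notin> norm_image x \<Longrightarrow> t [^] (N * N) \<in> norm_image x \<Longrightarrow> h t = (0 :: complex)"
    and x: "x \<in> carrier G" and \<phi>: "\<phi> \<in> F (powers x) (carrier G)" and fc: "fully_centralized p G F (\<phi> ` powers x)"
  shows "(if \<phi> x \<in> T then h (\<phi> x) else 0) = (if x \<in> T then h x else 0)"
proof -
  let ?P = "powers x"
  have P: "subgroup ?P G" by (rule powers_subgroup[OF x])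
  have xP: "x \<in> ?P" by (rule powers_self[OF x])
  show ?thesis
  proof (cases "x \<in> T")
    case True
    have "?P \<subseteq> T" by (rule powers_subset[OF T_subgroup True])
    then obtain w where w: "w \<in> F_iso F T T" "\<forall>d\<in>?P. w d = \<phi> d" using extend_to_T[OF P _ \<phi> fc] by blast
    have "\<phi> x = w x" using w(2) xP by simp
    then show ?thesis using h[OF w(1) True] Aut_TD(4)[OF w(1) True] True by simp
  next
    case False
    have "h (\<phi> x) = 0" if y: "\<phi> x \<in> T"
    proof -
      let ?C = "centralizer G ?P" and ?D = "norm_image x"
      have C: "subgroup ?C G" by (rule centralizer_subgroup[OF subgroup.subset[OF P]])
      obtain \<psi> where \<psi>: "\<psi> \<in> F ?C (carrier G)" "\<forall>z\<in>?P \<inter> ?C. \<psi> z = \<phi> z"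
        using extend_to_centralizer[OF P \<phi> fc] by blast
      have xC: "x \<in> ?C" using powers_centralizer[OF x, of "{x}"] x by simp
      have \<psi>x: "\<psi> x = \<phi> x" using \<psi>(2) xC xP by simp
      have D: "subgroup ?D G" "?D \<subseteq> T" by (rule norm_image_subgroup[OF x], rule norm_image_T[OF x])
      have DC: "?D \<subseteq> ?C"
        by (rule powers_centralizer[OF x subgroup.subset[OF D(1)] norm_image_commutes[OF x]])
      have div: "\<exists>y\<in>?D. y [^] N = d" if "d \<in> ?D" for d using norm_image_divisible[OF x that] N by blast
      have r: "restrict \<psi> ?D \<in> F ?D (carrier G)" by (rule restrict_mor[OF D(1) C subgroup_self DC \<psi>(1)])
      \<comment> \<open>Although \<open>\<psi>\<close> need not be defined on all of
        \<open>T\<close>, on the divisible group \<open>?D\<close> it agrees with an automorphism of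
        \<open>T\<close>. Its inverse \<open>v\<close> pulls \<open>\<phi> x\<close> back to
        \<open>y'\<close>, to be compared with \<open>?D\<close> itself.\<close>
      obtain w where w: "w \<in> F_iso F T T" "\<forall>d\<in>?D. w d = restrict \<psi> ?D d"
        using divisible_mor_extends[OF D div r] by blast
      then have w\<psi>: "w d = \<psi> d" if "d \<in> ?D" for d using that by simp
      obtain v where v: "v \<in> F_iso F T T" "\<And>t. t \<in> T \<Longrightarrow> w (v t) = t" using Aut_T_inverse[OF w(1)] by metis
      define y' where "y' = v (\<phi> x)"
      have y': "y' \<in> T" "w y' = \<phi> x" using Aut_TD(4)[OF v(1) y] v(2)[OF y] by (simp_all add: y'_def)
      have xq: "x [^] (N * N) \<in> ?D" by (rule pow_mem_norm_image[OF x])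
      have "w (y' [^] (N * N)) = \<phi> x [^] (N * N)" using Aut_TD(6)[OF w(1) y'(1)] y'(2) by simp
      also have "\<dots> = \<psi> (x [^] (N * N))" using mor_pow[OF C \<psi>(1) subgroup_self xC] \<psi>x by simp
      also have "\<dots> = w (x [^] (N * N))" using w\<psi>[OF xq] by simp
      finally have eq: "w (y' [^] (N * N)) = w (x [^] (N * N))" .
      have xT: "x [^] (N * N) \<in> T" using xq D(2) by (rule rev_subsetD)
      have "y' [^] (N * N) = x [^] (N * N)"
        by (rule inj_onD[OF Aut_TD(2)[OF w(1)] eq T_pow[OF y'(1)] xT])
      then have q: "y' [^] (N * N) \<in> ?D" using xq by simp
      \<comment> \<open>On \<open>?D\<close> the maps \<open>w\<close> and \<open>\<psi>\<close>
        agree, so \<open>y' \<in> ?D\<close> would give \<open>\<psi> y' = \<psi> x\<close>;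
        injectivity of \<open>\<psi>\<close> would then put \<open>x\<close> into
        \<open>T\<close>.\<close>
      have "y' \<notin> ?D"
      proof
        assume d: "y' \<in> ?D"
        have "\<psi> y' = \<psi> x" using w\<psi>[OF d] y'(2) \<psi>x by simp
        have "y' \<in> ?C" using d DC by (rule rev_subsetD)
        with \<open>\<psi> y' = \<psi> x\<close> have "y' = x" using xC by (rule inj_onD[OF mor_facts(3)[OF C subgroup_self \<psi>(1)]])
        then show False using False y'(1) by simp
      qed
      then have "h y' = 0" using van[OF x y'(1) _ q] by simp
      then show ?thesis using h[OF w(1) y'(1)] y'(2) by simp
    qed
    then show ?thesis using False by simp
  qed
qed

text \<open>Neither \<open>powers x\<close> nor its image need be fully centralized. Both map
  isomorphically onto a common fully centralized \<open>Q\<close>, sending \<open>x\<close> and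
  \<open>f x\<close> to the same element, and each value is compared with the value there.\<close>

lemma mor_invariance:
  assumes h: "\<And>w t. w \<in> F_iso F T T \<Longrightarrow> t \<in> T \<Longrightarrow> h (w t) = h t"
    and van: "\<And>x t. x \<in> carrier G \<Longrightarrow> t \<in> T \<Longrightarrow> t \<notin> norm_image x \<Longrightarrow> t [^] (N * N) \<in> norm_image x \<Longrightarrow> h t = (0 :: complex)"
    and P: "subgroup P G" and f: "f \<in> F P (carrier G)" and x: "x \<in> P"
  shows "(if f x \<in> T then h (f x) else 0) = (if x \<in> T then h x else 0)"
proof -
  let ?g = "\<lambda>x. if x \<in> T then h x else 0"
  let ?C = "powers x" and ?C' = "powers (f x)"
  have xc: "x \<in> carrier G" "f x \<in> carrier G"
    using subgroup.mem_carrier[OF P x] mor_facts(2)[OF P subgroup_self f] x by blast+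
  have C: "subgroup ?C G" "?C \<subseteq> P" "subgroup ?C' G"
    by (rule powers_subgroup[OF xc(1)], rule powers_subset[OF P x], rule powers_subgroup[OF xc(2)])
  have fr: "restrict f ?C \<in> F ?C (carrier G)" by (rule restrict_mor[OF C(1) P subgroup_self C(2) f])
  have "restrict f ?C ` ?C = ?C'" using mor_powers[OF P f x] by simp
  then have fi: "restrict f ?C \<in> F_iso F ?C ?C'" using mor_image(2)[OF C(1) subgroup_self fr] by simp
  obtain k where k: "k \<in> F_iso F ?C' ?C" "\<forall>z\<in>?C. k (restrict f ?C z) = z" using F_isoD(3)[OF C(1,3) fi] by blast
  obtain Q \<phi> where Q: "subgroup Q G" "\<phi> \<in> F_iso F ?C Q" "fully_centralized p G F Q"
    using exists_fully_centralized[OF C(1)] by blast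
  let ?\<phi>' = "compose ?C' \<phi> k"
  have \<phi>': "?\<phi>' \<in> F_iso F ?C' Q" by (rule F_iso_comp[OF C(3,1) Q(1) k(1) Q(2)])
  have e1: "?\<phi>' (f x) = \<phi> x"
    using bspec[OF k(2) powers_self[OF xc(1)]] powers_self[OF xc(1)] powers_self[OF xc(2)] by (simp add: compose_def)
  have e2: "?g (\<phi> x) = ?g x"
    by (rule fully_centralized_invariance[OF h van xc(1) mor_into_carrier(1)[OF C(1) Q(1,2)]])
      (use mor_into_carrier(2)[OF C(1) Q(1,2)] Q(3) in simp_all)
  have e3: "?g (?\<phi>' (f x)) = ?g (f x)"
    by (rule fully_centralized_invariance[OF h van xc(2) mor_into_carrier(1)[OF C(3) Q(1) \<phi>']])
      (use mor_into_carrier(2)[OF C(3) Q(1) \<phi>'] Q(3) in simp_all)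
  show ?thesis by (rule trans[OF e3[unfolded e1, symmetric] e2])
qed

text \<open>The exponent \<open>q = N * N * p\<close> serves both requirements at once: it is a
  multiple of \<open>N * N\<close>, as the norm images demand, and of \<open>p\<close>, which for
  the trivial subgroup covers the elements of order \<open>p\<close>.\<close>

lemma exists_invariant_character:
  "\<exists>h. T_character h \<and> h \<one> \<noteq> 0 \<and> (\<forall>w\<in>F_iso F T T. \<forall>t\<in>T. h (w t) = h t) \<and>
    (\<forall>x\<in>carrier G. \<forall>t\<in>T. t \<notin> norm_image x \<longrightarrow> t [^] (N * N) \<in> norm_image x \<longrightarrow> h t = 0) \<and>
    (\<forall>t\<in>T. t \<noteq> \<one> \<longrightarrow> t [^] p = \<one> \<longrightarrow> h t = 0)"
proof -
  obtain m where m: "N = p ^ m" using N by blast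
  define q where "q = p ^ (m + m + 1)"
  have q: "q = N * N * p" by (simp add: q_def m power_add)
  let ?D = "insert {\<one>} (norm_image ` carrier G)"
  have id: "(\<lambda>t\<in>T. t) \<in> F_iso F T T"
    using incl_mor[OF T_subgroup T_subgroup subset_refl] F_iso_iff[OF T_subgroup T_subgroup] by simp
  have "\<exists>h. T_character h \<and> h \<one> \<noteq> 0 \<and> (\<forall>w\<in>F_iso F T T. \<forall>t\<in>T. h (w t) = h t) \<and>
    (\<forall>D\<in>?D. \<forall>t\<in>T. t \<notin> D \<longrightarrow> t [^] q \<in> D \<longrightarrow> h t = 0)"
  proof (rule vanishing_character[OF finite_Aut_T])
    show "w \<in> extensional T" "w ` T = T" if "w \<in> F_iso F T T" for w
      by (rule Aut_TD(3)[OF that], rule Aut_TD(1)[OF that])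
    show "w (x \<otimes> y) = w x \<otimes> w y" if "w \<in> F_iso F T T" "x \<in> T" "y \<in> T" for w x y
      by (rule Aut_TD(5)[OF that])
    show "compose T w v \<in> F_iso F T T" if "v \<in> F_iso F T T" "w \<in> F_iso F T T" for v w
      by (rule F_iso_comp[OF T_subgroup T_subgroup T_subgroup that])
    show "finite ?D" using finite_norm_images by simp
    show "subgroup D G" if "D \<in> ?D" for D using that norm_image_subgroup triv_subgroup by blast
    show "D \<subseteq> T" if "D \<in> ?D" for D using that norm_image_T T.one_closed by blast
    show "\<exists>c\<in>D. c [^] q = d" if D: "D \<in> ?D" "d \<in> D" for D d
    proof (cases "D = {\<one>}")
      case False
      then obtain x where x: "x \<in> carrier G" "D = norm_image x" using D(1) by blast
      show ?thesis using norm_image_divisible[OF x(1), of d "m + m + 1"] D(2) x(2) by (simp add: q_def)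
    qed (use D(2) in simp)
    show "q = p ^ (m + m + 1)" by (simp add: q_def)
  qed (rule id)
  then obtain h where h: "T_character h" "h \<one> \<noteq> 0" "\<forall>w\<in>F_iso F T T. \<forall>t\<in>T. h (w t) = h t"
    and van: "\<forall>D\<in>?D. \<forall>t\<in>T. t \<notin> D \<longrightarrow> t [^] q \<in> D \<longrightarrow> h t = 0" by (elim exE conjE)
  have "h t = 0" if x: "x \<in> carrier G" and t: "t \<in> T" "t \<notin> norm_image x" "t [^] (N * N) \<in> norm_image x" for x t
  proof -
    have "t [^] q = (t [^] (N * N)) [^] p" unfolding q using T_carrier[OF t(1)] by (simp add: nat_pow_pow)
    then have "t [^] q \<in> norm_image x" using subgroup_pow_mem[OF norm_image_subgroup[OF x] t(3)] by simp
    then show ?thesis using van[rule_format, of "norm_image x" t] x t by simp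
  qed
  moreover have "h t = 0" if t: "t \<in> T" "t \<noteq> \<one>" "t [^] p = \<one>" for t
  proof -
    have "t [^] q = (t [^] p) [^] (N * N)" unfolding q using T_carrier[OF t(1)] by (simp add: nat_pow_pow mult.commute)
    then have "t [^] q = \<one>" using t(3) by simp
    then show ?thesis using van[rule_format, of "{\<one>}" t] t by simp
  qed
  ultimately show ?thesis using h by (intro exI[of _ h]) simp
qed

section \<open>Faithfulness and invariance of the induced representation\<close>

theorem exists_faithful_invariant_rep:
  "\<exists>n \<rho>. unitary_rep G n \<rho> \<and> faithful_rep G \<rho> \<and> fusion_preserving G F n \<rho>"
proof -
  from exists_invariant_character obtain h where h': "T_character h" "h \<one> \<noteq> 0"
    "\<forall>w\<in>F_iso F T T. \<forall>t\<in>T. h (w t) = h t"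
    "\<forall>x\<in>carrier G. \<forall>t\<in>T. t \<notin> norm_image x \<longrightarrow> t [^] (N * N) \<in> norm_image x \<longrightarrow> h t = 0"
    "\<forall>t\<in>T. t \<noteq> \<one> \<longrightarrow> t [^] p = \<one> \<longrightarrow> h t = 0"
    by (elim exE conjE)
  note h = h'(1,2) h'(3-5)[rule_format]
  obtain \<theta>s where \<theta>s: "set \<theta>s \<subseteq> T_chars" "\<And>t. t \<in> T \<Longrightarrow> h t = (\<Sum>\<theta>\<leftarrow>\<theta>s. \<theta> t)"
    using h(1) unfolding T_character_def by blast
  \<comment> \<open>Conjugation by \<open>s\<close> restricts to a morphism from \<open>T\<close> to
    itself in \<open>F\<close>, so invariance under these automorphisms includes the invariance
    under \<open>G\<close> that induction requires.\<close>
  have conj: "h (s \<otimes> t \<otimes> inv s) = h t" if s: "s \<in> carrier G" and t: "t \<in> T" for s t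
  proof -
    have "conj_map G T s ` T \<subseteq> carrier G" using s T_carrier by (auto simp: conj_map_def)
    then have "conj_map G T s \<in> F T (carrier G)" by (rule conj_mor[OF T_subgroup subgroup_self s])
    then have "restrict (conj_map G T s) T \<in> F_iso F T T" by (rule restrict_T_iso[OF T_subgroup subset_refl])
    from h(3)[OF this t] show ?thesis using t by (simp add: conj_map_def)
  qed
  obtain k n \<rho> where k: "k > (0::nat)" and \<rho>: "unitary_mat_rep G n \<rho>"
    and tr: "\<forall>s\<in>carrier G. tr (\<rho> s) = (if s \<in> T then of_nat k * h s else 0)"
    using induced_rep_of_sum[OF \<theta>s conj] by blast
  have rep: "mat_rep G n \<rho>" using \<rho> by (simp add: unitary_mat_rep_def)
  have one: "\<rho> \<one> = 1\<^sub>m n" and mult: "\<And>s s'. s \<in> carrier G \<Longrightarrow> s' \<in> carrier G \<Longrightarrow> \<rho> (s \<otimes> s') = \<rho> s * \<rho> s'"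
    using rep by (simp_all add: mat_rep_def)
  have ker: "u = \<one>" if u: "u \<in> carrier G" "\<rho> u = 1\<^sub>m n" for u
  proof (rule ccontr)
    assume ne: "u \<noteq> \<one>"
    have pow: "\<rho> (u [^] (j::nat)) = 1\<^sub>m n" for j
    proof (induction j)
      case 0 then show ?case using one by simp
    next
      case (Suc j) then show ?case using mult[of "u [^] j" u] u by simp
    qed
    \<comment> \<open>An element of the kernel has the trace of the identity, which is nonzero
      because \<open>k > 0\<close> and \<open>h \<one> \<noteq> 0\<close>; traces off
      \<open>T\<close> are zero.\<close>
    have eq: "s \<in> T \<and> h s = h \<one>" if s: "s \<in> carrier G" "\<rho> s = 1\<^sub>m n" for s
    proof -
      have "tr (\<rho> s) = tr (\<rho> \<one>)" using s(2) one by simp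
      then have "(if s \<in> T then of_nat k * h s else 0) = of_nat k * h \<one>" using tr s(1) by simp
      then show ?thesis using k h(2) by (auto split: if_splits)
    qed
    have uT: "u \<in> T" using eq[OF u] by simp
    obtain l where l: "u [^] (p ^ l) = \<one>" using T_torsion[OF uT] by blast
    \<comment> \<open>The power \<open>e\<close> just before the first trivial one has order
      \<open>p\<close> and is still in the kernel. Its value under \<open>h\<close> would be both 0
      and \<open>h \<one>\<close>.\<close>
    define j where "j = (LEAST l. u [^] (p ^ l) = \<one>)"
    have j: "u [^] (p ^ j) = \<one>" unfolding j_def using l by (rule LeastI)
    have "j \<noteq> 0" using j ne u(1) by (auto intro: ccontr)
    then obtain i where i: "j = Suc i" using not0_implies_Suc by blast
    define e where "e = u [^] (p ^ i)"
    have "e \<noteq> \<one>" using not_less_Least[of i "\<lambda>l. u [^] (p ^ l) = \<one>"] i by (simp add: j_def[symmetric] e_def)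
    moreover have "e [^] p = \<one>" using j u(1) unfolding i e_def by (simp add: nat_pow_pow mult.commute)
    moreover have "e \<in> T" unfolding e_def by (rule T_pow[OF uT])
    ultimately have "h e = 0" using h(5) by blast
    moreover have "h e = h \<one>" using eq[of e] pow u(1) by (simp add: e_def)
    ultimately show False using h(2) by simp
  qed
  have "inj_on \<rho> (carrier G)"
  proof (rule inj_onI)
    fix s s' assume s: "s \<in> carrier G" "s' \<in> carrier G" "\<rho> s = \<rho> s'"
    have "\<rho> (s \<otimes> inv s') = \<rho> (s' \<otimes> inv s')" using mult[of s "inv s'"] mult[of s' "inv s'"] s by simp
    then have "s \<otimes> inv s' = \<one>" using ker[of "s \<otimes> inv s'"] s one by simp
    then show "s = s'" using s by (metis inv_closed inv_equality inv_inv)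
  qed
  moreover have "fusion_preserving G F n \<rho>"
    unfolding fusion_preserving_def
  proof (intro allI impI ballI)
    fix P f assume P: "subgroup P G" and f: "f \<in> F P (carrier G)"
    note ff = mor_facts[OF P subgroup_self f]
    have Pc: "x \<in> carrier G" if "x \<in> P" for x using subgroup.mem_carrier[OF P that] .
    have fc: "f x \<in> carrier G" if "x \<in> P" for x using ff(2) that by blast
    interpret GP: group "G\<lparr>carrier := P\<rparr>" using subgroup.subgroup_is_group[OF P] is_group by blast
    have f1: "f \<one> = \<one>" using mor_pow[OF P f subgroup_self subgroup.one_closed[OF P], of 0] by simp
    have r: "mat_rep (G\<lparr>carrier := P\<rparr>) n \<rho>" using rep Pc by (simp add: mat_rep_def)
    have rf: "mat_rep (G\<lparr>carrier := P\<rparr>) n (\<rho> \<circ> f)" using rep fc ff(4) f1 by (simp add: mat_rep_def)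
    have "\<exists>A\<in>carrier_mat n n. det A \<noteq> 0 \<and> (\<forall>g\<in>carrier (G\<lparr>carrier := P\<rparr>). A * \<rho> g = (\<rho> \<circ> f) g * A)"
    proof (rule GP.locally_finite_equal_tr_imp_intertwiner[OF _ r rf])
      fix U assume U: "finite U" "U \<subseteq> carrier (G\<lparr>carrier := P\<rparr>)"
      then have "U \<subseteq> carrier G" using Pc by auto
      then obtain H where H: "subgroup H G" "finite H" "U \<subseteq> H" using locally_finite[OF U(1)] by blast
      \<comment> \<open>The subgroup \<open>P\<close> inherits local finiteness from the whole group
        by intersection.\<close>
      have "subgroup (H \<inter> P) (G\<lparr>carrier := P\<rparr>)"
        using subgroups_Inter_pair[OF H(1) P] by (intro subgroup_incl P) auto
      then show "\<exists>H. subgroup H (G\<lparr>carrier := P\<rparr>) \<and> finite H \<and> U \<subseteq> H" using H(2,3) U(2) by (intro exI[of _ "H \<inter> P"]) auto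
    next
      fix g assume "g \<in> carrier (G\<lparr>carrier := P\<rparr>)"
      then have g: "g \<in> P" by simp
      have "(if f g \<in> T then h (f g) else 0) = (if g \<in> T then h g else 0)" by (rule mor_invariance[OF h(3,4) P f g])
      then have "(if g \<in> T then of_nat k * h g else 0) = (if f g \<in> T then of_nat k * h (f g) else (0::complex))"
        by (auto split: if_splits)
      then show "tr (\<rho> g) = tr ((\<rho> \<circ> f) g)" using tr Pc[OF g] fc[OF g] by simp
    qed
    then show "rep_isomorphic (G\<lparr>carrier := P\<rparr>) n \<rho> (\<rho> \<circ> f)" by (auto simp: rep_isomorphic_def GL_carrier)
  qed
  ultimately show ?thesis using unitary_mat_rep_imp_unitary_rep[OF is_group \<rho>] by (auto simp: faithful_rep_def)
qed

end

theorem theorem3p7: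
  fixes p :: nat and S :: "('a, 'b) monoid_scheme" and F :: "'a mor_sets"
  assumes "Factorial_Ring.prime p" and "fusion_system p S F" and "saturated p S F"
  shows "\<exists>n \<rho>. unitary_rep S n \<rho> \<and> faithful_rep S \<rho> \<and> fusion_preserving S F n \<rho>"
proof -
  have "discrete_p_toral p S" using assms(2) by (simp add: fusion_system_def)
  then obtain T N where "p_toral_extension S T p N"
    using discrete_p_toral_imp_extension[OF assms(1)] by blast
  then interpret saturated_fusion S T p N F
    by (intro saturated_fusion.intro saturated_fusion_axioms.intro assms(2,3))
  show ?thesis by (rule exists_faithful_invariant_rep)
qed

end
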